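(* Let $\{X_i\}_{i\in\mathbb N}$ be a countable collection of subsets of $\mathbb I$ such that for each $i$ there exist a nonstandard $d$ and an injection, definable in $\mathbb M$, mapping $[0,\dots,|n|^d)$ into $X_i$. Then there exists an expansion of $\mathbb I$ (interpreting the binary relation symbol $\triangleleft$) to a model of $\mathsf{T}^1_2(\triangleleft)+\mathsf{PHP}(\Delta^b_1(\triangleleft))$ which moreover satisfies $\mathsf{DLO}(\triangleleft|_{X_i})$ for all $i\in\mathbb N$.
   Context: $\mathbb M$ is a countable nonstandard model of true arithmetic in the language $\{0,1,+,\cdot,|\cdot|,\lfloor\cdot/2\rfloor,\#,\le\}$, where $|x|$ is bit length ($|0|=0$, $|x|=\lfloor\log_2x\rfloor+1$) and $x\#y=2^{|x|\cdot|y|}$. Fix a nonstandard $n\in\mathbb M$; $[0,\dots,m)=\{0,\dots,m-1\}$. $\mathbb I$ is the substructure of $\mathbb M$ with domain $\{m:m\le2^{|n|^c}$ for some standard $c\}$. Theories: $\Sigma^b_1(\triangleleft)$ is the smallest class of bounded formulas in the language extended by $\triangleleft$ containing sharply bounded formulas (quantifiers bounded by terms $|t|$) and closed under $\land,\lor$, sharply bounded quantifiers and bounded existential quantifiers $\exists x\le t$. $\mathsf{S}^1_2(\triangleleft)$ is Buss's $\mathsf{BASIC}$ plus polynomial induction $\varphi(0)\land\forall x(\varphi(\lfloor x/2\rfloor)\to\varphi(x))\to\forall x\varphi(x)$ for $\Sigma^b_1(\triangleleft)$ formulas (with parameters); $\mathsf{T}^1_2(\triangleleft)$ adds ordinary induction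 ($x$ to $x+1$) for $\Sigma^b_1(\triangleleft)$ formulas. $\varphi$ is $\Delta^b_1(\triangleleft)$ if $\varphi\in\Sigma^b_1(\triangleleft)$ and $\mathsf{S}^1_2(\triangleleft)\vdash\varphi\leftrightarrow\neg\psi$ for some $\psi\in\Sigma^b_1(\triangleleft)$. $\mathsf{PHP}(\varphi(x,y,\bar z))$ is $\forall\bar z\forall u,v(u>v\to[\exists x<u\forall y<v\neg\varphi(x,y,\bar z)\lor\exists x\ne x'<u\exists y<v(\varphi(x,y,\bar z)\land\varphi(x',y,\bar z))\lor\exists x<u\exists y\ne y'<v(\varphi(x,y,\bar z)\land\varphi(x,y',\bar z))])$, and $\mathsf{PHP}(\Delta^b_1(\triangleleft))$ is the set of these for all $\Delta^b_1(\triangleleft)$ formulas. $\mathsf{DLO}(\triangleleft|_X)$ is the conjunction: $\forall x\in X\,\neg(x\triangleleft x)$; $\forall x,y\in X(x\ne y\to x\triangleleft y\lor y\triangleleft x)$; $\forall x,y,z\in X(x\triangleleft y\land y\triangleleft z\to x\triangleleft z)$; $\forall x\in X\exists y\in X(y\ne x\land y\triangleleft x)$; $\forall x\in X\exists y\in X(y\ne x\land x\triangleleft y)$; $\forall x,y\in X(x\triangleleft y\to\exists z\in X(x\triangleleft z\land z\triangleleft y))$. I.e. $(X,\triangleleft|_X)$ is a dense linear order without endpoints. *)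

theory Defs
  imports Complex_Main "HOL-Library.Countable_Set" "HOL-Library.Log_Nat"
begin

section \<open>Syntax\<close>

text \<open>
  Terms and formulas of the language \<open>0, 1, +, \<cdot>, |\<cdot>|, \<lfloor>\<cdot>/2\<rfloor>, #, \<le>\<close> extended by a binary relation
  symbol \<open>\<lhd>\<close>, with de Bruijn indices: inside a quantifier, \<open>Var 0\<close> is the variable it binds and
  \<open>Var (Suc k)\<close> is the variable written \<open>Var k\<close> outside.
\<close>

datatype trm =
    Var nat
  | Zero (\<open>\<^bold>0\<close>)
  | One (\<open>\<^bold>1\<close>)
  | Add trm trm (infixl \<open>\<^bold>+\<close> 65)
  | Mul trm trm (infixl \<open>\<^bold>*\<close> 70)
  | Len trm
  | Half trm
  | Smash trm trm (infixl \<open>\<^bold>#\<close> 75)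

datatype fm =
    Eq trm trm (infix \<open>\<^bold>=\<close> 50)
  | Le trm trm (infix \<open>\<^bold>\<le>\<close> 50)
  | Tri trm trm (infix \<open>\<^bold>\<lhd>\<close> 50)
  | Neg fm (\<open>\<^bold>\<not> _\<close> [40] 40)
  | And fm fm (infixr \<open>\<^bold>\<and>\<close> 35)
  | Or fm fm (infixr \<open>\<^bold>\<or>\<close> 30)
  | All fm
  | Ex fm

abbreviation Imp :: "fm \<Rightarrow> fm \<Rightarrow> fm" (infixr \<open>\<^bold>\<longrightarrow>\<close> 25) where
  "a \<^bold>\<longrightarrow> b \<equiv> \<^bold>\<not> a \<^bold>\<or> b"

abbreviation Iff :: "fm \<Rightarrow> fm \<Rightarrow> fm" (infixr \<open>\<^bold>\<longleftrightarrow>\<close> 25) where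
  "a \<^bold>\<longleftrightarrow> b \<equiv> (a \<^bold>\<longrightarrow> b) \<^bold>\<and> (b \<^bold>\<longrightarrow> a)"

abbreviation Neq :: "trm \<Rightarrow> trm \<Rightarrow> fm" (infix \<open>\<^bold>\<noteq>\<close> 50) where
  "s \<^bold>\<noteq> t \<equiv> \<^bold>\<not> (s \<^bold>= t)"

abbreviation Less :: "trm \<Rightarrow> trm \<Rightarrow> fm" (infix \<open>\<^bold><\<close> 50) where
  "s \<^bold>< t \<equiv> s \<^bold>\<le> t \<^bold>\<and> s \<^bold>\<noteq> t"

primrec L_formula :: "fm \<Rightarrow> bool" where
  "L_formula (s \<^bold>= t) = True"
| "L_formula (s \<^bold>\<le> t) = True"
| "L_formula (s \<^bold>\<lhd> t) = False"
| "L_formula (\<^bold>\<not> a) = L_formula a"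
| "L_formula (a \<^bold>\<and> b) = (L_formula a \<and> L_formula b)"
| "L_formula (a \<^bold>\<or> b) = (L_formula a \<and> L_formula b)"
| "L_formula (All a) = L_formula a"
| "L_formula (Ex a) = L_formula a"

subsection \<open>Substitution\<close>

primrec tsubst :: "(nat \<Rightarrow> trm) \<Rightarrow> trm \<Rightarrow> trm" where
  "tsubst \<sigma> (Var k) = \<sigma> k"
| "tsubst \<sigma> \<^bold>0 = \<^bold>0"
| "tsubst \<sigma> \<^bold>1 = \<^bold>1"
| "tsubst \<sigma> (s \<^bold>+ t) = tsubst \<sigma> s \<^bold>+ tsubst \<sigma> t"
| "tsubst \<sigma> (s \<^bold>* t) = tsubst \<sigma> s \<^bold>* tsubst \<sigma> t"
| "tsubst \<sigma> (Len t) = Len (tsubst \<sigma> t)"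
| "tsubst \<sigma> (Half t) = Half (tsubst \<sigma> t)"
| "tsubst \<sigma> (s \<^bold># t) = tsubst \<sigma> s \<^bold># tsubst \<sigma> t"

definition tlift :: "trm \<Rightarrow> trm" where
  "tlift = tsubst (\<lambda>k. Var (Suc k))"

definition up :: "(nat \<Rightarrow> trm) \<Rightarrow> nat \<Rightarrow> trm" where
  "up \<sigma> = case_nat (Var 0) (\<lambda>k. tlift (\<sigma> k))"

primrec subst :: "(nat \<Rightarrow> trm) \<Rightarrow> fm \<Rightarrow> fm" where
  "subst \<sigma> (s \<^bold>= t) = (tsubst \<sigma> s \<^bold>= tsubst \<sigma> t)"
| "subst \<sigma> (s \<^bold>\<le> t) = (tsubst \<sigma> s \<^bold>\<le> tsubst \<sigma> t)"
| "subst \<sigma> (s \<^bold>\<lhd> t) = (tsubst \<sigma> s \<^bold>\<lhd> tsubst \<sigma> t)"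
| "subst \<sigma> (\<^bold>\<not> a) = (\<^bold>\<not> subst \<sigma> a)"
| "subst \<sigma> (a \<^bold>\<and> b) = (subst \<sigma> a \<^bold>\<and> subst \<sigma> b)"
| "subst \<sigma> (a \<^bold>\<or> b) = (subst \<sigma> a \<^bold>\<or> subst \<sigma> b)"
| "subst \<sigma> (All a) = All (subst (up \<sigma>) a)"
| "subst \<sigma> (Ex a) = Ex (subst (up \<sigma>) a)"

definition lift :: "fm \<Rightarrow> fm" where
  "lift = subst (\<lambda>k. Var (Suc k))"

definition inst :: "trm \<Rightarrow> fm \<Rightarrow> fm" where
  "inst t = subst (case_nat t Var)"

text \<open>
  The lifting of the bound \<open>t\<close> enforces that the quantified variable does not occur in it.
\<close>

abbreviation BAll :: "trm \<Rightarrow> fm \<Rightarrow> fm" where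
  "BAll t a \<equiv> All (Var 0 \<^bold>\<le> tlift t \<^bold>\<longrightarrow> a)"

abbreviation BEx :: "trm \<Rightarrow> fm \<Rightarrow> fm" where
  "BEx t a \<equiv> Ex (Var 0 \<^bold>\<le> tlift t \<^bold>\<and> a)"

abbreviation BAll_less :: "trm \<Rightarrow> fm \<Rightarrow> fm" where
  "BAll_less t a \<equiv> All (Var 0 \<^bold>< tlift t \<^bold>\<longrightarrow> a)"

abbreviation BEx_less :: "trm \<Rightarrow> fm \<Rightarrow> fm" where
  "BEx_less t a \<equiv> Ex (Var 0 \<^bold>< tlift t \<^bold>\<and> a)"


section \<open>Structures\<close>

record 'a L_structure =
  univ :: "'a set"
  zer :: 'a
  un :: 'a
  add :: "'a \<Rightarrow> 'a \<Rightarrow> 'a"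
  mul :: "'a \<Rightarrow> 'a \<Rightarrow> 'a"
  len :: "'a \<Rightarrow> 'a"
  half :: "'a \<Rightarrow> 'a"
  smash :: "'a \<Rightarrow> 'a \<Rightarrow> 'a"
  leq :: "'a \<Rightarrow> 'a \<Rightarrow> bool"

definition is_structure :: "'a L_structure \<Rightarrow> bool" where
  "is_structure M \<longleftrightarrow>
     zer M \<in> univ M \<and> un M \<in> univ M \<and>
     (\<forall>x\<in>univ M. len M x \<in> univ M \<and> half M x \<in> univ M) \<and>
     (\<forall>x\<in>univ M. \<forall>y\<in>univ M. add M x y \<in> univ M \<and> mul M x y \<in> univ M \<and> smash M x y \<in> univ M)"

primrec tval :: "'a L_structure \<Rightarrow> (nat \<Rightarrow> 'a) \<Rightarrow> trm \<Rightarrow> 'a" where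
  "tval M e (Var k) = e k"
| "tval M e \<^bold>0 = zer M"
| "tval M e \<^bold>1 = un M"
| "tval M e (s \<^bold>+ t) = add M (tval M e s) (tval M e t)"
| "tval M e (s \<^bold>* t) = mul M (tval M e s) (tval M e t)"
| "tval M e (Len t) = len M (tval M e t)"
| "tval M e (Half t) = half M (tval M e t)"
| "tval M e (s \<^bold># t) = smash M (tval M e s) (tval M e t)"

text \<open>
  Satisfaction in the expansion of \<open>M\<close> in which \<open>\<lhd>\<close> is interpreted by \<open>R\<close> (restricted to
  \<open>univ M\<close>), under the assignment \<open>e\<close>.
\<close>

primrec sat :: "'a L_structure \<Rightarrow> ('a \<Rightarrow> 'a \<Rightarrow> bool) \<Rightarrow> (nat \<Rightarrow> 'a) \<Rightarrow> fm \<Rightarrow> bool" where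
  "sat M R e (s \<^bold>= t) = (tval M e s = tval M e t)"
| "sat M R e (s \<^bold>\<le> t) = leq M (tval M e s) (tval M e t)"
| "sat M R e (s \<^bold>\<lhd> t) = R (tval M e s) (tval M e t)"
| "sat M R e (\<^bold>\<not> a) = (\<not> sat M R e a)"
| "sat M R e (a \<^bold>\<and> b) = (sat M R e a \<and> sat M R e b)"
| "sat M R e (a \<^bold>\<or> b) = (sat M R e a \<or> sat M R e b)"
| "sat M R e (All a) = (\<forall>x\<in>univ M. sat M R (case_nat x e) a)"
| "sat M R e (Ex a) = (\<exists>x\<in>univ M. sat M R (case_nat x e) a)"

text \<open>For formulas without \<open>\<lhd>\<close> the interpretation of \<open>\<lhd>\<close> is immaterial.\<close>

abbreviation L_sat :: "'a L_structure \<Rightarrow> (nat \<Rightarrow> 'a) \<Rightarrow> fm \<Rightarrow> bool" where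
  "L_sat M e a \<equiv> sat M (\<lambda>_ _. False) e a"

text \<open>
  A theory is a set of formulas, each of which stands for its universal closure.
\<close>

definition is_model :: "'a L_structure \<Rightarrow> ('a \<Rightarrow> 'a \<Rightarrow> bool) \<Rightarrow> fm set \<Rightarrow> bool" where
  "is_model M R T \<longleftrightarrow>
     is_structure M \<and> (\<forall>a\<in>T. \<forall>e. range e \<subseteq> univ M \<longrightarrow> sat M R e a)"

text \<open>\<^const>\<open>floorlog\<close> \<open>2\<close> is the bit length, with value \<open>0\<close> at \<open>0\<close>.\<close>

definition nat_structure :: "nat L_structure" where
  "nat_structure = \<lparr>univ = UNIV, zer = 0, un = 1, add = (+), mul = (*),
     len = floorlog 2, half = (\<lambda>x. x div 2), smash = (\<lambda>x y. 2 ^ (floorlog 2 x * floorlog 2 y)),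
     leq = (\<le>)\<rparr>"

definition true_arithmetic :: "fm set" where
  "true_arithmetic = {a. L_formula a \<and> (\<forall>e. L_sat nat_structure e a)}"

abbreviation models_true_arithmetic :: "'a L_structure \<Rightarrow> bool" where
  "models_true_arithmetic M \<equiv> is_model M (\<lambda>_ _. False) true_arithmetic"

primrec standard :: "'a L_structure \<Rightarrow> nat \<Rightarrow> 'a" where
  "standard M 0 = zer M"
| "standard M (Suc k) = add M (standard M k) (un M)"

definition nonstandard :: "'a L_structure \<Rightarrow> 'a \<Rightarrow> bool" where
  "nonstandard M x \<longleftrightarrow> x \<in> univ M \<and> x \<notin> range (standard M)"

text \<open>
  Exponentiation in a model \<open>M\<close> of true arithmetic is given by any \<open>\<lhd>\<close>-free formula that defines
  the graph of \<open>x ^ y\<close> in the natural numbers. All these formulas are equivalent in \<open>M\<close>, so neither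
  the choice of the formula nor that of the assignment beyond the first three variables matters.
\<close>

definition defines_power :: "fm \<Rightarrow> bool" where
  "defines_power a \<longleftrightarrow>
     L_formula a \<and> (\<forall>e. L_sat nat_structure e a \<longleftrightarrow> e 2 = e 0 ^ e 1)"

definition is_power :: "'a L_structure \<Rightarrow> 'a \<Rightarrow> 'a \<Rightarrow> 'a \<Rightarrow> bool" where
  "is_power M x y z \<longleftrightarrow>
     (\<exists>a e. defines_power a \<and> range e \<subseteq> univ M \<and> e 0 = x \<and> e 1 = y \<and> e 2 = z \<and> L_sat M e a)"

definition below :: "'a L_structure \<Rightarrow> 'a \<Rightarrow> 'a set" where
  "below M p = {x \<in> univ M. leq M x p \<and> x \<noteq> p}"

definition small_cut :: "'a L_structure \<Rightarrow> 'a \<Rightarrow> 'a L_structure" where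
  "small_cut M n = M\<lparr>univ := {m \<in> univ M. \<exists>c p q. is_power M (len M n) (standard M c) p \<and>
     is_power M (standard M 2) p q \<and> leq M m q}\<rparr>"

text \<open>Definability in \<open>M\<close> allows parameters; these are the values of the assignment \<open>e\<close>.\<close>

definition definable_rel :: "'a L_structure \<Rightarrow> ('a \<times> 'a) set \<Rightarrow> bool" where
  "definable_rel M S \<longleftrightarrow>
     (\<exists>a e. L_formula a \<and> range e \<subseteq> univ M \<and>
        S = {(x, y) \<in> univ M \<times> univ M. L_sat M (case_nat x (case_nat y e)) a})"

definition definable_injection :: "'a L_structure \<Rightarrow> ('a \<Rightarrow> 'a) \<Rightarrow> 'a set \<Rightarrow> 'a set \<Rightarrow> bool" where
  "definable_injection M f A B \<longleftrightarrow>
     f ` A \<subseteq> B \<and> inj_on f A \<and> definable_rel M {(x, f x) | x. x \<in> A}"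

definition DLO :: "'a set \<Rightarrow> ('a \<Rightarrow> 'a \<Rightarrow> bool) \<Rightarrow> bool" where
  "DLO X R \<longleftrightarrow>
     (\<forall>x\<in>X. \<not> R x x) \<and>
     (\<forall>x\<in>X. \<forall>y\<in>X. x \<noteq> y \<longrightarrow> R x y \<or> R y x) \<and>
     (\<forall>x\<in>X. \<forall>y\<in>X. \<forall>z\<in>X. R x y \<and> R y z \<longrightarrow> R x z) \<and>
     (\<forall>x\<in>X. \<exists>y\<in>X. y \<noteq> x \<and> R y x) \<and>
     (\<forall>x\<in>X. \<exists>y\<in>X. y \<noteq> x \<and> R x y) \<and>
     (\<forall>x\<in>X. \<forall>y\<in>X. R x y \<longrightarrow> (\<exists>z\<in>X. R x z \<and> R z y))"


section \<open>Provability\<close>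

text \<open>
  A Hilbert-style calculus for first-order logic with equality, in the style of Shoenfield's: all
  propositional tautologies, instantiation axioms, rules introducing a quantifier, and equality
  axioms. Formulas derived from a theory are, like its axioms, read as universally closed.
\<close>

fun prop_val :: "(fm \<Rightarrow> bool) \<Rightarrow> fm \<Rightarrow> bool" where
  "prop_val v (\<^bold>\<not> a) = (\<not> prop_val v a)"
| "prop_val v (a \<^bold>\<and> b) = (prop_val v a \<and> prop_val v b)"
| "prop_val v (a \<^bold>\<or> b) = (prop_val v a \<or> prop_val v b)"
| "prop_val v a = v a"

definition tautology :: "fm \<Rightarrow> bool" where
  "tautology a \<longleftrightarrow> (\<forall>v. prop_val v a)"

inductive provable :: "fm set \<Rightarrow> fm \<Rightarrow> bool" (infix \<open>\<^bold>\<turnstile>\<close> 20) for T :: "fm set" where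
  axiom: "a \<in> T \<Longrightarrow> T \<^bold>\<turnstile> a"
| taut: "tautology a \<Longrightarrow> T \<^bold>\<turnstile> a"
| mp: "T \<^bold>\<turnstile> a \<^bold>\<longrightarrow> b \<Longrightarrow> T \<^bold>\<turnstile> a \<Longrightarrow> T \<^bold>\<turnstile> b"
| all_elim: "T \<^bold>\<turnstile> All a \<^bold>\<longrightarrow> inst t a"
| ex_intro: "T \<^bold>\<turnstile> inst t a \<^bold>\<longrightarrow> Ex a"
| all_rule: "T \<^bold>\<turnstile> lift b \<^bold>\<longrightarrow> a \<Longrightarrow> T \<^bold>\<turnstile> b \<^bold>\<longrightarrow> All a"
| ex_rule: "T \<^bold>\<turnstile> a \<^bold>\<longrightarrow> lift b \<Longrightarrow> T \<^bold>\<turnstile> Ex a \<^bold>\<longrightarrow> b"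
| eq_refl: "T \<^bold>\<turnstile> t \<^bold>= t"
| eq_subst: "T \<^bold>\<turnstile> s \<^bold>= t \<^bold>\<longrightarrow> inst s a \<^bold>\<longrightarrow> inst t a"


section \<open>Bounded arithmetic\<close>

inductive sharply_bounded :: "fm \<Rightarrow> bool" where
  "sharply_bounded (s \<^bold>= t)"
| "sharply_bounded (s \<^bold>\<le> t)"
| "sharply_bounded (s \<^bold>\<lhd> t)"
| "sharply_bounded a \<Longrightarrow> sharply_bounded (\<^bold>\<not> a)"
| "sharply_bounded a \<Longrightarrow> sharply_bounded b \<Longrightarrow> sharply_bounded (a \<^bold>\<and> b)"
| "sharply_bounded a \<Longrightarrow> sharply_bounded b \<Longrightarrow> sharply_bounded (a \<^bold>\<or> b)"
| "sharply_bounded a \<Longrightarrow> sharply_bounded (BAll (Len t) a)"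
| "sharply_bounded a \<Longrightarrow> sharply_bounded (BEx (Len t) a)"

inductive Sigma_b1 :: "fm \<Rightarrow> bool" where
  "sharply_bounded a \<Longrightarrow> Sigma_b1 a"
| "Sigma_b1 a \<Longrightarrow> Sigma_b1 b \<Longrightarrow> Sigma_b1 (a \<^bold>\<and> b)"
| "Sigma_b1 a \<Longrightarrow> Sigma_b1 b \<Longrightarrow> Sigma_b1 (a \<^bold>\<or> b)"
| "Sigma_b1 a \<Longrightarrow> Sigma_b1 (BAll (Len t) a)"
| "Sigma_b1 a \<Longrightarrow> Sigma_b1 (BEx (Len t) a)"
| "Sigma_b1 a \<Longrightarrow> Sigma_b1 (BEx t a)"

text \<open>
  Buss's 32 axioms in his order, with \<open>x + 1\<close> for the successor of \<open>x\<close> and \<open>1 + 1\<close> for \<open>2\<close>.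
\<close>

definition BASIC :: "fm set" where
  "BASIC =
    (let x = Var 0; y = Var 1; z = Var 2; u = Var 3; v = Var 4; two = \<^bold>1 \<^bold>+ \<^bold>1 in
     { y \<^bold>\<le> x \<^bold>\<longrightarrow> y \<^bold>\<le> x \<^bold>+ \<^bold>1,
       x \<^bold>\<noteq> x \<^bold>+ \<^bold>1,
       \<^bold>0 \<^bold>\<le> x,
       x \<^bold>\<le> y \<^bold>\<and> x \<^bold>\<noteq> y \<^bold>\<longleftrightarrow> x \<^bold>+ \<^bold>1 \<^bold>\<le> y,
       x \<^bold>\<noteq> \<^bold>0 \<^bold>\<longrightarrow> two \<^bold>* x \<^bold>\<noteq> \<^bold>0,
       y \<^bold>\<le> x \<^bold>\<or> x \<^bold>\<le> y,
       x \<^bold>\<le> y \<^bold>\<and> y \<^bold>\<le> x \<^bold>\<longrightarrow> x \<^bold>= y,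
       x \<^bold>\<le> y \<^bold>\<and> y \<^bold>\<le> z \<^bold>\<longrightarrow> x \<^bold>\<le> z,
       Len \<^bold>0 \<^bold>= \<^bold>0,
       x \<^bold>\<noteq> \<^bold>0 \<^bold>\<longrightarrow> Len (two \<^bold>* x) \<^bold>= Len x \<^bold>+ \<^bold>1 \<^bold>\<and> Len (two \<^bold>* x \<^bold>+ \<^bold>1) \<^bold>= Len x \<^bold>+ \<^bold>1,
       Len \<^bold>1 \<^bold>= \<^bold>1,
       x \<^bold>\<le> y \<^bold>\<longrightarrow> Len x \<^bold>\<le> Len y,
       Len (x \<^bold># y) \<^bold>= Len x \<^bold>* Len y \<^bold>+ \<^bold>1,
       \<^bold>0 \<^bold># y \<^bold>= \<^bold>1,
       x \<^bold>\<noteq> \<^bold>0 \<^bold>\<longrightarrow> \<^bold>1 \<^bold># (two \<^bold>* x) \<^bold>= two \<^bold>* (\<^bold>1 \<^bold># x) \<^bold>\<and> \<^bold>1 \<^bold># (two \<^bold>* x \<^bold>+ \<^bold>1) \<^bold>= two \<^bold>* (\<^bold>1 \<^bold># x),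
       x \<^bold># y \<^bold>= y \<^bold># x,
       Len x \<^bold>= Len y \<^bold>\<longrightarrow> x \<^bold># z \<^bold>= y \<^bold># z,
       Len x \<^bold>= Len u \<^bold>+ Len v \<^bold>\<longrightarrow> x \<^bold># y \<^bold>= (u \<^bold># y) \<^bold>* (v \<^bold># y),
       x \<^bold>\<le> x \<^bold>+ y,
       x \<^bold>\<le> y \<^bold>\<and> x \<^bold>\<noteq> y \<^bold>\<longrightarrow> two \<^bold>* x \<^bold>+ \<^bold>1 \<^bold>\<le> two \<^bold>* y \<^bold>\<and> two \<^bold>* x \<^bold>+ \<^bold>1 \<^bold>\<noteq> two \<^bold>* y,
       x \<^bold>+ y \<^bold>= y \<^bold>+ x,
       x \<^bold>+ \<^bold>0 \<^bold>= x,
       x \<^bold>+ (y \<^bold>+ \<^bold>1) \<^bold>= (x \<^bold>+ y) \<^bold>+ \<^bold>1,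
       (x \<^bold>+ y) \<^bold>+ z \<^bold>= x \<^bold>+ (y \<^bold>+ z),
       x \<^bold>+ y \<^bold>\<le> x \<^bold>+ z \<^bold>\<longleftrightarrow> y \<^bold>\<le> z,
       x \<^bold>* \<^bold>0 \<^bold>= \<^bold>0,
       x \<^bold>* (y \<^bold>+ \<^bold>1) \<^bold>= x \<^bold>* y \<^bold>+ x,
       x \<^bold>* y \<^bold>= y \<^bold>* x,
       x \<^bold>* (y \<^bold>+ z) \<^bold>= x \<^bold>* y \<^bold>+ x \<^bold>* z,
       \<^bold>1 \<^bold>\<le> x \<^bold>\<longrightarrow> (x \<^bold>* y \<^bold>\<le> x \<^bold>* z \<^bold>\<longleftrightarrow> y \<^bold>\<le> z),
       x \<^bold>\<noteq> \<^bold>0 \<^bold>\<longrightarrow> Len x \<^bold>= Len (Half x) \<^bold>+ \<^bold>1,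
       x \<^bold>= Half y \<^bold>\<longleftrightarrow> two \<^bold>* x \<^bold>= y \<^bold>\<or> two \<^bold>* x \<^bold>+ \<^bold>1 \<^bold>= y })"

text \<open>
  In the induction schemes \<open>Var 0\<close> is the induction variable and all others are parameters.
\<close>

definition PIND :: "fm \<Rightarrow> fm" where
  "PIND a = (inst \<^bold>0 a \<^bold>\<and> All (subst (case_nat (Half (Var 0)) (\<lambda>k. Var (Suc k))) a \<^bold>\<longrightarrow> a) \<^bold>\<longrightarrow> All a)"

definition IND :: "fm \<Rightarrow> fm" where
  "IND a = (inst \<^bold>0 a \<^bold>\<and> All (a \<^bold>\<longrightarrow> subst (case_nat (Var 0 \<^bold>+ \<^bold>1) (\<lambda>k. Var (Suc k))) a) \<^bold>\<longrightarrow> All a)"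

definition S12 :: "fm set" where
  "S12 = BASIC \<union> {PIND a | a. Sigma_b1 a}"

definition T12 :: "fm set" where
  "T12 = S12 \<union> {IND a | a. Sigma_b1 a}"

definition Delta_b1 :: "fm \<Rightarrow> bool" where
  "Delta_b1 a \<longleftrightarrow> Sigma_b1 a \<and> (\<exists>b. Sigma_b1 b \<and> (S12 \<^bold>\<turnstile> a \<^bold>\<longleftrightarrow> \<^bold>\<not> b))"

text \<open>
  In \<open>a\<close> the variables \<open>x\<close> and \<open>y\<close> are \<open>Var 0\<close> and \<open>Var 1\<close>, and \<open>Var (Suc (Suc k))\<close> is the
  parameter \<open>z\<^sub>k\<close>. \<open>app2 d a s t\<close> is \<open>a(s, t, z)\<close> written under \<open>d\<close> quantifiers, where \<open>z\<^sub>k\<close> has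
  become \<open>Var (k + d)\<close>.
\<close>

definition app2 :: "nat \<Rightarrow> fm \<Rightarrow> trm \<Rightarrow> trm \<Rightarrow> fm" where
  "app2 d a s t = subst (case_nat s (case_nat t (\<lambda>k. Var (k + d)))) a"

text \<open>
  The variables \<open>u\<close> and \<open>v\<close> are bound by the two outer quantifiers. In the three disjuncts the
  variables from the innermost outwards are \<open>y, x, v, u\<close>, then \<open>y, x', x, v, u\<close>, then
  \<open>y', y, x, v, u\<close>. The quantifiers over the parameters are implicit.
\<close>

definition PHP :: "fm \<Rightarrow> fm" where
  "PHP a = All (All (Var 0 \<^bold>< Var 1 \<^bold>\<longrightarrow>
     BEx_less (Var 1) (BAll_less (Var 1) (\<^bold>\<not> app2 4 a (Var 1) (Var 0)))
   \<^bold>\<or> BEx_less (Var 1) (BEx_less (Var 2) (Var 1 \<^bold>\<noteq> Var 0 \<^bold>\<and>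
       BEx_less (Var 2) (app2 5 a (Var 2) (Var 0) \<^bold>\<and> app2 5 a (Var 1) (Var 0))))
   \<^bold>\<or> BEx_less (Var 1) (BEx_less (Var 1) (BEx_less (Var 2) (Var 1 \<^bold>\<noteq> Var 0 \<^bold>\<and>
       (app2 5 a (Var 2) (Var 1) \<^bold>\<and> app2 5 a (Var 2) (Var 0)))))))"

definition PHP_Delta_b1 :: "fm set" where
  "PHP_Delta_b1 = {PHP a | a. Delta_b1 a}"

end

theory Submission
  imports Defs "HOL-Library.Nat_Bijection"
begin

text \<open>
  The order is built by forcing. A condition is a linear order, coded in the model, of an
  initial segment that contains the cut, of which only the restriction to a coded set \<open>D\<close> of size \<open>|n|\<^sup>c\<close>, \<open>c\<close>
  standard, matters; an extension enlarges \<open>D\<close> and keeps the order on the old \<open>D\<close>. It forces a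
  formula if all coded linear orders that agree with it on \<open>D\<close> satisfy the formula. A true
  \<open>\<Sigma>\<^sup>b\<^sub>1(\<lhd>)\<close> formula is certified by a set \<open>D\<close> of size \<open>|n|\<^sup>c\<close>, hence counterexamples to
  induction are avoided by choosing the largest \<open>x\<close> for which some small extension forces the
  formula, a choice which is possible because forcing is definable in the model.

  For the pigeonhole principle, suppose no small extension refutes totality, injectivity or
  functionality. Certificates for different values at the same \<open>x\<close> cannot be amalgamated, so
  they share a point outside of the condition. A decision tree of polynomial depth hence determines
  a unique value for each \<open>x\<close> along one fixed coded order, which gives a coded injection from \<open>u\<close>
  to \<open>v < u\<close>. Density of the orders holds since
  \<open>X\<^sub>i\<close> contains a definable copy of \<open>|n|\<^sup>d\<close> with \<open>d\<close> nonstandard and so is not covered by \<open>D\<close>.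

  The combinatorics is done for finite sets of natural numbers, coded by their binary digits, and
  transferred to the model as first-order sentences of true arithmetic.
\<close>

text \<open>The cut is not definable in the model, whereas choosing a largest \<open>x\<close> and
  counting are possible only for definable notions. Hence conditions order a segment below an
  element \<open>B\<close> above the cut, forcing evaluates formulas in the whole model, and
  standardness of \<open>c\<close> never enters a transferred statement: what is transferred is that
  a set of size \<open>m\<close> can be enlarged to one of size \<open>m ^ c\<close> that meets a
  requirement, with one fixed \<open>c\<close> for each requirement. Passing to the cut afterwards
  is harmless since the quantifiers concerned are bounded by terms, and the cut is closed downwards
  and under terms.

  Certificates exist only for true formulas; a false one need not have a small refutation. The
  arguments are therefore arranged so that negative outcomes come for free, by maximality or because
  no order agreeing with the condition satisfies the formula, and only positive outcomes cost
  points. Countability of the model lets a single increasing sequence of conditions meet all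
  requirements.\<close>

abbreviation \<N> :: "nat L_structure" where
  "\<N> \<equiv> nat_structure"

section \<open>Simultaneous definability in the natural numbers and in a structure\<close>

definition same_term :: "'a L_structure \<Rightarrow> ((nat \<Rightarrow> nat) \<Rightarrow> nat) \<Rightarrow> ((nat \<Rightarrow> 'a) \<Rightarrow> 'a) \<Rightarrow> bool" where
  "same_term M f g \<longleftrightarrow> (\<exists>t. (\<forall>e. f e = tval \<N> e t) \<and>
     (\<forall>e. range e \<subseteq> univ M \<longrightarrow> g e = tval M e t))"

definition same_env ::
  "'a L_structure \<Rightarrow> ((nat \<Rightarrow> nat) \<Rightarrow> nat \<Rightarrow> nat) \<Rightarrow> ((nat \<Rightarrow> 'a) \<Rightarrow> nat \<Rightarrow> 'a) \<Rightarrow> bool" where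
  "same_env M F G \<longleftrightarrow> (\<forall>k. same_term M (\<lambda>e. F e k) (\<lambda>e. G e k))"

text \<open>Lets a notion that is written once for arbitrary structures be transferred without
  spelling out its formula: the closure rules below build the formula along the HOL definition. On
  the side of \<open>M\<close> only assignments into the universe count, as the operations may
  behave arbitrarily outside of it.\<close>

definition same_fm :: "'a L_structure \<Rightarrow> ((nat \<Rightarrow> nat) \<Rightarrow> bool) \<Rightarrow> ((nat \<Rightarrow> 'a) \<Rightarrow> bool) \<Rightarrow> bool" where
  "same_fm M P Q \<longleftrightarrow> (\<exists>a. L_formula a \<and> (\<forall>e. P e = L_sat \<N> e a) \<and>
     (\<forall>e. range e \<subseteq> univ M \<longrightarrow> Q e = L_sat M e a))"

lemma nat_structure_simps [simp]:
  "univ \<N> = UNIV" "zer \<N> = 0" "un \<N> = 1"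
  "add \<N> = (+)" "mul \<N> = (*)" "len \<N> = floorlog 2"
  "half \<N> = (\<lambda>x. x div 2)" "leq \<N> = (\<le>)"
  "smash \<N> = (\<lambda>x y. 2 ^ (floorlog 2 x * floorlog 2 y))"
  by (simp_all add: nat_structure_def)

lemma tval_closed: "is_structure M \<Longrightarrow> range e \<subseteq> univ M \<Longrightarrow> tval M e t \<in> univ M"
  by (induction t) (auto simp: is_structure_def)

lemma case_nat_shift: "case_nat (e 0) (\<lambda>k. e (Suc k)) = e"
  by (auto simp: fun_eq_iff split: nat.split)

lemma range_case_nat: "range (case_nat x e) \<subseteq> A \<longleftrightarrow> x \<in> A \<and> range e \<subseteq> A"
proof
  assume *: "range (case_nat x e) \<subseteq> A"
  have "e k \<in> A" for k using subsetD[OF * rangeI[of _ "Suc k"]] by simp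
  then show "x \<in> A \<and> range e \<subseteq> A" using subsetD[OF * rangeI[of _ 0]] by auto
next
  assume "x \<in> A \<and> range e \<subseteq> A"
  then have "case_nat x e k \<in> A" for k by (cases k) auto
  then show "range (case_nat x e) \<subseteq> A" by auto
qed

lemma transferI:
  assumes "models_true_arithmetic M" "same_fm M P Q" "\<And>e. P e" "range e \<subseteq> univ M"
  shows "Q e"
proof -
  obtain a where a: "L_formula a" "\<And>e. P e = L_sat \<N> e a"
     "\<And>e. range e \<subseteq> univ M \<Longrightarrow> Q e = L_sat M e a"
    using assms(2) by (auto simp: same_fm_def)
  then have "a \<in> true_arithmetic" using assms(3) by (simp add: true_arithmetic_def)
  then show ?thesis using assms(1,4) a(3) by (auto simp: is_model_def)
qed

lemma same_term_var: "same_term M (\<lambda>e. e k) (\<lambda>e. e k)"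
  unfolding same_term_def by (rule exI[of _ "Var k"]) simp

lemma same_term_zer: "same_term M (\<lambda>e. zer \<N>) (\<lambda>e. zer M)"
  unfolding same_term_def by (rule exI[of _ Zero]) simp

lemma same_term_un: "same_term M (\<lambda>e. un \<N>) (\<lambda>e. un M)"
  unfolding same_term_def by (rule exI[of _ One]) simp

lemma same_term_binary:
  assumes "same_term M f g" "same_term M f' g'"
    and "\<And>e s t. tval \<N> e (C s t) = h (tval \<N> e s) (tval \<N> e t)"
    and "\<And>e s t. tval M e (C s t) = k (tval M e s) (tval M e t)"
  shows "same_term M (\<lambda>e. h (f e) (f' e)) (\<lambda>e. k (g e) (g' e))"
proof -
  obtain t t' where "\<forall>e. f e = tval \<N> e t" "\<forall>e. range e \<subseteq> univ M \<longrightarrow> g e = tval M e t"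
    "\<forall>e. f' e = tval \<N> e t'" "\<forall>e. range e \<subseteq> univ M \<longrightarrow> g' e = tval M e t'"
    using assms(1,2) by (auto simp: same_term_def)
  then show ?thesis unfolding same_term_def by (intro exI[of _ "C t t'"]) (simp add: assms(3,4))
qed

lemma same_term_unary:
  assumes "same_term M f g"
    and "\<And>e t. tval \<N> e (C t) = h (tval \<N> e t)"
    and "\<And>e t. tval M e (C t) = k (tval M e t)"
  shows "same_term M (\<lambda>e. h (f e)) (\<lambda>e. k (g e))"
  using same_term_binary[OF assms(1,1), of "\<lambda>s t. C s" "\<lambda>x y. h x" "\<lambda>x y. k x"] assms(2,3) by simp

lemma same_term_add: "same_term M f g \<Longrightarrow> same_term M f' g' \<Longrightarrow>
    same_term M (\<lambda>e. add \<N> (f e) (f' e)) (\<lambda>e. add M (g e) (g' e))"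
  by (erule (1) same_term_binary[of _ _ _ _ _ Add]) simp_all

lemma same_term_mul: "same_term M f g \<Longrightarrow> same_term M f' g' \<Longrightarrow>
    same_term M (\<lambda>e. mul \<N> (f e) (f' e)) (\<lambda>e. mul M (g e) (g' e))"
  by (erule (1) same_term_binary[of _ _ _ _ _ Mul]) simp_all

lemma same_term_smash: "same_term M f g \<Longrightarrow> same_term M f' g' \<Longrightarrow>
    same_term M (\<lambda>e. smash \<N> (f e) (f' e)) (\<lambda>e. smash M (g e) (g' e))"
  by (erule (1) same_term_binary[of _ _ _ _ _ Smash]) simp_all

lemma same_term_len:
  "same_term M f g \<Longrightarrow> same_term M (\<lambda>e. len \<N> (f e)) (\<lambda>e. len M (g e))"
  by (erule same_term_unary[of _ _ _ Len]) simp_all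

lemma same_term_half:
  "same_term M f g \<Longrightarrow> same_term M (\<lambda>e. half \<N> (f e)) (\<lambda>e. half M (g e))"
  by (erule same_term_unary[of _ _ _ Half]) simp_all

lemma same_env_var: "same_env M (\<lambda>e k. e (s k)) (\<lambda>e k. e (s k))"
  by (simp add: same_env_def same_term_var)

lemma same_env_case_nat:
  assumes "same_term M f g" "same_env M F G"
  shows "same_env M (\<lambda>e. case_nat (f e) (F e)) (\<lambda>e. case_nat (g e) (G e))"
  unfolding same_env_def
proof
  fix k show "same_term M (\<lambda>e. case_nat (f e) (F e) k) (\<lambda>e. case_nat (g e) (G e) k)"
    using assms by (cases k) (simp_all add: same_env_def)
qed

lemma same_term_tval:
  "same_env M F G \<Longrightarrow> same_term M (\<lambda>e. tval \<N> (F e) t) (\<lambda>e. tval M (G e) t)"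
proof (induction t)
  case (Var k) then show ?case by (simp add: same_env_def)
next
  case Zero then show ?case using same_term_zer by simp
next
  case One then show ?case using same_term_un by simp
next
  case (Add t1 t2) then show ?case using same_term_add by simp
next
  case (Mul t1 t2) then show ?case using same_term_mul by simp
next
  case (Smash t1 t2) then show ?case using same_term_smash[OF Smash.IH] by simp
next
  case (Len t) then show ?case using same_term_len by simp
next
  case (Half t) then show ?case using same_term_half by simp
qed

lemma same_fm_atom:
  assumes "same_term M f g" "same_term M f' g'" and "\<And>s t. L_formula (C s t)"
    and "\<And>e s t. L_sat \<N> e (C s t) = h (tval \<N> e s) (tval \<N> e t)"
    and "\<And>e s t. L_sat M e (C s t) = k (tval M e s) (tval M e t)"
  shows "same_fm M (\<lambda>e. h (f e) (f' e)) (\<lambda>e. k (g e) (g' e))"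
proof -
  obtain t t' where "\<forall>e. f e = tval \<N> e t" "\<forall>e. range e \<subseteq> univ M \<longrightarrow> g e = tval M e t"
    "\<forall>e. f' e = tval \<N> e t'" "\<forall>e. range e \<subseteq> univ M \<longrightarrow> g' e = tval M e t'"
    using assms(1,2) by (auto simp: same_term_def)
  then show ?thesis unfolding same_fm_def by (intro exI[of _ "C t t'"]) (simp add: assms(3-5))
qed

lemma same_fm_eq: "same_term M f g \<Longrightarrow> same_term M f' g' \<Longrightarrow>
    same_fm M (\<lambda>e. f e = f' e) (\<lambda>e. g e = g' e)"
  by (erule (1) same_fm_atom[of _ _ _ _ _ Eq]) simp_all

lemma same_fm_leq: "same_term M f g \<Longrightarrow> same_term M f' g' \<Longrightarrow>
    same_fm M (\<lambda>e. leq \<N> (f e) (f' e)) (\<lambda>e. leq M (g e) (g' e))"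
  by (erule (1) same_fm_atom[of _ _ _ _ _ Le]) simp_all

lemma same_fm_not:
  assumes "same_fm M P Q"
  shows "same_fm M (\<lambda>e. \<not> P e) (\<lambda>e. \<not> Q e)"
proof -
  obtain a where "L_formula a" "\<forall>e. P e = L_sat \<N> e a"
    "\<forall>e. range e \<subseteq> univ M \<longrightarrow> Q e = L_sat M e a"
    using assms by (auto simp: same_fm_def)
  then show ?thesis unfolding same_fm_def by (intro exI[of _ "Neg a"]) simp
qed

lemma same_fm_conj:
  assumes "same_fm M P Q" "same_fm M P' Q'"
  shows "same_fm M (\<lambda>e. P e \<and> P' e) (\<lambda>e. Q e \<and> Q' e)"
proof -
  obtain a a' where "L_formula a" "\<forall>e. P e = L_sat \<N> e a"
    "\<forall>e. range e \<subseteq> univ M \<longrightarrow> Q e = L_sat M e a"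
    "L_formula a'" "\<forall>e. P' e = L_sat \<N> e a'"
    "\<forall>e. range e \<subseteq> univ M \<longrightarrow> Q' e = L_sat M e a'"
    using assms by (auto simp: same_fm_def)
  then show ?thesis unfolding same_fm_def by (intro exI[of _ "And a a'"]) simp
qed

lemma same_fm_disj:
  assumes "same_fm M P Q" "same_fm M P' Q'"
  shows "same_fm M (\<lambda>e. P e \<or> P' e) (\<lambda>e. Q e \<or> Q' e)"
  using same_fm_not[OF same_fm_conj[OF same_fm_not[OF assms(1)] same_fm_not[OF assms(2)]]]
  by simp

lemma same_fm_imp:
  assumes "same_fm M P Q" "same_fm M P' Q'"
  shows "same_fm M (\<lambda>e. P e \<longrightarrow> P' e) (\<lambda>e. Q e \<longrightarrow> Q' e)"
  using same_fm_disj[OF same_fm_not[OF assms(1)] assms(2)] unfolding imp_conv_disj .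

lemma same_fm_iff:
  assumes "same_fm M P Q" "same_fm M P' Q'"
  shows "same_fm M (\<lambda>e. P e \<longleftrightarrow> P' e) (\<lambda>e. Q e \<longleftrightarrow> Q' e)"
  using same_fm_conj[OF same_fm_imp[OF assms] same_fm_imp[OF assms(2,1)]]
  unfolding iff_conv_conj_imp .

text \<open>In the premise the bound element is entry 0 of the assignment and the parameters are the
  shifted entries, which is the de Bruijn reading of the body. Unification with a quantified goal
  thus yields a subgoal about the body alone.\<close>

lemma same_fm_ball:
  assumes "same_fm M (\<lambda>e. P (e 0) (\<lambda>k. e (Suc k))) (\<lambda>e. Q (e 0) (\<lambda>k. e (Suc k)))"
  shows "same_fm M (\<lambda>e. \<forall>x\<in>univ \<N>. P x e) (\<lambda>e. \<forall>x\<in>univ M. Q x e)"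
proof -
  obtain a where a: "L_formula a" "\<And>e. P (e 0) (\<lambda>k. e (Suc k)) = L_sat \<N> e a"
    "\<And>e. range e \<subseteq> univ M \<Longrightarrow> Q (e 0) (\<lambda>k. e (Suc k)) = L_sat M e a"
    using assms by (auto simp: same_fm_def)
  have "P x e = L_sat \<N> (case_nat x e) a" for x e
    using a(2)[of "case_nat x e"] by simp
  moreover have "Q x e = L_sat M (case_nat x e) a" if "x \<in> univ M" "range e \<subseteq> univ M" for x e
    using a(3)[of "case_nat x e"] that by (simp add: range_case_nat)
  ultimately show ?thesis unfolding same_fm_def using a(1) by (intro exI[of _ "All a"]) simp
qed

lemma same_fm_bex:
  assumes "same_fm M (\<lambda>e. P (e 0) (\<lambda>k. e (Suc k))) (\<lambda>e. Q (e 0) (\<lambda>k. e (Suc k)))"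
  shows "same_fm M (\<lambda>e. \<exists>x\<in>univ \<N>. P x e) (\<lambda>e. \<exists>x\<in>univ M. Q x e)"
  using same_fm_not[OF same_fm_ball[of M "\<lambda>x e. \<not> P x e" "\<lambda>x e. \<not> Q x e", OF same_fm_not[OF assms]]]
  by simp


section \<open>Substitution and change of assignment\<close>

lemma tval_tsubst: "tval S e (tsubst \<sigma> t) = tval S (\<lambda>k. tval S e (\<sigma> k)) t"
  by (induction t) auto

lemma tval_tlift [simp]: "tval S (case_nat x e) (tlift t) = tval S e t"
  by (simp add: tlift_def tval_tsubst)

lemma tval_up: "(\<lambda>k. tval S (case_nat x e) (up \<sigma> k)) = case_nat x (\<lambda>k. tval S e (\<sigma> k))"
  by (auto simp: fun_eq_iff up_def split: nat.split)

lemma sat_subst: "sat S R e (subst \<sigma> a) = sat S R (\<lambda>k. tval S e (\<sigma> k)) a"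
  by (induction a arbitrary: \<sigma> e) (auto simp: tval_tsubst tval_up)

lemma L_formula_subst [simp]: "L_formula (subst \<sigma> a) = L_formula a"
  by (induction a arbitrary: \<sigma>) auto

text \<open>A change of assignment given entrywise by terms is realized by substituting these terms
  into the defining formula. Each notion can thus be treated once on variables and then be used at
  arbitrary terms.\<close>

lemma same_fm_compose:
  assumes M: "is_structure M" and "same_fm M P Q" and "same_env M F G"
  shows "same_fm M (\<lambda>e. P (F e)) (\<lambda>e. Q (G e))"
proof -
  obtain a where a: "L_formula a" "\<And>e. P e = L_sat \<N> e a"
    "\<And>e. range e \<subseteq> univ M \<Longrightarrow> Q e = L_sat M e a"
    using assms(2) by (auto simp: same_fm_def)
  obtain \<sigma> where \<sigma>: "\<And>k e. F e k = tval \<N> e (\<sigma> k)"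
    "\<And>k e. range e \<subseteq> univ M \<Longrightarrow> G e k = tval M e (\<sigma> k)"
    using assms(3) unfolding same_env_def same_term_def by metis
  have F: "F e = (\<lambda>k. tval \<N> e (\<sigma> k))" for e using \<sigma> by auto
  have G: "G e = (\<lambda>k. tval M e (\<sigma> k))" if "range e \<subseteq> univ M" for e using \<sigma> that by auto
  have "P (F e) = L_sat \<N> e (subst \<sigma> a)" for e
    unfolding sat_subst a(2) F ..
  moreover have "Q (G e) = L_sat M e (subst \<sigma> a)" if e: "range e \<subseteq> univ M" for e
  proof -
    have "range (\<lambda>k. tval M e (\<sigma> k)) \<subseteq> univ M"
      using tval_closed[OF M e] by auto
    from a(3)[OF this] show ?thesis unfolding sat_subst G[OF e] .
  qed
  ultimately show ?thesis unfolding same_fm_def using a(1)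
    by (intro exI[of _ "subst \<sigma> a"]) simp
qed

named_theorems same

lemmas [same] = same_term_var same_term_zer same_term_un same_term_add same_term_mul same_term_smash
  same_term_len same_term_half same_env_var same_env_case_nat same_term_tval
  same_fm_eq same_fm_leq same_fm_not same_fm_conj same_fm_disj same_fm_imp same_fm_iff same_fm_ball
  same_fm_bex

section \<open>Coded sets and relations\<close>

definition lt :: "'a L_structure \<Rightarrow> 'a \<Rightarrow> 'a \<Rightarrow> bool" where
  "lt S x y \<longleftrightarrow> leq S x y \<and> x \<noteq> y"

lemma lt_nat [simp]: "lt \<N> = (<)"
  by (auto simp: lt_def fun_eq_iff)

lemma same_fm_lt [same]:
  "same_term M f g \<Longrightarrow> same_term M f' g' \<Longrightarrow>
   same_fm M (\<lambda>e. lt \<N> (f e) (f' e)) (\<lambda>e. lt M (g e) (g' e))"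
  unfolding lt_def by (intro same)

text \<open>Membership of \<open>x\<close> in the set of positions of the binary digits \<open>1\<close> of \<open>s\<close>: any \<open>z\<close> of
  length \<open>x\<close> gives \<open>2\<^sup>x\<close> as \<open>1 # z\<close>.\<close>

definition mem :: "'a L_structure \<Rightarrow> 'a \<Rightarrow> 'a \<Rightarrow> bool" where
  "mem S x s \<longleftrightarrow> (\<exists>z\<in>univ S. \<exists>q\<in>univ S. \<exists>r\<in>univ S. len S z = x \<and> lt S r (smash S (un S) z) \<and>
     s = add S (mul S (add S (add S q q) (un S)) (smash S (un S) z)) r)"

lemma floorlog_1 [simp]: "floorlog 2 (Suc 0) = 1"
  by (simp add: floorlog_def)

lemma floorlog_surj: "\<exists>z. floorlog 2 z = x"
proof (cases x)
  case 0 then show ?thesis by (intro exI[of _ 0]) (simp add: floorlog_def)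
next
  case (Suc k)
  have "floorlog 2 (2 ^ k) = Suc k" by (simp add: floorlog_power floorlog_def)
  with Suc show ?thesis by blast
qed

lemma mem_nat [simp]: "mem \<N> x s \<longleftrightarrow> x \<in> set_decode s"
proof
  assume "mem \<N> x s"
  then obtain q r where "r < 2 ^ x" "s = (2 * q + 1) * 2 ^ x + r"
    by (auto simp: mem_def mult_2)
  then have "s div 2 ^ x = 2 * q + 1"
    by (metis add.right_neutral div_less div_mult_self3 power_not_zero zero_neq_numeral)
  then show "x \<in> set_decode s" by (simp add: set_decode_def)
next
  assume "x \<in> set_decode s"
  then obtain q where q: "s div 2 ^ x = 2 * q + 1" by (auto simp: set_decode_def elim: oddE)
  obtain z where z: "floorlog 2 z = x" using floorlog_surj by blast
  have "s = (2 * q + 1) * 2 ^ x + s mod 2 ^ x" using q by (metis div_mult_mod_eq)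
  then show "mem \<N> x s" unfolding mem_def using z
    by (intro bexI[of _ z] bexI[of _ q] bexI[of _ "s mod 2 ^ x"]) (auto simp: algebra_simps)
qed

lemma same_fm_args2:
  assumes "is_structure M" "same_fm M (\<lambda>e. P (e 0) (e 1)) (\<lambda>e. Q (e 0) (e 1))"
    and "same_term M f g" "same_term M f' g'"
  shows "same_fm M (\<lambda>e. P (f e) (f' e)) (\<lambda>e. Q (g e) (g' e))"
  using same_fm_compose[OF assms(1,2), of "\<lambda>e. case_nat (f e) (case_nat (f' e) e)"
      "\<lambda>e. case_nat (g e) (case_nat (g' e) e)"]
    same_env_case_nat[OF assms(3) same_env_case_nat[OF assms(4) same_env_var]]
  by simp

lemma same_fm_args3:
  assumes "is_structure M" "same_fm M (\<lambda>e. P (e 0) (e 1) (e 2)) (\<lambda>e. Q (e 0) (e 1) (e 2))"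
    and "same_term M f g" "same_term M f' g'" "same_term M f'' g''"
  shows "same_fm M (\<lambda>e. P (f e) (f' e) (f'' e)) (\<lambda>e. Q (g e) (g' e) (g'' e))"
  using same_fm_compose[OF assms(1,2),
      of "\<lambda>e. case_nat (f e) (case_nat (f' e) (case_nat (f'' e) e))"
      "\<lambda>e. case_nat (g e) (case_nat (g' e) (case_nat (g'' e) e))"]
    same_env_case_nat[OF assms(3) same_env_case_nat[OF assms(4) same_env_case_nat[OF assms(5) same_env_var]]]
  by (simp add: numeral_2_eq_2)

lemma same_fm_args3_env:
  assumes "is_structure M"
    "same_fm M (\<lambda>e. P (e 0) (e 1) (e 2) (\<lambda>k. e (Suc (Suc (Suc k)))))
               (\<lambda>e. Q (e 0) (e 1) (e 2) (\<lambda>k. e (Suc (Suc (Suc k)))))"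
    and "same_term M f g" "same_term M f' g'" "same_term M f'' g''" "same_env M F G"
  shows "same_fm M (\<lambda>e. P (f e) (f' e) (f'' e) (F e)) (\<lambda>e. Q (g e) (g' e) (g'' e) (G e))"
  using same_fm_compose[OF assms(1,2),
      of "\<lambda>e. case_nat (f e) (case_nat (f' e) (case_nat (f'' e) (F e)))"
      "\<lambda>e. case_nat (g e) (case_nat (g' e) (case_nat (g'' e) (G e)))"]
    same_env_case_nat[OF assms(3) same_env_case_nat[OF assms(4) same_env_case_nat[OF assms(5,6)]]]
  by (simp add: numeral_2_eq_2)

lemma same_fm_mem:
  "is_structure M \<Longrightarrow> same_term M f g \<Longrightarrow> same_term M f' g' \<Longrightarrow>
   same_fm M (\<lambda>e. mem \<N> (f e) (f' e)) (\<lambda>e. mem M (g e) (g' e))"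
proof (erule same_fm_args2)
  show "same_fm M (\<lambda>e. mem \<N> (e 0) (e 1)) (\<lambda>e. mem M (e 0) (e 1))"
    unfolding mem_def by (intro same same_fm_lt)
qed

text \<open>The number tested for membership is Cantor's pairing \<open>prod_encode (x, y)\<close>,
  which is a term because the language has halving.\<close>

definition rel :: "'a L_structure \<Rightarrow> 'a \<Rightarrow> 'a \<Rightarrow> 'a \<Rightarrow> bool" where
  "rel S l x y \<longleftrightarrow>
     mem S (add S (half S (mul S (add S x y) (add S (add S x y) (un S)))) x) l"

lemma rel_nat: "rel \<N> l x y \<longleftrightarrow> prod_encode (x, y) \<in> set_decode l"
  by (simp add: rel_def prod_encode_def triangle_def)

lemma same_fm_rel:
  "is_structure M \<Longrightarrow> same_term M f g \<Longrightarrow> same_term M f' g' \<Longrightarrow> same_term M f'' g'' \<Longrightarrow>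
   same_fm M (\<lambda>e. rel \<N> (f e) (f' e) (f'' e)) (\<lambda>e. rel M (g e) (g' e) (g'' e))"
  unfolding rel_def by (intro same same_fm_mem)


text \<open>Pairs outside of the segment are excluded, so that in the natural numbers only finitely
  many pairs are related and every such order has a code.\<close>

definition lin :: "'a L_structure \<Rightarrow> 'a \<Rightarrow> 'a \<Rightarrow> bool" where
  "lin S B l \<longleftrightarrow>
     (\<forall>x\<in>univ S. \<forall>y\<in>univ S. rel S l x y \<longrightarrow> lt S x B \<and> lt S y B \<and> x \<noteq> y) \<and>
     (\<forall>x\<in>univ S. \<forall>y\<in>univ S. \<forall>z\<in>univ S. rel S l x y \<longrightarrow> rel S l y z \<longrightarrow> rel S l x z) \<and>
     (\<forall>x\<in>univ S. \<forall>y\<in>univ S. lt S x B \<longrightarrow> lt S y B \<longrightarrow> x \<noteq> y \<longrightarrow> rel S l x y \<or> rel S l y x)"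

definition agree :: "'a L_structure \<Rightarrow> 'a \<Rightarrow> 'a \<Rightarrow> 'a \<Rightarrow> bool" where
  "agree S D l l' \<longleftrightarrow> (\<forall>x\<in>univ S. \<forall>y\<in>univ S. mem S x D \<longrightarrow> mem S y D \<longrightarrow>
     (rel S l x y \<longleftrightarrow> rel S l' x y))"

definition sub :: "'a L_structure \<Rightarrow> 'a \<Rightarrow> 'a \<Rightarrow> bool" where
  "sub S D D' \<longleftrightarrow> (\<forall>x\<in>univ S. mem S x D \<longrightarrow> mem S x D')"

text \<open>Cardinality at most \<open>k\<close>, expressed by a coded relation \<open>F\<close>:
  every element of \<open>D\<close> is the only entry of some row with index below \<open>k\<close>,
  which amounts to an injection of \<open>D\<close> into the numbers below \<open>k\<close>.\<close>

definition small :: "'a L_structure \<Rightarrow> 'a \<Rightarrow> 'a \<Rightarrow> bool" where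
  "small S D k \<longleftrightarrow> (\<exists>F\<in>univ S. \<forall>x\<in>univ S. mem S x D \<longrightarrow>
     (\<exists>i\<in>univ S. lt S i k \<and> rel S F i x \<and> (\<forall>y\<in>univ S. rel S F i y \<longrightarrow> y = x)))"

text \<open>The exponent belongs to the metatheory, which makes the power a term. Powers with
  exponents from the structure go through \<open>is_power\<close> instead.\<close>

primrec mpow :: "'a L_structure \<Rightarrow> 'a \<Rightarrow> nat \<Rightarrow> 'a" where
  "mpow S x 0 = un S"
| "mpow S x (Suc c) = mul S x (mpow S x c)"

text \<open>Only finitely many entries are bounded, so that the condition is expressible by a formula.\<close>

definition bounded_env :: "'a L_structure \<Rightarrow> nat \<Rightarrow> 'a \<Rightarrow> (nat \<Rightarrow> 'a) \<Rightarrow> bool" where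
  "bounded_env S N m e \<longleftrightarrow> (\<forall>i<N. leq S (len S (e i)) m)"

text \<open>The quantifier ranges over total orders rather than over stronger conditions, so forcing
  is closed under semantic consequence and first-order expressible. The formula is evaluated in the
  whole structure, not in the cut.\<close>

definition forces :: "'a L_structure \<Rightarrow> fm \<Rightarrow> 'a \<Rightarrow> 'a \<Rightarrow> 'a \<Rightarrow> (nat \<Rightarrow> 'a) \<Rightarrow> bool" where
  "forces S a B D l e \<longleftrightarrow> (\<forall>l'\<in>univ S. lin S B l' \<longrightarrow> agree S D l l' \<longrightarrow> sat S (rel S l') e a)"

text \<open>The bound is a fixed power of \<open>m\<close>, so finitely many extensions lead from conditions of size
  \<open>|n|\<^sup>c\<close> to conditions of that form. Having the same bound for the size and for the parameters
  loses nothing.\<close>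

definition dense_req ::
  "'a L_structure \<Rightarrow> nat \<Rightarrow> nat \<Rightarrow> ('a \<Rightarrow> 'a \<Rightarrow> 'a \<Rightarrow> (nat \<Rightarrow> 'a) \<Rightarrow> bool) \<Rightarrow> (nat \<Rightarrow> 'a) \<Rightarrow> bool" where
  "dense_req S c N Q e \<longleftrightarrow> (\<forall>m\<in>univ S. \<forall>B\<in>univ S. \<forall>D\<in>univ S. \<forall>l\<in>univ S.
     leq S (add S (un S) (un S)) m \<longrightarrow> bounded_env S N m e \<longrightarrow> lin S B l \<longrightarrow> small S D m \<longrightarrow>
     (\<exists>D'\<in>univ S. \<exists>l'\<in>univ S. lin S B l' \<and> agree S D l l' \<and> sub S D D' \<and>
        small S D' (mpow S m c) \<and> Q B D' l' e))"

lemma bounded_env_Suc: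
  "bounded_env S (Suc N) m e \<longleftrightarrow> bounded_env S N m e \<and> leq S (len S (e N)) m"
  by (auto simp: bounded_env_def less_Suc_eq)

lemma mpow_nat [simp]: "mpow \<N> x c = x ^ c"
  by (induction c) auto

section \<open>First-order expressibility of the forcing notions\<close>

locale true_arith =
  fixes M :: "'a L_structure"
  assumes M: "models_true_arithmetic M"
begin

lemma struct: "is_structure M"
  using M by (simp add: is_model_def)

lemmas [same] = same_fm_lt same_fm_mem[OF struct] same_fm_rel[OF struct]

lemma same_fm_lin [same]:
  assumes "same_term M f g" "same_term M f' g'"
  shows "same_fm M (\<lambda>e. lin \<N> (f e) (f' e)) (\<lambda>e. lin M (g e) (g' e))"
proof (rule same_fm_args2[OF struct _ assms])
  show "same_fm M (\<lambda>e. lin \<N> (e 0) (e 1)) (\<lambda>e. lin M (e 0) (e 1))"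
    unfolding lin_def by (intro same)
qed

lemma same_fm_agree [same]:
  assumes "same_term M f g" "same_term M f' g'" "same_term M f'' g''"
  shows "same_fm M (\<lambda>e. agree \<N> (f e) (f' e) (f'' e)) (\<lambda>e. agree M (g e) (g' e) (g'' e))"
proof (rule same_fm_args3[OF struct _ assms])
  show "same_fm M (\<lambda>e. agree \<N> (e 0) (e 1) (e 2)) (\<lambda>e. agree M (e 0) (e 1) (e 2))"
    unfolding agree_def by (intro same)
qed

lemma same_fm_sub [same]:
  assumes "same_term M f g" "same_term M f' g'"
  shows "same_fm M (\<lambda>e. sub \<N> (f e) (f' e)) (\<lambda>e. sub M (g e) (g' e))"
proof (rule same_fm_args2[OF struct _ assms])
  show "same_fm M (\<lambda>e. sub \<N> (e 0) (e 1)) (\<lambda>e. sub M (e 0) (e 1))"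
    unfolding sub_def by (intro same)
qed

lemma same_fm_small [same]:
  assumes "same_term M f g" "same_term M f' g'"
  shows "same_fm M (\<lambda>e. small \<N> (f e) (f' e)) (\<lambda>e. small M (g e) (g' e))"
proof (rule same_fm_args2[OF struct _ assms])
  show "same_fm M (\<lambda>e. small \<N> (e 0) (e 1)) (\<lambda>e. small M (e 0) (e 1))"
    unfolding small_def by (intro same)
qed

lemma same_term_mpow [same]:
  "same_term M f g \<Longrightarrow> same_term M (\<lambda>e. mpow \<N> (f e) c) (\<lambda>e. mpow M (g e) c)"
proof (induction c)
  case 0 show ?case unfolding mpow.simps by (intro same)
next
  case (Suc c) then show ?case unfolding mpow.simps by (intro same)
qed

lemma same_fm_const: "same_fm M (\<lambda>e. P) (\<lambda>e. P)"
proof (cases P)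
  case True then show ?thesis unfolding same_fm_def by (intro exI[of _ "Eq Zero Zero"]) simp
next
  case False then show ?thesis unfolding same_fm_def by (intro exI[of _ "Neg (Eq Zero Zero)"]) simp
qed

lemma same_fm_bounded_env [same]:
  assumes "same_term M f g" "same_env M F G"
  shows "same_fm M (\<lambda>e. bounded_env \<N> N (f e) (F e)) (\<lambda>e. bounded_env M N (g e) (G e))"
proof (induction N)
  case 0 then show ?case using same_fm_const[of True] by (simp add: bounded_env_def)
next
  case (Suc N)
  have "same_term M (\<lambda>e. F e N) (\<lambda>e. G e N)" using assms(2) by (simp add: same_env_def)
  then show ?case unfolding bounded_env_Suc
    by (intro same Suc assms)
qed

text \<open>Replacing \<open>\<lhd>\<close> by the coded relation gives a formula of arithmetic, so
  for a fixed \<open>a\<close> truth under a coded order is definable, with the code as one more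
  parameter. A quantifier shifts both the position \<open>i\<close> of the code and the renaming
  \<open>s\<close>, hence the induction is for arbitrary ones.\<close>

lemma same_fm_sat [same]:
  assumes "same_term M l l'" "same_env M F G"
  shows "same_fm M (\<lambda>e. sat \<N> (rel \<N> (l e)) (F e) a)
     (\<lambda>e. sat M (rel M (l' e)) (G e) a)"
proof -
  have shift: "case_nat (e 0) (\<lambda>k. e (Suc (s k))) = (\<lambda>k. e (case_nat 0 (\<lambda>k. Suc (s k)) k))"
    for e :: "nat \<Rightarrow> 'b" and s
    by (auto simp: fun_eq_iff split: nat.split)
  have var: "same_fm M (\<lambda>e. sat \<N> (rel \<N> (e i)) (\<lambda>k. e (s k)) a)
     (\<lambda>e. sat M (rel M (e i)) (\<lambda>k. e (s k)) a)" for i s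
  proof (induction a arbitrary: s i)
    case (All a)
    show ?case
      using same_fm_ball[of M "\<lambda>x e. sat \<N> (rel \<N> (e i)) (case_nat x (\<lambda>k. e (s k))) a"
          "\<lambda>x e. sat M (rel M (e i)) (case_nat x (\<lambda>k. e (s k))) a"]
        All.IH[of "Suc i" "case_nat 0 (\<lambda>k. Suc (s k))"]
      unfolding sat.simps shift by blast
  next
    case (Ex a)
    show ?case
      using same_fm_bex[of M "\<lambda>x e. sat \<N> (rel \<N> (e i)) (case_nat x (\<lambda>k. e (s k))) a"
          "\<lambda>x e. sat M (rel M (e i)) (case_nat x (\<lambda>k. e (s k))) a"]
        Ex.IH[of "Suc i" "case_nat 0 (\<lambda>k. Suc (s k))"]
      unfolding sat.simps shift by blast
  qed (unfold sat.simps, (intro same; assumption)+)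
  show ?thesis
    using same_fm_compose[OF struct var[of 0 Suc] same_env_case_nat[OF assms]] by simp
qed

lemma same_fm_forces [same]:
  assumes "same_term M f g" "same_term M f' g'" "same_term M f'' g''" "same_env M F G"
  shows "same_fm M (\<lambda>e. forces \<N> a (f e) (f' e) (f'' e) (F e))
     (\<lambda>e. forces M a (g e) (g' e) (g'' e) (G e))"
proof (rule same_fm_args3_env[OF struct _ assms])
  show "same_fm M (\<lambda>e. forces \<N> a (e 0) (e 1) (e 2) (\<lambda>k. e (Suc (Suc (Suc k)))))
     (\<lambda>e. forces M a (e 0) (e 1) (e 2) (\<lambda>k. e (Suc (Suc (Suc k)))))"
    unfolding forces_def by (intro same)
qed

lemma transfer_dense_req:
  assumes "\<And>e. dense_req \<N> c N P e"
    and PQ: "same_fm M (\<lambda>e. P (e 0) (e 1) (e 2) (\<lambda>k. e (Suc (Suc (Suc k)))))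
       (\<lambda>e. Q (e 0) (e 1) (e 2) (\<lambda>k. e (Suc (Suc (Suc k)))))"
    and "range e \<subseteq> univ M"
  shows "dense_req M c N Q e"
  using M _ assms(1,3)
proof (rule transferI)
  have PQ': "same_fm M (\<lambda>e. P (f e) (f' e) (f'' e) (F e)) (\<lambda>e. Q (g e) (g' e) (g'' e) (G e))"
    if "same_term M f g" "same_term M f' g'" "same_term M f'' g''" "same_env M F G"
    for f g f' g' f'' g'' F G
    using same_fm_args3_env[OF struct PQ that] .
  show "same_fm M (dense_req \<N> c N P) (dense_req M c N Q)"
    unfolding dense_req_def[abs_def] by (intro same PQ')
qed

end

section \<open>The standard model\<close>

definition linord :: "nat \<Rightarrow> (nat \<Rightarrow> nat \<Rightarrow> bool) \<Rightarrow> bool" where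
  "linord B r \<longleftrightarrow> (\<forall>x y. r x y \<longrightarrow> x < B \<and> y < B \<and> x \<noteq> y) \<and> transp r \<and>
     (\<forall>x<B. \<forall>y<B. x \<noteq> y \<longrightarrow> r x y \<or> r y x)"

definition agree_on :: "nat set \<Rightarrow> (nat \<Rightarrow> nat \<Rightarrow> bool) \<Rightarrow> (nat \<Rightarrow> nat \<Rightarrow> bool) \<Rightarrow> bool" where
  "agree_on D r r' \<longleftrightarrow> (\<forall>x\<in>D. \<forall>y\<in>D. r x y \<longleftrightarrow> r' x y)"

lemma lin_nat: "lin \<N> B l \<longleftrightarrow> linord B (rel \<N> l)"
  by (auto simp: lin_def linord_def transp_def)

lemma agree_nat: "agree \<N> D l l' \<longleftrightarrow>
    agree_on (set_decode D) (rel \<N> l) (rel \<N> l')"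
  by (auto simp: agree_def agree_on_def)

lemma sub_nat: "sub \<N> D D' \<longleftrightarrow> set_decode D \<subseteq> set_decode D'"
  by (auto simp: sub_def)

lemma ex_rel:
  assumes "finite {(x, y). r x y}"
  shows "\<exists>l. rel \<N> l = r"
proof -
  let ?A = "prod_encode ` {(x, y). r x y}"
  have "set_decode (set_encode ?A) = ?A" using assms by (simp add: set_encode_inverse)
  then have "rel \<N> (set_encode ?A) = r"
    by (auto simp: rel_nat fun_eq_iff inj_image_mem_iff[OF inj_prod_encode])
  then show ?thesis by blast
qed

lemma linord_code:
  assumes "linord B r"
  obtains l where "rel \<N> l = r"
proof -
  have "{(x, y). r x y} \<subseteq> {..<B} \<times> {..<B}" using assms by (auto simp: linord_def)
  then show ?thesis using ex_rel[of r] that by (meson finite_SigmaI finite_lessThan finite_subset)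
qed

lemma set_code:
  assumes "finite D"
  obtains d where "set_decode d = D"
  using assms set_encode_inverse by blast

lemma small_nat: "small \<N> D k \<longleftrightarrow> card (set_decode D) \<le> k"
proof
  assume "small \<N> D k"
  then obtain F where "\<And>x. x \<in> set_decode D \<Longrightarrow>
      \<exists>i<k. rel \<N> F i x \<and> (\<forall>y. rel \<N> F i y \<longrightarrow> y = x)"
    by (auto simp: small_def)
  then obtain h where h: "\<And>x. x \<in> set_decode D \<Longrightarrow> h x < k \<and> rel \<N> F (h x) x \<and>
      (\<forall>y. rel \<N> F (h x) y \<longrightarrow> y = x)"
    by metis
  have "inj_on h (set_decode D)" using h by (metis inj_onI)
  moreover have "h ` set_decode D \<subseteq> {..<k}" using h by auto
  ultimately have "card (set_decode D) \<le> card {..<k}" by (metis card_inj_on_le finite_lessThan)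
  then show "card (set_decode D) \<le> k" by simp
next
  assume "card (set_decode D) \<le> k"
  then have "card (set_decode D) \<le> card {..<k}" by simp
  then obtain h where h: "inj_on h (set_decode D)" "h ` set_decode D \<subseteq> {..<k}"
    using card_le_inj[of "set_decode D" "{..<k}"] by auto
  let ?r = "\<lambda>i x. x \<in> set_decode D \<and> i = h x"
  have "{(i, x). ?r i x} = (\<lambda>x. (h x, x)) ` set_decode D" by auto
  then have "finite {(i, x). ?r i x}" by simp
  then obtain F where "rel \<N> F = ?r" using ex_rel by blast
  then show "small \<N> D k"
    unfolding small_def using h by (intro bexI[of _ F]) (auto simp: inj_on_def)
qed

definition forces_nat :: "nat \<Rightarrow> nat set \<Rightarrow> (nat \<Rightarrow> nat \<Rightarrow> bool) \<Rightarrow> ((nat \<Rightarrow> nat \<Rightarrow> bool) \<Rightarrow> bool) \<Rightarrow> bool"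
  where "forces_nat B D r P \<longleftrightarrow> (\<forall>r'. linord B r' \<longrightarrow> agree_on D r r' \<longrightarrow> P r')"

lemma forces_nat_structure: "forces \<N> a B D l e \<longleftrightarrow>
    forces_nat B (set_decode D) (rel \<N> l) (\<lambda>r. sat \<N> r e a)"
  unfolding forces_def forces_nat_def lin_nat agree_nat
  by simp (metis linord_code)

text \<open>Here \<open>k\<close> bounds the size of \<open>D'\<close>, not the number of new points.\<close>

definition extends :: "nat \<Rightarrow> nat set \<Rightarrow> (nat \<Rightarrow> nat \<Rightarrow> bool) \<Rightarrow> nat \<Rightarrow> nat set \<Rightarrow> (nat \<Rightarrow> nat \<Rightarrow> bool) \<Rightarrow> bool" where
  "extends B D r k D' r' \<longleftrightarrow> linord B r' \<and> agree_on D r r' \<and> D \<subseteq> D' \<and> finite D' \<and> card D' \<le> k"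

lemma dense_req_natI:
  assumes "\<And>m B D r. 2 \<le> m \<Longrightarrow> (\<And>i. i < N \<Longrightarrow> floorlog 2 (e i) \<le> m) \<Longrightarrow> linord B r \<Longrightarrow> finite D \<Longrightarrow>
     card D \<le> m \<Longrightarrow>
     \<exists>D' r'. extends B D r (m ^ c) D' r' \<and>
       (\<forall>d l. set_decode d = D' \<longrightarrow> rel \<N> l = r' \<longrightarrow> Q B d l e)"
  shows "dense_req \<N> c N Q e"
  unfolding dense_req_def
proof (intro ballI impI)
  fix m B D l
  assume *: "leq \<N> (add \<N> (un \<N>) (un \<N>)) m"
    "bounded_env \<N> N m e" "lin \<N> B l" "small \<N> D m"
  obtain D' r' where D': "extends B (set_decode D) (rel \<N> l) (m ^ c) D' r'"
    and Q: "\<And>d l. set_decode d = D' \<Longrightarrow> rel \<N> l = r' \<Longrightarrow> Q B d l e"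
    using assms[of m B "rel \<N> l" "set_decode D"] *
    by (auto simp: bounded_env_def lin_nat small_nat)
  obtain d where d: "set_decode d = D'" using set_code D' by (auto simp: extends_def)
  obtain l' where l': "rel \<N> l' = r'" using linord_code D' by (auto simp: extends_def)
  show "\<exists>D'\<in>univ \<N>. \<exists>l'\<in>univ \<N>. lin \<N> B l' \<and>
      agree \<N> D l l' \<and> sub \<N> D D' \<and>
      small \<N> D' (mpow \<N> m c) \<and> Q B D' l' e"
    using D' Q[OF d l'] d l'
    by (intro bexI[of _ d] bexI[of _ l'])
       (auto simp: extends_def lin_nat agree_nat sub_nat small_nat)
qed

section \<open>Agreement of orders, insertion of a point, amalgamation\<close>

lemma agree_on_refl [simp]: "agree_on D r r"
  by (simp add: agree_on_def)

lemma agree_on_sym: "agree_on D r r' \<Longrightarrow> agree_on D r' r"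
  by (simp add: agree_on_def)

lemma agree_on_trans: "agree_on D r r' \<Longrightarrow> agree_on D r' r'' \<Longrightarrow> agree_on D r r''"
  by (simp add: agree_on_def)

lemma agree_on_mono: "agree_on D' r r' \<Longrightarrow> D \<subseteq> D' \<Longrightarrow> agree_on D r r'"
  by (auto simp: agree_on_def)

lemma linord_less: "linord B (\<lambda>x y. x < y \<and> y < B)"
  by (auto simp: linord_def transp_def)

text \<open>As \<open>r\<close> orders everything below \<open>B\<close>, the point \<open>z\<close>
  already has a place in it. It is taken out and put back immediately above the down-closure of
  \<open>Lo\<close>, which does not reach \<open>Hi\<close>; all other pairs keep their
  order.\<close>

lemma linord_insert_point:
  assumes r: "linord B r" and z: "z < B" "z \<notin> Lo" "z \<notin> Hi"
    and Lo: "\<And>a b. a \<in> Lo \<Longrightarrow> b \<in> Hi \<Longrightarrow> r a b" "Lo \<subseteq> {..<B}" "Hi \<subseteq> {..<B}"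
  obtains r' where "linord B r'" "\<And>x y. x \<noteq> z \<Longrightarrow> y \<noteq> z \<Longrightarrow> r' x y = r x y"
    "\<And>a. a \<in> Lo \<Longrightarrow> r' a z" "\<And>b. b \<in> Hi \<Longrightarrow> r' z b"
proof -
  define low where "low x \<longleftrightarrow> (\<exists>w\<in>Lo. x = w \<or> r x w)" for x
  have r1: "\<And>x y. r x y \<Longrightarrow> x < B \<and> y < B \<and> x \<noteq> y" and r2: "\<And>x y z. r x y \<Longrightarrow> r y z \<Longrightarrow> r x z"
    and r3: "\<And>x y. x < B \<Longrightarrow> y < B \<Longrightarrow> x \<noteq> y \<Longrightarrow> r x y \<or> r y x"
    using r unfolding linord_def transp_def by blast+
  have low_down: "low y \<Longrightarrow> r x y \<Longrightarrow> low x" for x y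
    using r2 unfolding low_def by blast
  have low_B: "low y \<Longrightarrow> y < B" for y
    using r1 Lo unfolding low_def by blast
  have low_up: "low x \<Longrightarrow> \<not> low y \<Longrightarrow> y < B \<Longrightarrow> r x y" for x y
    using low_down r3 low_B by metis
  have hi: "\<not> low b" if "b \<in> Hi" for b
  proof
    assume "low b"
    then obtain w where "w \<in> Lo" "b = w \<or> r b w" by (auto simp: low_def)
    then show False using Lo(1)[OF _ that, of w] r1 r2[of b w b] by blast
  qed
  define r' where "r' x y \<longleftrightarrow> (if x = z then y \<noteq> z \<and> y < B \<and> \<not> low y
      else if y = z then low x else r x y)" for x y
  have "transp r'" unfolding transp_def
  proof (intro allI impI)
    fix a b c assume ab: "r' a b" and bc: "r' b c"
    show "r' a c"
    proof (cases "a = z")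
      case True
      with ab bc have "b \<noteq> z" "b < B" "\<not> low b" "c \<noteq> z" "r b c" using bc
        by (auto simp: r'_def split: if_splits)
      then show ?thesis using True r1[of b c] low_down[of c b] by (auto simp: r'_def)
    next
      case a: False
      show ?thesis
      proof (cases "b = z")
        case True
        then show ?thesis using ab bc a low_up[of a c] by (auto simp: r'_def)
      next
        case False
        then show ?thesis using ab bc a low_down[of b a] r2[of a b c] by (auto simp: r'_def split: if_splits)
      qed
    qed
  qed
  moreover have "x < B \<and> y < B \<and> x \<noteq> y" if "r' x y" for x y
    using that r1[of x y] low_B[of x] z(1) by (auto simp: r'_def split: if_splits)
  moreover have "r' x y \<or> r' y x" if "x < B" "y < B" "x \<noteq> y" for x y
    using that r3[of x y] by (auto simp: r'_def)
  ultimately have "linord B r'" unfolding linord_def by blast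
  moreover have "r' a z" if "a \<in> Lo" for a using that z by (auto simp: r'_def low_def)
  moreover have "r' z b" if "b \<in> Hi" for b using that hi[OF that] z Lo(3) by (auto simp: r'_def)
  moreover have "r' x y = r x y" if "x \<noteq> z" "y \<noteq> z" for x y using that by (simp add: r'_def)
  ultimately show thesis using that[of r'] by blast
qed

text \<open>Starting from \<open>r1\<close>, the points of \<open>D2 - D1\<close> are moved one at a
  time to the place that \<open>r2\<close> prescribes relative to the points of \<open>D2\<close>
  treated so far. Points of \<open>D1\<close> never move, so agreement with \<open>r1\<close>
  survives.\<close>

lemma linord_amalgamate:
  assumes "finite D2" and r: "linord B r1" "linord B r2" "agree_on (D1 \<inter> D2) r1 r2"
  shows "\<exists>r. linord B r \<and> agree_on D1 r1 r \<and> agree_on D2 r2 r"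
proof -
  have "\<exists>r. linord B r \<and> agree_on D1 r1 r \<and> agree_on ((D1 \<inter> D2) \<union> E) r2 r"
    if "finite E" "E \<subseteq> D2 - D1" for E
    using that
  proof (induction E)
    case empty
    then show ?case using r agree_on_sym by auto
  next
    case (insert z E)
    define F where "F = (D1 \<inter> D2) \<union> E"
    have zF: "z \<notin> F" "z \<notin> D1" using insert by (auto simp: F_def)
    obtain s where s: "linord B s" "agree_on D1 r1 s" "agree_on F r2 s"
      using insert by (auto simp: F_def)
    have l2: "\<And>x y. r2 x y \<Longrightarrow> x < B \<and> y < B \<and> x \<noteq> y" "\<And>x y z. r2 x y \<Longrightarrow> r2 y z \<Longrightarrow> r2 x z"
       "\<And>x y. x < B \<Longrightarrow> y < B \<Longrightarrow> x \<noteq> y \<Longrightarrow> r2 x y \<or> r2 y x"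
      using r(2) unfolding linord_def transp_def by blast+
    show ?case
    proof (cases "z < B")
      \<comment> \<open>Points from \<open>B\<close> on are unrelated to everything in both orders,
        so nothing has to be moved.\<close>
      case False
      have "\<not> r2 x y" "\<not> s x y" if "x = z \<or> y = z" for x y
        using that False r(2) s(1) by (auto simp: linord_def)
      then have "agree_on (insert z F) r2 s" using s(3) by (auto simp: agree_on_def)
      then show ?thesis using s by (auto simp: F_def)
    next
      case True
      define Lo where "Lo = {a\<in>F. r2 a z}"
      define Hi where "Hi = {b\<in>F. r2 z b}"
      obtain s' where s': "linord B s'" "\<And>x y. x \<noteq> z \<Longrightarrow> y \<noteq> z \<Longrightarrow> s' x y = s x y"
        "\<And>a. a \<in> Lo \<Longrightarrow> s' a z" "\<And>b. b \<in> Hi \<Longrightarrow> s' z b"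
      proof (rule linord_insert_point[OF s(1) True, of Lo Hi])
        show "z \<notin> Lo" "z \<notin> Hi" using zF by (auto simp: Lo_def Hi_def)
        show "Lo \<subseteq> {..<B}" "Hi \<subseteq> {..<B}" using l2(1) by (auto simp: Lo_def Hi_def)
        show "s a b" if "a \<in> Lo" "b \<in> Hi" for a b
          using that s(3) l2(2)[of a z b] unfolding Lo_def Hi_def agree_on_def by blast
      qed auto
      have s'l: "\<not> (s' x y \<and> s' y x)" "\<not> s' x x" for x y
        using s'(1) unfolding linord_def transp_def by metis+
      have "r2 a z = s' a z \<and> r2 z a = s' z a" if "a \<in> F" for a
      proof (cases "a < B")
        case False
        then show ?thesis using l2(1) s'(1) by (auto simp: linord_def)
      next
        case aB: True
        then have "r2 a z \<and> \<not> r2 z a \<or> r2 z a \<and> \<not> r2 a z" using l2 True that zF by metis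
        then show ?thesis using s'(3,4) that s'l(1)[of a z] by (auto simp: Lo_def Hi_def)
      qed
      moreover have "r2 z z = s' z z" using l2(1) s'l by blast
      moreover have "r2 x y = s' x y" if "x \<in> F" "y \<in> F" for x y
      proof -
        have "r2 x y = s x y" using s(3) that by (auto simp: agree_on_def)
        also have "\<dots> = s' x y" using s'(2)[of x y] that zF(1) by metis
        finally show ?thesis .
      qed
      ultimately have "agree_on (insert z F) r2 s'" unfolding agree_on_def by blast
      moreover have "agree_on D1 r1 s'" using s(2) s'(2) zF(2) unfolding agree_on_def by metis
      ultimately show ?thesis using s'(1) by (auto simp: F_def)
    qed
  qed
  moreover have "D1 \<inter> D2 \<union> (D2 - D1) = D2" by blast
  ultimately show ?thesis using assms(1) by (metis finite_Diff order_refl)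
qed

subsection \<open>Extending conditions\<close>

text \<open>One-sided certificate complexity: only orders that satisfy \<open>P\<close> have small
  certificates. More cannot be expected for bounded existential formulas, as a refutation may have
  to exclude very many witnesses.\<close>

definition certified :: "nat \<Rightarrow> nat \<Rightarrow> ((nat \<Rightarrow> nat \<Rightarrow> bool) \<Rightarrow> bool) \<Rightarrow> bool" where
  "certified B K P \<longleftrightarrow> (\<forall>r. linord B r \<longrightarrow> P r \<longrightarrow> (\<exists>C. finite C \<and> card C \<le> K \<and> forces_nat B C r P))"

lemma forces_natD: "forces_nat B D r P \<Longrightarrow> linord B r' \<Longrightarrow> agree_on D r r' \<Longrightarrow> P r'"
  by (simp add: forces_nat_def)

lemma forces_nat_mono:
  "forces_nat B D r P \<Longrightarrow> D \<subseteq> D' \<Longrightarrow> agree_on D r r' \<Longrightarrow> forces_nat B D' r' P"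
  unfolding forces_nat_def using agree_on_trans agree_on_mono by blast

lemma extends_forces: "extends B D r k D' r' \<Longrightarrow> forces_nat B D r P \<Longrightarrow> forces_nat B D' r' P"
  unfolding extends_def using forces_nat_mono by blast

lemma extends_refl: "linord B r \<Longrightarrow> finite D \<Longrightarrow> card D \<le> k \<Longrightarrow> extends B D r k D r"
  by (simp add: extends_def)

lemma extends_trans: "extends B D r k D' r' \<Longrightarrow> extends B D' r' k' D'' r'' \<Longrightarrow> extends B D r k' D'' r''"
  unfolding extends_def using agree_on_trans[OF _ agree_on_mono] by blast

lemma extends_le: "extends B D r k D' r' \<Longrightarrow> k \<le> k' \<Longrightarrow> extends B D r k' D' r'"
  unfolding extends_def by auto

lemma extend_certified:
  assumes "certified B K P" "linord B r'" "agree_on D r r'" "P r'" "finite D"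
  shows "\<exists>D'. extends B D r (card D + K) D' r' \<and> forces_nat B D' r' P"
proof -
  obtain C where C: "finite C" "card C \<le> K" "forces_nat B C r' P"
    using assms by (auto simp: certified_def)
  have "card (D \<union> C) \<le> card D + K" using C(2) card_Un_le[of D C] by linarith
  then have "extends B D r (card D + K) (D \<union> C) r'" using assms C by (auto simp: extends_def)
  moreover have "forces_nat B (D \<union> C) r' P" by (rule forces_nat_mono[OF C(3)]) auto
  ultimately show ?thesis by blast
qed

lemma extend_decide:
  assumes "certified B K P" "linord B r" "finite D"
  shows "\<exists>D' r'. extends B D r (card D + K) D' r' \<and>
    (forces_nat B D' r' P \<or> forces_nat B D' r' (\<lambda>r. \<not> P r))"
proof (cases "forces_nat B D r (\<lambda>r. \<not> P r)")
  case True
  then show ?thesis using extends_refl[OF assms(2,3), of "card D + K"] by auto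
next
  case False
  then obtain r' where "linord B r'" "agree_on D r r'" "P r'" by (auto simp: forces_nat_def)
  then show ?thesis using extend_certified[OF assms(1) _ _ _ assms(3)] by blast
qed

text \<open>The statements are forced one after the other at a cost of \<open>K\<close> points each;
  the negation of one of them, once forced, persists. This serves a sharply bounded universal
  quantifier, which has few instances.\<close>

lemma extend_decide_all:
  assumes "\<And>i. i \<le> n \<Longrightarrow> certified B K (P i)" "linord B r" "finite D"
  shows "\<exists>D' r'. extends B D r (card D + (n + 1) * K) D' r' \<and>
    ((\<forall>i\<le>n. forces_nat B D' r' (P i)) \<or> (\<exists>i\<le>n. forces_nat B D' r' (\<lambda>r. \<not> P i r)))"
proof -
  have "\<exists>D' r'. extends B D r (card D + j * K) D' r' \<and>
    ((\<forall>i<j. forces_nat B D' r' (P i)) \<or> (\<exists>i\<le>n. forces_nat B D' r' (\<lambda>r. \<not> P i r)))"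
    if "j \<le> n + 1" for j
    using that
  proof (induction j)
    case 0
    then show ?case using extends_refl[OF assms(2,3)] by auto
  next
    case (Suc j)
    then obtain D' r' where D': "extends B D r (card D + j * K) D' r'"
      "(\<forall>i<j. forces_nat B D' r' (P i)) \<or> (\<exists>i\<le>n. forces_nat B D' r' (\<lambda>r. \<not> P i r))"
      by auto
    then have "linord B r'" "finite D'" by (auto simp: extends_def)
    then obtain D'' r'' where D'': "extends B D' r' (card D' + K) D'' r''"
      "forces_nat B D'' r'' (P j) \<or> forces_nat B D'' r'' (\<lambda>r. \<not> P j r)"
      using extend_decide[OF assms(1)[of j] \<open>linord B r'\<close> \<open>finite D'\<close>] Suc.prems by auto
    have "extends B D r (card D + Suc j * K) D'' r''"
      by (rule extends_le[OF extends_trans[OF D'(1) D''(1)]]) (use D'(1) in \<open>auto simp: extends_def\<close>)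
    moreover have "(\<forall>i<Suc j. forces_nat B D'' r'' (P i)) \<or>
        (\<exists>i\<le>n. forces_nat B D'' r'' (\<lambda>r. \<not> P i r))"
    proof (cases "\<exists>i\<le>n. forces_nat B D' r' (\<lambda>r. \<not> P i r)")
      case True
      then show ?thesis using extends_forces[OF D''(1)] by blast
    next
      case False
      then have "forces_nat B D'' r'' (P i)" if "i < j" for i
        using D'(2) that extends_forces[OF D''(1)] by blast
      then show ?thesis using D''(2) Suc.prems by (auto simp: less_Suc_eq)
    qed
    ultimately show ?case by blast
  qed
  from this[of "n + 1"] show ?thesis by (simp add: less_Suc_eq_le)
qed

text \<open>Maximize \<open>x \<in> S\<close> among those for which \<open>P x\<close> can still be forced.\<close>

lemma extend_induction:
  fixes b :: nat
  assumes P: "\<And>x. x \<le> b \<Longrightarrow> certified B K (P x)" and r: "linord B r" "finite D"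
    and S: "0 \<in> S" "\<And>x. x \<in> S \<Longrightarrow> x < b \<Longrightarrow> \<exists>y\<in>S. x < y \<and> y \<le> b \<and> T x y"
  shows "\<exists>D' r'. extends B D r (card D + K) D' r' \<and>
    (forces_nat B D' r' (\<lambda>r. \<not> P 0 r) \<or> forces_nat B D' r' (P b) \<or>
     (\<exists>x y. x < y \<and> y \<le> b \<and> T x y \<and> forces_nat B D' r' (P x) \<and> forces_nat B D' r' (\<lambda>r. \<not> P y r)))"
proof (cases "forces_nat B D r (\<lambda>r. \<not> P 0 r)")
  case True
  then show ?thesis using extends_refl[OF r, of "card D + K"] by auto
next
  case False
  \<comment> \<open>Membership only demands that \<open>P x\<close> is not refuted by the present
    condition; any such \<open>P x\<close> becomes forced at the cost of a single
    certificate.\<close>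
  let ?A = "{x\<in>S. x \<le> b \<and> \<not> forces_nat B D r (\<lambda>r. \<not> P x r)}"
  have "0 \<in> ?A" using False S(1) by auto
  then have A: "finite ?A" "?A \<noteq> {}" by (auto intro: finite_subset[of _ "{..b}"])
  define x where "x = Max ?A"
  have x: "x \<in> S" "x \<le> b" "\<not> forces_nat B D r (\<lambda>r. \<not> P x r)"
    using Max_in[OF A] by (auto simp: x_def)
  then obtain r' where r': "linord B r'" "agree_on D r r'" "P x r'" by (auto simp: forces_nat_def)
  then obtain D' where D': "extends B D r (card D + K) D' r'" "forces_nat B D' r' (P x)"
    using extend_certified[OF P[OF x(2)]] r(2) by blast
  show ?thesis
  proof (cases "x = b")
    case True
    then show ?thesis using D' by blast
  next
    case False
    then obtain y where y: "y \<in> S" "x < y" "y \<le> b" "T x y" using S(2)[OF x(1)] x(2) by auto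
    \<comment> \<open>By maximality of \<open>x\<close> the failure at \<open>y\<close> is forced by
      \<open>D\<close> already, so the negation needs no certificate.\<close>
    have "forces_nat B D r (\<lambda>r. \<not> P y r)"
      using Max_ge[OF A(1), of y] y by (fastforce simp: x_def)
    then show ?thesis using D' y extends_forces by blast
  qed
qed

subsection \<open>The pigeonhole principle\<close>

text \<open>If no small extension makes \<open>A\<close> multi-valued at \<open>x\<close>, then by amalgamation certificates for
  different values at \<open>x\<close> intersect outside of the condition. Hence after adding certificates for
  two different values \<open>K + 1\<close> times there is no room for any certificate; so before that
  only one value remains.\<close>

lemma unique_value:
  assumes A: "\<And>y. y < v \<Longrightarrow> certified B K (A y)" and r: "linord B r" "finite D"
    and single: "\<And>r' y y'. linord B r' \<Longrightarrow> agree_on D r r' \<Longrightarrow> y < v \<Longrightarrow> y' < v \<Longrightarrow> A y r' \<Longrightarrow> A y' r' \<Longrightarrow> y = y'"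
    and total: "\<And>D'. D \<subseteq> D' \<Longrightarrow> finite D' \<Longrightarrow> card D' \<le> card D + 2 * K * (K + 1) \<Longrightarrow>
      \<exists>y<v. \<exists>r'. linord B r' \<and> agree_on D' r r' \<and> A y r'"
  shows "\<exists>D' y. D \<subseteq> D' \<and> finite D' \<and> card D' \<le> card D + 2 * K * (K + 1) \<and> y < v \<and>
    (\<forall>y' r'. y' < v \<longrightarrow> linord B r' \<longrightarrow> agree_on D' r r' \<longrightarrow> A y' r' \<longrightarrow> y' = y)"
proof (rule ccontr)
  assume neg: "\<not> ?thesis"
  \<comment> \<open>As long as the size bound is kept, no value is the only one compatible with
    \<open>D'\<close>, so two different values occur.\<close>
  have two: "\<exists>y1 r1 y2 r2. y1 < v \<and> y2 < v \<and> y1 \<noteq> y2 \<and> linord B r1 \<and> linord B r2 \<and>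
      agree_on D' r r1 \<and> agree_on D' r r2 \<and> A y1 r1 \<and> A y2 r2"
    if D': "D \<subseteq> D'" "finite D'" "card D' \<le> card D + 2 * K * (K + 1)" for D'
  proof -
    obtain y r' where "y < v" "linord B r'" "agree_on D' r r'" "A y r'" using total[OF D'] by blast
    moreover have "\<not> (\<forall>y' r'. y' < v \<longrightarrow> linord B r' \<longrightarrow> agree_on D' r r' \<longrightarrow> A y' r' \<longrightarrow> y' = y)"
      using neg D' \<open>y < v\<close> by blast
    ultimately show ?thesis by metis
  qed
  \<comment> \<open>Invariant: every certificate of a value in an order that agrees with
    \<open>r\<close> on \<open>E\<close> has at least \<open>i\<close> points in \<open>E\<close>. A
    round adds two certificates, which accounts for \<open>2 * K * i\<close>.\<close>
  have "\<exists>E. D \<subseteq> E \<and> finite E \<and> card E \<le> card D + 2 * K * i \<and>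
     (\<forall>r' y C. linord B r' \<longrightarrow> agree_on E r r' \<longrightarrow> y < v \<longrightarrow> finite C \<longrightarrow> forces_nat B C r' (A y) \<longrightarrow>
       i \<le> card (C \<inter> E))" if "i \<le> K + 1" for i
    using that
  proof (induction i)
    case 0
    then show ?case using r(2) by auto
  next
    case (Suc i)
    then obtain E where E: "D \<subseteq> E" "finite E" "card E \<le> card D + 2 * K * i"
      and meet: "\<And>r' y C. linord B r' \<Longrightarrow> agree_on E r r' \<Longrightarrow> y < v \<Longrightarrow> finite C \<Longrightarrow>
         forces_nat B C r' (A y) \<Longrightarrow> i \<le> card (C \<inter> E)"
      by auto
    have "2 * K * i \<le> 2 * K * (K + 1)" using Suc.prems by (intro mult_le_mono) auto
    then obtain y1 r1 y2 r2 where y: "y1 < v" "y2 < v" "y1 \<noteq> y2" and r12: "linord B r1" "linord B r2"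
      "agree_on E r r1" "agree_on E r r2" "A y1 r1" "A y2 r2"
      using two[OF E(1,2)] E(3) by (meson add_left_mono order_trans)
    obtain C1 where C1: "finite C1" "card C1 \<le> K" "forces_nat B C1 r1 (A y1)"
      using A[OF y(1)] r12 by (auto simp: certified_def)
    obtain C2 where C2: "finite C2" "card C2 \<le> K" "forces_nat B C2 r2 (A y2)"
      using A[OF y(2)] r12 by (auto simp: certified_def)
    \<comment> \<open>Certificates for different values that meet only inside \<open>E\<close> could
      be amalgamated to one order having both values, against single-valuedness over
      \<open>D\<close>.\<close>
    have clash: "\<not> C \<inter> C' \<subseteq> E"
      if C: "finite C" "forces_nat B C r' (A y)" "linord B r'" "agree_on E r r'" "y < v"
        and C': "finite C'" "forces_nat B C' r'' (A y')" "linord B r''" "agree_on E r r''" "y' < v"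
        and "y \<noteq> y'" for C C' r' r'' y y'
    proof
      assume "C \<inter> C' \<subseteq> E"
      then have "(E \<union> C) \<inter> (E \<union> C') = E" by blast
      moreover have "agree_on E r' r''" using C(4) C'(4) agree_on_sym agree_on_trans by blast
      ultimately obtain s where s: "linord B s" "agree_on (E \<union> C) r' s" "agree_on (E \<union> C') r'' s"
        using linord_amalgamate[of "E \<union> C'" B r' r'' "E \<union> C"] E(2) C C' by auto
      have "A y s" "A y' s"
        using s forces_natD[OF C(2)] forces_natD[OF C'(2)] agree_on_mono by blast+
      moreover have "agree_on D r s"
        using C(4) s(2) E(1) by (meson agree_on_mono agree_on_trans sup_ge1)
      ultimately show False using single s(1) C(5) C'(5) \<open>y \<noteq> y'\<close> by blast
    qed
    let ?E = "E \<union> C1 \<union> C2"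
    have "card ?E \<le> card E + card C1 + card C2" by (meson add_le_mono1 card_Un_le order_trans)
    then have "card ?E \<le> card D + 2 * K * Suc i" using E(3) C1(2) C2(2) by simp
    moreover have "Suc i \<le> card (C \<inter> ?E)"
      if C: "linord B r'" "agree_on ?E r r'" "y < v" "finite C" "forces_nat B C r' (A y)" for r' y C
    proof -
      have ag: "agree_on E r r'" using C(2) by (auto simp: agree_on_def)
      \<comment> \<open>The value \<open>y\<close> differs from \<open>y1\<close> or from
        \<open>y2\<close>, so its certificate clashes with at least one of the two new ones and
        gains a point of \<open>?E\<close>.\<close>
      have "\<not> C \<inter> C1 \<subseteq> E \<or> \<not> C \<inter> C2 \<subseteq> E"
        using clash[OF C(4,5,1) ag C(3) C1(1,3) r12(1,3) y(1)]
          clash[OF C(4,5,1) ag C(3) C2(1,3) r12(2,4) y(2)] y(3) by blast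
      then have "C \<inter> E \<subset> C \<inter> ?E" by blast
      then have "card (C \<inter> E) < card (C \<inter> ?E)" using C(4) by (simp add: psubset_card_mono)
      then show ?thesis using meet[OF C(1) ag C(3-5)] by simp
    qed
    ultimately show ?case using E C1 C2 by (intro exI[of _ ?E]) auto
  qed
  from this[of "K + 1"] obtain E where E: "D \<subseteq> E" "finite E" "card E \<le> card D + 2 * K * (K + 1)"
    and meet: "\<And>r' y C. linord B r' \<Longrightarrow> agree_on E r r' \<Longrightarrow> y < v \<Longrightarrow> finite C \<Longrightarrow>
       forces_nat B C r' (A y) \<Longrightarrow> K + 1 \<le> card (C \<inter> E)"
    by auto
  obtain y r' where y: "y < v" "linord B r'" "agree_on E r r'" "A y r'" using total[OF E] by blast
  obtain C where C: "finite C" "card C \<le> K" "forces_nat B C r' (A y)"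
    using A[OF y(1)] y by (auto simp: certified_def)
  have "K + 1 \<le> card (C \<inter> E)" using meet y C by blast
  also have "\<dots> \<le> card C" using C by (simp add: card_mono)
  finally show False using C by simp
qed

text \<open>Two arguments with the same unique value are made to take it in one order, which
  contradicts injectivity. The bound on \<open>n\<close> leaves room for the sets that fix the
  values at both arguments, each of the size given by \<open>unique_value\<close>, and for up to two
  certificates.\<close>

lemma extend_pigeonhole:
  fixes u v :: nat
  assumes A: "\<And>x y. x < u \<Longrightarrow> y < v \<Longrightarrow> certified B K (A x y)" and r: "linord B r" "finite D"
    and "v < u" and n: "2 * (card D + 2 * K * (K + 1)) + 2 * K \<le> n"
  shows "\<exists>D' r'. extends B D r n D' r' \<and>
    ((\<exists>x<u. \<forall>y<v. forces_nat B D' r' (\<lambda>r. \<not> A x y r)) \<or>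
     (\<exists>x<u. \<exists>x'<u. x \<noteq> x' \<and> (\<exists>y<v. forces_nat B D' r' (A x y) \<and> forces_nat B D' r' (A x' y))) \<or>
     (\<exists>x<u. \<exists>y<v. \<exists>y'<v. y \<noteq> y' \<and> forces_nat B D' r' (A x y) \<and> forces_nat B D' r' (A x y')))"
    (is "\<exists>D' r'. _ \<and> ?goal D' r'")
proof (rule ccontr)
  assume neg: "\<not> ?thesis"
  have no: "\<not> ?goal D' r'" if "extends B D r n D' r'" for D' r'
    using neg that by blast
  have total: "\<exists>y<v. \<exists>r''. linord B r'' \<and> agree_on D' r' r'' \<and> A x y r''"
    if "extends B D r n D' r'" "x < u" for D' r' x
  proof (rule ccontr)
    assume "\<not> ?thesis"
    then have "\<forall>y<v. forces_nat B D' r' (\<lambda>r. \<not> A x y r)" unfolding forces_nat_def by blast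
    then show False using no[OF that(1)] that(2) by blast
  qed
  \<comment> \<open>Two certified statements that hold in one order can be forced together within
    size \<open>n\<close>. This makes \<open>A\<close> single-valued and injective in every order
    that agrees with \<open>r\<close> on \<open>D\<close>.\<close>
  have both: "False" if P: "certified B K P" "certified B K Q" "P r'" "Q r'"
    and r': "linord B r'" "agree_on D r r'"
    and goal: "\<And>D'. forces_nat B D' r' P \<Longrightarrow> forces_nat B D' r' Q \<Longrightarrow> ?goal D' r'" for P Q r'
  proof -
    obtain D' where D': "extends B D r (card D + K) D' r'" "forces_nat B D' r' P"
      using extend_certified[OF P(1) r' P(3) r(2)] by blast
    then have "finite D'" "card D' \<le> card D + K" by (auto simp: extends_def)
    then obtain D'' where D'': "extends B D' r' (card D' + K) D'' r'" "forces_nat B D'' r' Q"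
      using extend_certified[OF P(2) r'(1) agree_on_refl P(4)] by blast
    have "extends B D r n D'' r'"
      by (rule extends_le[OF extends_trans[OF D'(1) D''(1)]]) (use n \<open>card D' \<le> card D + K\<close> in auto)
    moreover have "?goal D'' r'" by (rule goal[OF extends_forces[OF D''(1) D'(2)] D''(2)])
    ultimately show False using no by blast
  qed
  have single: "y = y'" if "linord B r'" "agree_on D r r'" "x < u" "y < v" "y' < v" "A x y r'" "A x y' r'" for r' x y y'
  proof (rule ccontr)
    assume "y \<noteq> y'"
    then have "?goal D' r'" if "forces_nat B D' r' (A x y)" "forces_nat B D' r' (A x y')" for D'
      using that \<open>x < u\<close> \<open>y < v\<close> \<open>y' < v\<close> by blast
    then show False using both[OF A[OF that(3,4)] A[OF that(3,5)] that(6,7,1,2)] by blast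
  qed
  have inj: "x = x'" if "linord B r'" "agree_on D r r'" "x < u" "x' < u" "y < v" "A x y r'" "A x' y r'" for r' x x' y
  proof (rule ccontr)
    assume "x \<noteq> x'"
    then have "?goal D' r'" if "forces_nat B D' r' (A x y)" "forces_nat B D' r' (A x' y)" for D'
      using that \<open>x < u\<close> \<open>x' < u\<close> \<open>y < v\<close> by blast
    then show False using both[OF A[OF that(3,5)] A[OF that(4,5)] that(6,7,1,2)] by blast
  qed
  have "\<exists>D' y. D \<subseteq> D' \<and> finite D' \<and> card D' \<le> card D + 2 * K * (K + 1) \<and> y < v \<and>
    (\<forall>y' r'. y' < v \<longrightarrow> linord B r' \<longrightarrow> agree_on D' r r' \<longrightarrow> A x y' r' \<longrightarrow> y' = y)" if x: "x < u" for x
  proof (rule unique_value[OF A[OF x] r])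
    show "\<exists>y<v. \<exists>r'. linord B r' \<and> agree_on D' r r' \<and> A x y r'"
      if "D \<subseteq> D'" "finite D'" "card D' \<le> card D + 2 * K * (K + 1)" for D'
      using total[of D' r x] that x r n by (auto simp: extends_def)
    show "y = y'" if "linord B r'" "agree_on D r r'" "y < v" "y' < v" "A x y r'" "A x y' r'" for r' y y'
      using single[OF that(1,2) x that(3-6)] .
  qed
  then obtain E f where E: "\<And>x. x < u \<Longrightarrow> D \<subseteq> E x \<and> finite (E x) \<and>
      card (E x) \<le> card D + 2 * K * (K + 1) \<and> f x < v"
    and f: "\<And>x y r'. x < u \<Longrightarrow> y < v \<Longrightarrow> linord B r' \<Longrightarrow> agree_on (E x) r r' \<Longrightarrow> A x y r' \<Longrightarrow> y = f x"
    by metis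
  have "f ` {..<u} \<subseteq> {..<v}" using E by auto
  \<comment> \<open>The pigeonhole principle for sets of natural numbers enters here; transfer turns
    the resulting lemma into a statement about the model.\<close>
  then have "\<not> inj_on f {..<u}" using \<open>v < u\<close> card_inj_on_le[of f "{..<u}" "{..<v}"] by auto
  then obtain x x' where x: "x < u" "x' < u" "x \<noteq> x'" "f x = f x'" by (auto simp: inj_on_def)
  let ?E = "E x \<union> E x'"
  have card_E: "card ?E \<le> 2 * (card D + 2 * K * (K + 1))"
    unfolding mult_2 using E[OF x(1)] E[OF x(2)]
    by (intro order_trans[OF card_Un_le] add_mono) (auto simp: mult_2)
  then have "extends B D r n ?E r"
    using r E[OF x(1)] E[OF x(2)] n by (auto simp: extends_def)
  then obtain y s where s: "y < v" "linord B s" "agree_on ?E r s" "A x y s" using total x by blast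
  have y: "y = f x" using f[OF x(1) s(1,2) _ s(4)] s(3) agree_on_mono by blast
  have fin: "finite ?E" using E[OF x(1)] E[OF x(2)] by auto
  obtain C where C: "extends B ?E r (card ?E + K) C s" "forces_nat B C s (A x y)"
    using extend_certified[OF A[OF x(1) s(1)] s(2,3,4) fin] by blast
  have "extends B D r n C s"
    by (rule extends_le[OF extends_trans[OF \<open>extends B D r n ?E r\<close> C(1)]]) (use n card_E in auto)
  \<comment> \<open>The order \<open>s'\<close> respects a certificate of \<open>A x y\<close> and
    also has a value at \<open>x'\<close>, which over \<open>E x'\<close> can only be
    \<open>f x'\<close>.\<close>
  then obtain y' s' where s': "y' < v" "linord B s'" "agree_on C s s'" "A x' y' s'" using total x by blast
  have ag: "agree_on ?E r s'"
    using C(1) s(3) s'(3) unfolding extends_def by (meson agree_on_mono agree_on_trans)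
  then have "agree_on (E x') r s'" "agree_on D r s'" using agree_on_mono E[OF x(2)] by blast+
  then have "y' = y" using f[OF x(2) s'(1,2) _ s'(4)] y x(4) by simp
  moreover have "A x y s'" using forces_natD[OF C(2) s'(2,3)] .
  ultimately show False using inj s' \<open>agree_on D r s'\<close> x s(1) by blast
qed

subsection \<open>Certificates of polynomial size\<close>

lemma len_le_iff: "floorlog 2 x \<le> k \<longleftrightarrow> x < 2 ^ k"
  by (simp add: floorlog_le_iff)

lemma pow_mono2: "2 \<le> m \<Longrightarrow> c \<le> d \<Longrightarrow> m ^ c \<le> m ^ d" for m :: nat
  by (simp add: power_increasing)

lemma pow_sum: "2 \<le> m \<Longrightarrow> x \<le> m ^ c \<Longrightarrow> y \<le> m ^ c \<Longrightarrow> x + y \<le> m ^ Suc c" for m :: nat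
proof -
  assume *: "2 \<le> m" "x \<le> m ^ c" "y \<le> m ^ c"
  then have "2 * m ^ c \<le> m * m ^ c" by (intro mult_right_mono) auto
  with * show ?thesis unfolding power_Suc by linarith
qed

abbreviation len_le :: "nat \<Rightarrow> nat \<Rightarrow> (nat \<Rightarrow> nat) \<Rightarrow> bool" where
  "len_le N m e \<equiv> \<forall>i<N. floorlog 2 (e i) \<le> m"

text \<open>From arguments of length at most \<open>k\<close>, addition yields length at most
  \<open>k + 1\<close>, multiplication \<open>2 * k\<close> and smash \<open>k * k + 1\<close>, all
  covered by \<open>k * k + k + 1\<close>. The assumption \<open>2 \<le> m\<close> lets constant
  factors and summands be absorbed into the exponent.\<close>

lemma len_tval_bound:
  "\<exists>c N. \<forall>m\<ge>2. \<forall>e. len_le N m e \<longrightarrow> floorlog 2 (tval \<N> e t) \<le> m ^ c"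
proof -
  have binary: "\<exists>c N. \<forall>m\<ge>2. \<forall>e. len_le N m e \<longrightarrow> floorlog 2 (h (f e) (g e)) \<le> m ^ c"
    if f: "\<exists>c N. \<forall>m\<ge>2. \<forall>e. len_le N m e \<longrightarrow> floorlog 2 (f e) \<le> m ^ c"
      and g: "\<exists>c N. \<forall>m\<ge>2. \<forall>e. len_le N m e \<longrightarrow> floorlog 2 (g e) \<le> m ^ c"
      and h: "\<And>x y k. floorlog 2 x \<le> k \<Longrightarrow> floorlog 2 y \<le> k \<Longrightarrow> floorlog 2 (h x y) \<le> k * k + k + 1"
    for h :: "nat \<Rightarrow> nat \<Rightarrow> nat" and f g :: "(nat \<Rightarrow> nat) \<Rightarrow> nat"
  proof -
    obtain c N where c: "\<And>m e. 2 \<le> m \<Longrightarrow> len_le N m e \<Longrightarrow> floorlog 2 (f e) \<le> m ^ c"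
      using f by blast
    obtain d N' where d: "\<And>m e. 2 \<le> m \<Longrightarrow> len_le N' m e \<Longrightarrow> floorlog 2 (g e) \<le> m ^ d"
      using g by blast
    let ?k = "max c d"
    have "floorlog 2 (h (f e) (g e)) \<le> m ^ (2 * ?k + 2)"
      if m: "2 \<le> m" and e: "len_le (max N N') m e" for m e
    proof -
      have "floorlog 2 (f e) \<le> m ^ ?k" "floorlog 2 (g e) \<le> m ^ ?k"
        using c[OF m, of e] d[OF m, of e] e pow_mono2[OF m, of c ?k] pow_mono2[OF m, of d ?k]
        by force+
      then have *: "floorlog 2 (h (f e) (g e)) \<le> m ^ ?k * m ^ ?k + m ^ ?k + 1" by (rule h)
      have "m ^ ?k * m ^ ?k = m ^ (2 * ?k)" by (simp add: power_add[symmetric] mult_2)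
      moreover have "m ^ ?k + 1 \<le> m ^ Suc ?k" using m by (intro pow_sum) auto
      moreover have "m ^ Suc ?k \<le> m ^ (2 * ?k + 1)" "m ^ (2 * ?k) \<le> m ^ (2 * ?k + 1)"
        using m by (auto intro!: pow_mono2)
      then have "m ^ (2 * ?k) + m ^ Suc ?k \<le> m ^ Suc (2 * ?k + 1)" using m by (intro pow_sum)
      ultimately show ?thesis using * by simp
    qed
    then show ?thesis by blast
  qed
  have unary: "\<exists>c N. \<forall>m\<ge>2. \<forall>e. len_le N m e \<longrightarrow> floorlog 2 (h (f e)) \<le> m ^ c"
    if f: "\<exists>c N. \<forall>m\<ge>2. \<forall>e. len_le N m e \<longrightarrow> floorlog 2 (f e) \<le> m ^ c"
      and h: "\<And>x. h x \<le> x" for h and f :: "(nat \<Rightarrow> nat) \<Rightarrow> nat"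
    using f floorlog_mono[OF h, of 2] by (meson order_trans)
  show ?thesis
  proof (induction t)
    case (Var k)
    show ?case by (intro exI[of _ 1] exI[of _ "Suc k"]) auto
  next
    case Zero
    show ?case by (simp add: floorlog_def)
  next
    case One
    show ?case by (intro exI[of _ 0]) auto
  next
    case (Add s t)
    have h: "floorlog 2 (x + y) \<le> k * k + k + 1" if "floorlog 2 x \<le> k" "floorlog 2 y \<le> k" for x y k
    proof -
      have "x + y < 2 ^ Suc k" using that by (simp add: len_le_iff)
      then have "floorlog 2 (x + y) \<le> Suc k" by (simp only: len_le_iff)
      then show ?thesis by simp
    qed
    show ?case using binary[OF Add.IH h] by simp
  next
    case (Mul s t)
    have h: "floorlog 2 (x * y) \<le> k * k + k + 1" if "floorlog 2 x \<le> k" "floorlog 2 y \<le> k" for x y k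
    proof -
      have "x * y < 2 ^ k * 2 ^ k" using that by (intro mult_strict_mono) (auto simp: len_le_iff)
      then have "floorlog 2 (x * y) \<le> k + k" by (simp only: len_le_iff power_add)
      also have "k + k \<le> k * k + k + 1" by (cases k) auto
      finally show ?thesis .
    qed
    show ?case using binary[OF Mul.IH h] by simp
  next
    case (Smash s t)
    have h: "floorlog 2 (2 ^ (floorlog 2 x * floorlog 2 y) :: nat) \<le> k * k + k + 1"
      if "floorlog 2 x \<le> k" "floorlog 2 y \<le> k" for x y k
    proof -
      have "floorlog 2 x * floorlog 2 y \<le> k * k" using that by (intro mult_le_mono)
      then have "(2 :: nat) ^ (floorlog 2 x * floorlog 2 y) < 2 ^ (k * k + k + 1)"
        by (intro power_strict_increasing) auto
      then show ?thesis by (simp only: len_le_iff)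
    qed
    show ?case using binary[OF Smash.IH h] by simp
  next
    case (Len t)
    have "floorlog 2 x \<le> x" for x by (simp add: len_le_iff)
    from unary[OF Len this] show ?case by simp
  next
    case (Half t)
    have "x div 2 \<le> x" for x :: nat by simp
    from unary[OF Half this] show ?case by simp
  qed
qed

text \<open>Unlike in \<open>certified\<close>, certificates hold against arbitrary relations and
  not only against linear orders of a segment. The induction on formulas thus needs no properties of
  orders and no bound \<open>B\<close>.\<close>

definition local_with :: "nat \<Rightarrow> ((nat \<Rightarrow> nat \<Rightarrow> bool) \<Rightarrow> bool) \<Rightarrow> bool" where
  "local_with K P \<longleftrightarrow> (\<forall>r. P r \<longrightarrow> (\<exists>C. finite C \<and> card C \<le> K \<and> (\<forall>r'. agree_on C r r' \<longrightarrow> P r')))"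

definition poly_local :: "((nat \<Rightarrow> nat) \<Rightarrow> (nat \<Rightarrow> nat \<Rightarrow> bool) \<Rightarrow> bool) \<Rightarrow> bool" where
  "poly_local P \<longleftrightarrow> (\<exists>c N. \<forall>m\<ge>2. \<forall>e. len_le N m e \<longrightarrow> local_with (m ^ c) (P e))"

lemma local_withE:
  assumes "local_with K P" "P r"
  obtains C where "finite C" "card C \<le> K" "\<forall>r'. agree_on C r r' \<longrightarrow> P r'"
  using assms(1)[unfolded local_with_def, rule_format, OF assms(2)] that by (elim exE conjE)

lemma local_withI:
  assumes "\<And>r. P r \<Longrightarrow> \<exists>C. finite C \<and> card C \<le> K \<and> (\<forall>r'. agree_on C r r' \<longrightarrow> P r')"
  shows "local_with K P"
  unfolding local_with_def by (intro allI impI assms)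

lemma local_with_mono:
  assumes "local_with K P" "K \<le> K'"
  shows "local_with K' P"
proof (rule local_withI)
  fix r assume "P r"
  with assms(1) obtain C where "finite C" "card C \<le> K" "\<forall>r'. agree_on C r r' \<longrightarrow> P r'"
    by (rule local_withE)
  then show "\<exists>C. finite C \<and> card C \<le> K' \<and> (\<forall>r'. agree_on C r r' \<longrightarrow> P r')"
    by (intro exI[of _ C] conjI order_trans[OF _ assms(2)])
qed

lemma local_certified:
  assumes "local_with K P"
  shows "certified B K P"
  unfolding certified_def forces_nat_def
proof (intro allI impI)
  fix r assume "P r"
  with assms obtain C where C: "finite C" "card C \<le> K" "\<forall>r'. agree_on C r r' \<longrightarrow> P r'"
    by (rule local_withE)
  show "\<exists>C. finite C \<and> card C \<le> K \<and> (\<forall>r'. linord B r' \<longrightarrow> agree_on C r r' \<longrightarrow> P r')"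
    by (intro exI[of _ C] conjI allI impI C C(3)[rule_format])
qed

lemma poly_local_const: "poly_local (\<lambda>e r. P e)"
  unfolding poly_local_def local_with_def
  by (intro exI[of _ 0] allI impI exI[of _ "{}"]) simp

text \<open>At most two points matter, and \<open>2 \<le> m\<close> makes them fit into
  \<open>m ^ 1\<close>. The predicate \<open>Q\<close> serves to treat an atom and its negation at
  once.\<close>

lemma poly_local_atom: "poly_local (\<lambda>e r. Q (r (f e) (g e)))"
  unfolding poly_local_def local_with_def
proof (intro exI[of _ 1] exI[of _ 0] allI impI)
  fix m :: nat and e r assume *: "2 \<le> m" "Q (r (f e) (g e))"
  have "card {f e, g e} \<le> 2" by (simp add: card_insert_if)
  moreover have "Q (r' (f e) (g e))" if "agree_on {f e, g e} r r'" for r'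
  proof -
    have "r (f e) (g e) = r' (f e) (g e)" using that by (simp add: agree_on_def)
    with * show ?thesis by simp
  qed
  ultimately show "\<exists>C. finite C \<and> card C \<le> m ^ 1 \<and> (\<forall>r'. agree_on C r r' \<longrightarrow> Q (r' (f e) (g e)))"
    using *(1) by (intro exI[of _ "{f e, g e}"]) simp
qed

lemma poly_local_common:
  assumes "poly_local P" "poly_local Q"
  obtains c N where "\<And>m e. 2 \<le> m \<Longrightarrow> len_le N m e \<Longrightarrow>
    local_with (m ^ c) (P e) \<and> local_with (m ^ c) (Q e)"
proof -
  obtain c N where c: "\<And>m e. 2 \<le> m \<Longrightarrow> len_le N m e \<Longrightarrow> local_with (m ^ c) (P e)"
    using assms(1) unfolding poly_local_def by blast
  obtain c' N' where c': "\<And>m e. 2 \<le> m \<Longrightarrow> len_le N' m e \<Longrightarrow> local_with (m ^ c') (Q e)"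
    using assms(2) unfolding poly_local_def by blast
  show thesis
  proof (rule that[of "max N N'" "max c c'"])
    fix m e assume m: "2 \<le> (m::nat)" and e: "len_le (max N N') m e"
    show "local_with (m ^ max c c') (P e) \<and> local_with (m ^ max c c') (Q e)"
      using local_with_mono[OF c[OF m, of e] pow_mono2[OF m, of c "max c c'"]]
        local_with_mono[OF c'[OF m, of e] pow_mono2[OF m, of c' "max c c'"]] e
      by auto
  qed
qed

lemma local_with_conj:
  assumes "local_with K P" "local_with K' Q"
  shows "local_with (K + K') (\<lambda>r. P r \<and> Q r)"
proof (rule local_withI)
  fix r assume r: "P r \<and> Q r"
  obtain C where C: "finite C" "card C \<le> K" "\<forall>r'. agree_on C r r' \<longrightarrow> P r'"
    by (rule local_withE[OF assms(1) r[THEN conjunct1]])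
  obtain C' where C': "finite C'" "card C' \<le> K'" "\<forall>r'. agree_on C' r r' \<longrightarrow> Q r'"
    by (rule local_withE[OF assms(2) r[THEN conjunct2]])
  have "card (C \<union> C') \<le> K + K'" using C C' card_Un_le[of C C'] by linarith
  moreover have "P r' \<and> Q r'" if "agree_on (C \<union> C') r r'" for r'
    using C(3)[rule_format, OF agree_on_mono[OF that]] C'(3)[rule_format, OF agree_on_mono[OF that]]
    by simp
  ultimately show "\<exists>C. finite C \<and> card C \<le> K + K' \<and> (\<forall>r'. agree_on C r r' \<longrightarrow> P r' \<and> Q r')"
    using C(1) C'(1) by (intro exI[of _ "C \<union> C'"]) simp
qed

lemma local_with_ball:
  assumes "\<And>x. x \<le> k \<Longrightarrow> local_with K (P x)"
  shows "local_with ((k + 1) * K) (\<lambda>r. \<forall>x\<le>k. P x r)"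
proof -
  have "local_with (j * K) (\<lambda>r. \<forall>x<j. P x r)" if "j \<le> k + 1" for j
    using that
  proof (induction j)
    case 0
    show ?case unfolding local_with_def by (intro allI impI exI[of _ "{}"]) auto
  next
    case (Suc j)
    have "local_with (K + j * K) (\<lambda>r. P j r \<and> (\<forall>x<j. P x r))"
      using Suc assms[of j] by (intro local_with_conj) auto
    moreover have "(\<lambda>r. P j r \<and> (\<forall>x<j. P x r)) = (\<lambda>r. \<forall>x<Suc j. P x r)" by (auto simp: less_Suc_eq)
    ultimately show ?case by simp
  qed
  from this[of "k + 1"] show ?thesis by (simp add: less_Suc_eq_le)
qed

text \<open>The certificate of a single witness suffices, so the size does not depend on the number
  of candidates. This is why existential quantifiers need no sharp bound.\<close>

lemma local_with_bex:
  assumes "\<And>x. Q x \<Longrightarrow> local_with K (P x)"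
  shows "local_with K (\<lambda>r. \<exists>x. Q x \<and> P x r)"
proof (rule local_withI)
  fix r assume "\<exists>x. Q x \<and> P x r"
  then obtain x where x: "Q x" "P x r" by blast
  obtain C where "finite C" "card C \<le> K" "\<forall>r'. agree_on C r r' \<longrightarrow> P x r'"
    by (rule local_withE[OF assms[OF x(1)] x(2)])
  with x(1) show "\<exists>C. finite C \<and> card C \<le> K \<and> (\<forall>r'. agree_on C r r' \<longrightarrow> (\<exists>x. Q x \<and> P x r'))"
    by (intro exI[of _ C] conjI allI impI exI[of _ x]) simp_all
qed

lemma poly_local_conj: "poly_local P \<Longrightarrow> poly_local Q \<Longrightarrow> poly_local (\<lambda>e r. P e r \<and> Q e r)"
proof (erule (1) poly_local_common)
  fix c N assume c: "\<And>m e. 2 \<le> m \<Longrightarrow> len_le N m e \<Longrightarrow>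
    local_with (m ^ c) (P e) \<and> local_with (m ^ c) (Q e)"
  have "local_with (m ^ Suc c) (\<lambda>r. P e r \<and> Q e r)"
    if "2 \<le> m" "len_le N m e" for m e
    using local_with_mono[OF local_with_conj pow_sum[OF that(1) order_refl order_refl]] c[OF that] by blast
  then show ?thesis unfolding poly_local_def by blast
qed

lemma poly_local_disj: "poly_local P \<Longrightarrow> poly_local Q \<Longrightarrow> poly_local (\<lambda>e r. P e r \<or> Q e r)"
proof (erule (1) poly_local_common)
  fix c N assume c: "\<And>m e. 2 \<le> m \<Longrightarrow> len_le N m e \<Longrightarrow>
    local_with (m ^ c) (P e) \<and> local_with (m ^ c) (Q e)"
  have "local_with (m ^ c) (\<lambda>r. P e r \<or> Q e r)"
    if m: "2 \<le> m" "len_le N m e" for m e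
  proof (rule local_withI)
    fix r assume "P e r \<or> Q e r"
    then show "\<exists>C. finite C \<and> card C \<le> m ^ c \<and> (\<forall>r'. agree_on C r r' \<longrightarrow> P e r' \<or> Q e r')"
    proof
      assume "P e r"
      obtain C where "finite C" "card C \<le> m ^ c" "\<forall>r'. agree_on C r r' \<longrightarrow> P e r'"
        by (rule local_withE[OF conjunct1[OF c[OF m]] \<open>P e r\<close>])
      then show ?thesis by (intro exI[of _ C] conjI allI impI disjI1) simp_all
    next
      assume "Q e r"
      obtain C where "finite C" "card C \<le> m ^ c" "\<forall>r'. agree_on C r r' \<longrightarrow> Q e r'"
        by (rule local_withE[OF conjunct2[OF c[OF m]] \<open>Q e r\<close>])
      then show ?thesis by (intro exI[of _ C] conjI allI impI disjI2) simp_all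
    qed
  qed
  then show ?thesis unfolding poly_local_def by blast
qed

lemma poly_local_under_quantifier:
  assumes "poly_local P"
  shows "\<exists>c N. \<forall>m\<ge>2. \<forall>e. len_le N m e \<longrightarrow> (\<forall>x\<le>tval \<N> e t.
    floorlog 2 (tval \<N> e t) \<le> m ^ c \<and> local_with (m ^ c) (P (case_nat x e)))"
proof -
  obtain c N where c: "\<And>m e. 2 \<le> m \<Longrightarrow> len_le N m e \<Longrightarrow> local_with (m ^ c) (P e)"
    using assms unfolding poly_local_def by blast
  obtain d N' where d: "\<And>m e. 2 \<le> m \<Longrightarrow> len_le N' m e \<Longrightarrow>
      floorlog 2 (tval \<N> e t) \<le> m ^ d"
    using len_tval_bound[of t] by blast
  show ?thesis
  \<comment> \<open>The exponent majorizes two bounds: \<open>m ^ d\<close> for the length of the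
    term, and \<open>(m ^ Suc d) ^ c\<close> for the certificate, since the enlarged assignment has
    entries of length up to \<open>m ^ Suc d\<close>.\<close>
  proof (rule exI[of _ "d + Suc d * c"], rule exI[of _ "max N N'"], intro allI impI)
    fix m x :: nat and e
    assume m: "2 \<le> m" and e: "len_le (max N N') m e" and x: "x \<le> tval \<N> e t"
    have t: "floorlog 2 (tval \<N> e t) \<le> m ^ d" using d[OF m] e by simp
    have "m ^ 1 \<le> m ^ Suc d" by (rule pow_mono2[OF m]) simp
    then have m1: "m \<le> m ^ Suc d" by simp
    have "floorlog 2 x \<le> m ^ Suc d"
      using floorlog_mono[OF x, of 2] t pow_mono2[OF m, of d "Suc d"] by linarith
    then have "floorlog 2 (case_nat x e i) \<le> m ^ Suc d" if "i < N" for i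
    proof (cases i)
      case (Suc j)
      then have "floorlog 2 (e j) \<le> m" using e that by simp
      with m1 have "floorlog 2 (e j) \<le> m ^ Suc d" by (rule order_trans[rotated])
      with Suc show ?thesis by simp
    qed (use \<open>floorlog 2 x \<le> m ^ Suc d\<close> in simp)
    then have "local_with ((m ^ Suc d) ^ c) (P (case_nat x e))"
      by (intro c allI impI order_trans[OF m m1])
    then have "local_with (m ^ (d + Suc d * c)) (P (case_nat x e))"
      using local_with_mono pow_mono2[OF m, of "Suc d * c" "d + Suc d * c"]
      by (simp only: power_mult[symmetric])
    moreover have "m ^ d \<le> m ^ (d + Suc d * c)" by (rule pow_mono2[OF m]) simp
    ultimately show "floorlog 2 (tval \<N> e t) \<le> m ^ (d + Suc d * c) \<and>
        local_with (m ^ (d + Suc d * c)) (P (case_nat x e))"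
      using t by simp
  qed
qed

lemma poly_localI:
  assumes "\<And>m e. 2 \<le> m \<Longrightarrow> len_le N m e \<Longrightarrow> local_with (m ^ c) (P e)"
  shows "poly_local P"
  unfolding poly_local_def by (rule exI[of _ c], rule exI[of _ N], intro allI impI) (rule assms)

lemma poly_local_bex:
  assumes "poly_local P"
  shows "poly_local (\<lambda>e r. \<exists>x. x \<le> tval \<N> e t \<and> P (case_nat x e) r)"
proof -
  obtain c N where c: "\<forall>m\<ge>2. \<forall>e. len_le N m e \<longrightarrow> (\<forall>x\<le>tval \<N> e t.
    floorlog 2 (tval \<N> e t) \<le> m ^ c \<and> local_with (m ^ c) (P (case_nat x e)))"
    using poly_local_under_quantifier[OF assms, of t] by (elim exE)
  show ?thesis
  proof (rule poly_localI[of N c])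
    fix m e assume "2 \<le> m" and e: "len_le N m e"
    then show "local_with (m ^ c) (\<lambda>r. \<exists>x. x \<le> tval \<N> e t \<and> P (case_nat x e) r)"
      using c by (intro local_with_bex) simp
  qed
qed

text \<open>Every instance needs its own certificate, and their number is one more than the length
  of the term, hence polynomial. Here the quantifier has to be sharply bounded.\<close>

lemma poly_local_ball_len:
  assumes "poly_local P"
  shows "poly_local (\<lambda>e r. \<forall>x\<le>floorlog 2 (tval \<N> e t). P (case_nat x e) r)"
proof -
  obtain d N' where d: "\<And>m e. 2 \<le> m \<Longrightarrow> len_le N' m e \<Longrightarrow>
      floorlog 2 (tval \<N> e t) \<le> m ^ d"
    using len_tval_bound[of t] by blast
  obtain c N where c: "\<forall>m\<ge>2. \<forall>e. len_le N m e \<longrightarrow>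
    (\<forall>x\<le>tval \<N> e (Len t). floorlog 2 (tval \<N> e (Len t)) \<le> m ^ c \<and>
      local_with (m ^ c) (P (case_nat x e)))"
    using poly_local_under_quantifier[OF assms, of "Len t"] by (elim exE)
  show ?thesis
  proof (rule poly_localI[of "max N N'" "Suc d + c"])
    fix m e assume m: "2 \<le> (m::nat)" and e: "len_le (max N N') m e"
    have "local_with (m ^ c) (P (case_nat x e))" if "x \<le> floorlog 2 (tval \<N> e t)" for x
      using c[rule_format, of m e x] m e that by simp
    then have "local_with ((floorlog 2 (tval \<N> e t) + 1) * m ^ c)
        (\<lambda>r. \<forall>x\<le>floorlog 2 (tval \<N> e t). P (case_nat x e) r)"
      by (rule local_with_ball)
    moreover have "floorlog 2 (tval \<N> e t) + 1 \<le> m ^ Suc d"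
      using d[OF m, of e] e m by (intro pow_sum) auto
    then have "(floorlog 2 (tval \<N> e t) + 1) * m ^ c \<le> m ^ (Suc d + c)"
      unfolding power_add by (rule mult_right_mono) simp
    ultimately show "local_with (m ^ (Suc d + c))
        (\<lambda>r. \<forall>x\<le>floorlog 2 (tval \<N> e t). P (case_nat x e) r)"
      by (rule local_with_mono)
  qed
qed

lemma sat_BEx: "sat \<N> r e (BEx t a) \<longleftrightarrow>
    (\<exists>x. x \<le> tval \<N> e t \<and> sat \<N> r (case_nat x e) a)"
  by simp

lemma sat_BAll: "sat \<N> r e (BAll t a) \<longleftrightarrow>
    (\<forall>x\<le>tval \<N> e t. sat \<N> r (case_nat x e) a)"
  by auto

lemma sat_not_BEx: "\<not> sat \<N> r e (BEx t a) \<longleftrightarrow>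
    (\<forall>x\<le>tval \<N> e t. \<not> sat \<N> r (case_nat x e) a)"
  by auto

lemma sat_not_BAll: "\<not> sat \<N> r e (BAll t a) \<longleftrightarrow>
    (\<exists>x. x \<le> tval \<N> e t \<and> \<not> sat \<N> r (case_nat x e) a)"
  by auto

lemma poly_local_BAll_Len:
  "poly_local (\<lambda>e r. sat \<N> r e a) \<Longrightarrow> poly_local (\<lambda>e r. sat \<N> r e (BAll (Len t) a))"
  unfolding sat_BAll tval.simps nat_structure_simps by (rule poly_local_ball_len)

lemma poly_local_BEx:
  "poly_local (\<lambda>e r. sat \<N> r e a) \<Longrightarrow> poly_local (\<lambda>e r. sat \<N> r e (BEx t a))"
  unfolding sat_BEx by (rule poly_local_bex)

text \<open>Sharply bounded formulas are closed under negation, so both signs are treated in one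
  induction; the two quantifiers exchange their roles under negation.\<close>

lemma poly_local_sharply_bounded:
  assumes "sharply_bounded a"
  shows "poly_local (\<lambda>e r. sat \<N> r e a) \<and> poly_local (\<lambda>e r. \<not> sat \<N> r e a)"
  using assms
proof (induction rule: sharply_bounded.induct)
  case (3 s t)
  show ?case unfolding sat.simps
    by (intro conjI poly_local_atom[of "\<lambda>x. x"] poly_local_atom[of Not])
next
  case (4 a)
  then show ?case by simp
next
  case (5 a b)
  then show ?case unfolding sat.simps de_Morgan_conj
    by (intro conjI poly_local_conj poly_local_disj) blast+
next
  case (6 a b)
  then show ?case unfolding sat.simps de_Morgan_disj
    by (intro conjI poly_local_conj poly_local_disj) blast+
next
  case (7 a t)
  have "poly_local (\<lambda>e r. \<not> sat \<N> r e (BAll (Len t) a))"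
    unfolding sat_not_BAll by (rule poly_local_bex) (rule 7(2)[THEN conjunct2])
  then show ?case using poly_local_BAll_Len[OF 7(2)[THEN conjunct1]] by (intro conjI)
next
  case (8 a t)
  have "poly_local (\<lambda>e r. \<not> sat \<N> r e (BEx (Len t) a))"
    unfolding sat_not_BEx tval.simps nat_structure_simps
    by (rule poly_local_ball_len) (rule 8(2)[THEN conjunct2])
  then show ?case using poly_local_BEx[OF 8(2)[THEN conjunct1]] by (intro conjI)
qed (simp_all add: poly_local_const)

lemma poly_local_Sigma_b1:
  assumes "Sigma_b1 a"
  shows "poly_local (\<lambda>e r. sat \<N> r e a)"
  using assms
proof (induction rule: Sigma_b1.induct)
  case (1 a)
  then show ?case using poly_local_sharply_bounded by blast
next
  case (2 a b)
  show ?case unfolding sat.simps using 2(3,4) by (rule poly_local_conj)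
next
  case (3 a b)
  show ?case unfolding sat.simps using 3(3,4) by (rule poly_local_disj)
next
  case (4 a t)
  show ?case using 4(2) by (rule poly_local_BAll_Len)
next
  case (5 a t)
  show ?case using 5(2) by (rule poly_local_BEx)
next
  case (6 a t)
  show ?case using 6(2) by (rule poly_local_BEx)
qed

lemma certified_Sigma_b1:
  assumes "Sigma_b1 a"
  shows "\<exists>c N. \<forall>m\<ge>2. \<forall>e B. len_le N m e \<longrightarrow>
    certified B (m ^ c) (\<lambda>r. sat \<N> r e a)"
proof -
  obtain c N where c: "\<forall>m\<ge>2. \<forall>e. len_le N m e \<longrightarrow>
      local_with (m ^ c) (\<lambda>r. sat \<N> r e a)"
    using poly_local_Sigma_b1[OF assms] unfolding poly_local_def by (elim exE)
  show ?thesis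
  proof (rule exI[of _ c], rule exI[of _ N], intro allI impI)
    fix m e B assume "2 \<le> m" "len_le N m e"
    then show "certified B (m ^ c) (\<lambda>r. sat \<N> r e a)"
      using c by (intro local_certified) simp
  qed
qed

subsection \<open>Density in the standard model\<close>

text \<open>A Henkin-type requirement for the truth lemma: forcing an existential formula does not
  by itself provide a witness common to all orders that agree with the condition.\<close>

definition BEx_witnessed ::
  "'a L_structure \<Rightarrow> trm \<Rightarrow> fm \<Rightarrow> 'a \<Rightarrow> 'a \<Rightarrow> 'a \<Rightarrow> (nat \<Rightarrow> 'a) \<Rightarrow> bool" where
  "BEx_witnessed S t a B D l e \<longleftrightarrow> forces S (\<^bold>\<not> BEx t a) B D l e \<or>
     (\<exists>x\<in>univ S. leq S x (tval S e t) \<and> forces S a B D l (case_nat x e))"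

definition BAll_witnessed ::
  "'a L_structure \<Rightarrow> trm \<Rightarrow> fm \<Rightarrow> 'a \<Rightarrow> 'a \<Rightarrow> 'a \<Rightarrow> (nat \<Rightarrow> 'a) \<Rightarrow> bool" where
  "BAll_witnessed S t a B D l e \<longleftrightarrow> forces S (BAll t a) B D l e \<or>
     (\<exists>x\<in>univ S. leq S x (tval S e t) \<and> forces S (\<^bold>\<not> a) B D l (case_nat x e))"

text \<open>Allows a common treatment of both schemes: the flag selects the step of polynomial
  induction, its absence that of ordinary induction.\<close>

definition predecessor :: "bool \<Rightarrow> 'a L_structure \<Rightarrow> 'a \<Rightarrow> 'a \<Rightarrow> bool" where
  "predecessor binary S x y \<longleftrightarrow> (if binary then x = half S y else y = add S x (un S))"

text \<open>The bound of the induction is \<open>e 0\<close>; in the pigeonhole principle \<open>v\<close> is \<open>e 0\<close> and \<open>u\<close> is \<open>e 1\<close>.\<close>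

definition induction_decided ::
  "bool \<Rightarrow> 'a L_structure \<Rightarrow> fm \<Rightarrow> 'a \<Rightarrow> 'a \<Rightarrow> 'a \<Rightarrow> (nat \<Rightarrow> 'a) \<Rightarrow> bool" where
  "induction_decided binary S a B D l e \<longleftrightarrow>
     forces S (\<^bold>\<not> a) B D l (case_nat (zer S) (\<lambda>k. e (Suc k))) \<or> forces S a B D l e \<or>
     (\<exists>x\<in>univ S. \<exists>y\<in>univ S. leq S x y \<and> leq S y (e 0) \<and> predecessor binary S x y \<and>
        forces S a B D l (case_nat x (\<lambda>k. e (Suc k))) \<and>
        forces S (\<^bold>\<not> a) B D l (case_nat y (\<lambda>k. e (Suc k))))"

definition PHP_decided ::
  "'a L_structure \<Rightarrow> fm \<Rightarrow> 'a \<Rightarrow> 'a \<Rightarrow> 'a \<Rightarrow> (nat \<Rightarrow> 'a) \<Rightarrow> bool" where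
  "PHP_decided S a B D l e \<longleftrightarrow> (lt S (e 0) (e 1) \<longrightarrow>
     (\<exists>x\<in>univ S. lt S x (e 1) \<and> (\<forall>y\<in>univ S. lt S y (e 0) \<longrightarrow>
        forces S (\<^bold>\<not> a) B D l (case_nat x (case_nat y (\<lambda>k. e (Suc (Suc k))))))) \<or>
     (\<exists>x\<in>univ S. \<exists>x'\<in>univ S. \<exists>y\<in>univ S. lt S x (e 1) \<and> lt S x' (e 1) \<and> x \<noteq> x' \<and> lt S y (e 0) \<and>
        forces S a B D l (case_nat x (case_nat y (\<lambda>k. e (Suc (Suc k))))) \<and>
        forces S a B D l (case_nat x' (case_nat y (\<lambda>k. e (Suc (Suc k)))))) \<or>
     (\<exists>x\<in>univ S. \<exists>y\<in>univ S. \<exists>y'\<in>univ S. lt S x (e 1) \<and> lt S y (e 0) \<and> lt S y' (e 0) \<and> y \<noteq> y' \<and>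
        forces S a B D l (case_nat x (case_nat y (\<lambda>k. e (Suc (Suc k))))) \<and>
        forces S a B D l (case_nat x (case_nat y' (\<lambda>k. e (Suc (Suc k)))))))"

lemma forces_code:
  "set_decode d = D \<Longrightarrow> rel \<N> l = r \<Longrightarrow> forces \<N> a B d l e \<longleftrightarrow>
    forces_nat B D r (\<lambda>r. sat \<N> r e a)"
  by (simp add: forces_nat_structure)

lemma forces_code_Neg:
  "set_decode d = D \<Longrightarrow> rel \<N> l = r \<Longrightarrow> forces \<N> (\<^bold>\<not> a) B d l e \<longleftrightarrow>
    forces_nat B D r (\<lambda>r. \<not> sat \<N> r e a)"
  by (simp add: forces_nat_structure)

lemma not_forces_not:
  "\<not> forces_nat B D r (\<lambda>r. \<not> P r) \<Longrightarrow> \<exists>s. linord B s \<and> agree_on D r s \<and> P s"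
  by (auto simp: forces_nat_def)

lemma size_bound:
  fixes m :: nat
  assumes "2 \<le> m" "x \<le> m" "y \<le> m ^ c"
  shows "x + y \<le> m ^ (c + 2)"
proof -
  have "m ^ 1 \<le> m ^ (c + 1)" by (rule pow_mono2[OF assms(1)]) simp
  then have x: "x \<le> m ^ (c + 1)"
    unfolding power_one_right by (rule order_trans[OF assms(2)])
  have "m ^ c \<le> m ^ (c + 1)" by (rule pow_mono2[OF assms(1)]) simp
  then have y: "y \<le> m ^ (c + 1)" by (rule order_trans[OF assms(3)])
  from pow_sum[OF assms(1) x y] show ?thesis by simp
qed

lemma certified_under_quantifier:
  assumes "Sigma_b1 a"
  shows "\<exists>c N. \<forall>m\<ge>2. \<forall>e B. len_le N m e \<longrightarrow>
    (\<forall>x\<le>tval \<N> e t. certified B (m ^ c) (\<lambda>r. sat \<N> r (case_nat x e) a))"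
proof -
  obtain c N where c: "\<forall>m\<ge>2. \<forall>e. len_le N m e \<longrightarrow> (\<forall>x\<le>tval \<N> e t.
    floorlog 2 (tval \<N> e t) \<le> m ^ c \<and>
    local_with (m ^ c) (\<lambda>r. sat \<N> r (case_nat x e) a))"
    using poly_local_under_quantifier[OF poly_local_Sigma_b1[OF assms], of t] by (elim exE)
  show ?thesis
  proof (rule exI[of _ c], rule exI[of _ N], intro allI impI)
    fix m e B x
    assume "2 \<le> m" "len_le N m e" "x \<le> tval \<N> e t"
    then show "certified B (m ^ c) (\<lambda>r. sat \<N> r (case_nat x e) a)"
      using c by (intro local_certified) simp
  qed
qed

lemma dense_BEx_witnessed:
  assumes "Sigma_b1 a"
  shows "\<exists>c N. \<forall>e. dense_req \<N> c N (BEx_witnessed \<N> t a) e"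
proof -
  obtain c N where c': "\<forall>m\<ge>2. \<forall>e B. len_le N m e \<longrightarrow>
    (\<forall>x\<le>tval \<N> e t. certified B (m ^ c) (\<lambda>r. sat \<N> r (case_nat x e) a))"
    using certified_under_quantifier[OF assms, of "t"] by (elim exE)
  note c = c'[rule_format]
  have "dense_req \<N> (c + 2) N (BEx_witnessed \<N> t a) e" for e
  proof (rule dense_req_natI)
    fix m B and D :: "nat set" and r
    assume m: "2 \<le> m" and e: "\<And>i. i < N \<Longrightarrow> floorlog 2 (e i) \<le> m"
      and r: "linord B r" "finite D" and D: "card D \<le> m"
    show "\<exists>D' r'. extends B D r (m ^ (c + 2)) D' r' \<and>
       (\<forall>d l. set_decode d = D' \<longrightarrow> rel \<N> l = r' \<longrightarrow> BEx_witnessed \<N> t a B d l e)"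
    proof (cases "forces_nat B D r (\<lambda>r. \<not> sat \<N> r e (BEx t a))")
      case True
      have "extends B D r (m ^ (c + 2)) D r"
        using size_bound[OF m D, of 0 c] by (intro extends_refl r) simp
      moreover have "BEx_witnessed \<N> t a B d l e"
        if "set_decode d = D" "rel \<N> l = r" for d l
        using True unfolding BEx_witnessed_def forces_code_Neg[OF that] by (rule disjI1)
      ultimately show ?thesis by (intro exI[of _ D] exI[of _ r] conjI allI impI)
    next
      case False
      then obtain s where s: "linord B s" "agree_on D r s" "sat \<N> s e (BEx t a)"
        using not_forces_not[OF False] by (elim exE conjE)
      then obtain x where x: "x \<le> tval \<N> e t" "sat \<N> s (case_nat x e) a"
        unfolding sat_BEx by (elim exE conjE)
      have cert: "certified B (m ^ c) (\<lambda>r. sat \<N> r (case_nat x e) a)"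
        by (rule c[OF m e x(1)])
      obtain D' where D': "extends B D r (card D + m ^ c) D' s"
        and f: "forces_nat B D' s (\<lambda>r. sat \<N> r (case_nat x e) a)"
        using extend_certified[OF cert s(1,2) x(2) r(2)] by (elim exE conjE)
      have "extends B D r (m ^ (c + 2)) D' s" by (rule extends_le[OF D' size_bound[OF m D order_refl]])
      moreover have "BEx_witnessed \<N> t a B d l e"
        if "set_decode d = D'" "rel \<N> l = s" for d l
        unfolding BEx_witnessed_def forces_code[OF that]
        by (intro disjI2 bexI[of _ x] conjI f) (simp_all add: x)
      ultimately show ?thesis by (intro exI[of _ D'] exI[of _ s] conjI allI impI)
    qed
  qed
  then show ?thesis by (intro exI allI)
qed

lemma dense_BAll_witnessed:
  assumes "Sigma_b1 a"
  shows "\<exists>c N. \<forall>e. dense_req \<N> c N (BAll_witnessed \<N> (Len t) a) e"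
proof -
  obtain c N where c': "\<forall>m\<ge>2. \<forall>e B. len_le N m e \<longrightarrow>
    (\<forall>x\<le>tval \<N> e (Len t). certified B (m ^ c) (\<lambda>r. sat \<N> r (case_nat x e) a))"
    using certified_under_quantifier[OF assms, of "(Len t)"] by (elim exE)
  note c = c'[rule_format]
  obtain d N' where d: "\<And>m e. 2 \<le> m \<Longrightarrow> len_le N' m e \<Longrightarrow>
      floorlog 2 (tval \<N> e t) \<le> m ^ d"
    using len_tval_bound[of t] by blast
  have "dense_req \<N> (Suc d + c + 2) (max N N') (BAll_witnessed \<N> (Len t) a) e" for e
  proof (rule dense_req_natI)
    fix m B and D :: "nat set" and r
    assume m: "2 \<le> m" and e: "\<And>i. i < max N N' \<Longrightarrow> floorlog 2 (e i) \<le> m"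
      and r: "linord B r" "finite D" and D: "card D \<le> m"
    define n where "n = tval \<N> e (Len t)"
    have P: "certified B (m ^ c) (\<lambda>r. sat \<N> r (case_nat i e) a)" if "i \<le> n" for i
      using m e that by (intro c) (auto simp: n_def)
    have "n \<le> m ^ d" using d[OF m, of e] e by (simp add: n_def)
    then have "n + 1 \<le> m ^ Suc d" using m by (intro pow_sum) auto
    then have size: "(n + 1) * m ^ c \<le> m ^ (Suc d + c)"
      unfolding power_add by (rule mult_right_mono) simp
    have "\<exists>D' r'. extends B D r (card D + (n + 1) * m ^ c) D' r' \<and>
        ((\<forall>i\<le>n. forces_nat B D' r' (\<lambda>r. sat \<N> r (case_nat i e) a)) \<or>
         (\<exists>i\<le>n. forces_nat B D' r' (\<lambda>r. \<not> sat \<N> r (case_nat i e) a)))" (is "\<exists>D' r'. _ \<and> ?f D' r'")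
      by (rule extend_decide_all[OF _ r]) (rule P)
    then obtain D' r' where D': "extends B D r (card D + (n + 1) * m ^ c) D' r'"
      and f: "?f D' r'"
      by (elim exE conjE)
    have E: "extends B D r (m ^ (Suc d + c + 2)) D' r'"
      by (intro extends_le[OF D'] size_bound m D size)
    have "BAll_witnessed \<N> (Len t) a B d l e"
      if "set_decode d = D'" "rel \<N> l = r'" for d l
      using f
    proof
      assume "\<forall>i\<le>n. forces_nat B D' r' (\<lambda>r. sat \<N> r (case_nat i e) a)"
      then have "forces_nat B D' r' (\<lambda>r. sat \<N> r e (BAll (Len t) a))"
        unfolding forces_nat_def sat_BAll n_def by (intro allI impI) simp
      then show ?thesis unfolding BAll_witnessed_def forces_code[OF that] by (rule disjI1)
    next
      assume "\<exists>i\<le>n. forces_nat B D' r' (\<lambda>r. \<not> sat \<N> r (case_nat i e) a)"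
      then obtain i where "i \<le> n" "forces_nat B D' r' (\<lambda>r. \<not> sat \<N> r (case_nat i e) a)"
        by (elim exE conjE)
      then show ?thesis unfolding BAll_witnessed_def forces_code_Neg[OF that] n_def
        by (intro disjI2 bexI[of _ i] conjI) simp_all
    qed
    with E show "\<exists>D' r'. extends B D r (m ^ (Suc d + c + 2)) D' r' \<and>
       (\<forall>d l. set_decode d = D' \<longrightarrow> rel \<N> l = r' \<longrightarrow>
          BAll_witnessed \<N> (Len t) a B d l e)"
      by (intro exI[of _ D'] exI[of _ r'] conjI allI impI)
  qed
  then show ?thesis by (intro exI allI)
qed

lemma certified_up_to:
  assumes "Sigma_b1 a"
  shows "\<exists>c N. \<forall>m\<ge>2. \<forall>e B. len_le (Suc N) m e \<longrightarrow>
    (\<forall>x\<le>e 0. certified B (m ^ c) (\<lambda>r. sat \<N> r (case_nat x (\<lambda>k. e (Suc k))) a))"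
proof -
  obtain c N where c': "\<forall>m\<ge>2. \<forall>e B. len_le N m e \<longrightarrow>
    certified B (m ^ c) (\<lambda>r. sat \<N> r e a)"
    using certified_Sigma_b1[OF assms] by (elim exE)
  note c = c'[rule_format]
  show ?thesis
  proof (rule exI[of _ c], rule exI[of _ N], intro allI impI, rule c)
    fix m :: nat and e x i
    assume e: "len_le (Suc N) m e" and x: "x \<le> e 0" and "i < N"
    then show "floorlog 2 (case_nat x (\<lambda>k. e (Suc k)) i) \<le> m"
      using floorlog_mono[OF x, of 2] e[rule_format, of 0] e[rule_format, of i]
      by (cases i) auto
  qed
qed

text \<open>The desired number is the prefix of \<open>b\<close> that is one binary digit longer
  than \<open>x\<close>. The induction on \<open>i\<close> passes over exponents where the quotient
  does not change, which happens only when it has reached 0.\<close>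

lemma next_prefix:
  fixes b :: nat
  assumes "x < b" "x = b div 2 ^ i"
  shows "\<exists>j. x < b div 2 ^ j \<and> x = b div 2 ^ j div 2"
  using assms
proof (induction i)
  case 0
  then show ?case by simp
next
  case (Suc i)
  have eq: "b div 2 ^ Suc i = b div 2 ^ i div 2" by (simp only: power_Suc2 div_mult2_eq)
  show ?case
  proof (cases "x = b div 2 ^ i")
    case True
    then show ?thesis using Suc by blast
  next
    case False
    then show ?thesis using Suc.prems eq by (intro exI[of _ i]) auto
  qed
qed

lemma dense_induction_decided:
  assumes "Sigma_b1 a"
  shows "\<exists>c N. \<forall>e. dense_req \<N> c N (induction_decided binary \<N> a) e"
proof -
  obtain c N where c': "\<forall>m\<ge>2. \<forall>e B. len_le (Suc N) m e \<longrightarrow>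
    (\<forall>x\<le>e 0. certified B (m ^ c) (\<lambda>r. sat \<N> r (case_nat x (\<lambda>k. e (Suc k))) a))"
    using certified_up_to[OF assms] by (elim exE)
  note c = c'[rule_format]
  have "dense_req \<N> (c + 2) (Suc N) (induction_decided binary \<N> a) e" for e
  proof (rule dense_req_natI)
    fix m B and D :: "nat set" and r
    assume m: "2 \<le> m" and e: "\<And>i. i < Suc N \<Longrightarrow> floorlog 2 (e i) \<le> m"
      and r: "linord B r" "finite D" and D: "card D \<le> m"
    define P where "P x r = sat \<N> r (case_nat x (\<lambda>k. e (Suc k))) a" for x r
    have P: "certified B (m ^ c) (P x)" if "x \<le> e 0" for x
      unfolding P_def by (rule c[where m = m and e = e]) (use m e that in auto)
    \<comment> \<open>For polynomial induction the candidates are the binary prefixes of the bound,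
      whose neighbours are related by halving; for ordinary induction they are all numbers.\<close>
    define S where "S = (if binary then range (\<lambda>i. e 0 div 2 ^ i) else UNIV)"
    \<comment> \<open>The exponent \<open>e 0\<close> is large enough for the quotient to be
      0.\<close>
    have S: "0 \<in> S" unfolding S_def by (auto intro: range_eqI[of _ _ "e 0"])
    have step: "\<exists>y\<in>S. x < y \<and> y \<le> e 0 \<and> predecessor binary \<N> x y" if "x \<in> S" "x < e 0" for x
      using that next_prefix[of x "e 0"] by (auto simp: S_def predecessor_def)
    have "\<exists>D' r'. extends B D r (card D + m ^ c) D' r' \<and>
       (forces_nat B D' r' (\<lambda>r. \<not> P 0 r) \<or> forces_nat B D' r' (P (e 0)) \<or>
        (\<exists>x y. x < y \<and> y \<le> e 0 \<and> predecessor binary \<N> x y \<and> forces_nat B D' r' (P x) \<and>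
           forces_nat B D' r' (\<lambda>r. \<not> P y r)))" (is "\<exists>D' r'. _ \<and> ?f D' r'")
      by (rule extend_induction[OF _ r S]) (auto intro: P step)
    then obtain D' r' where D': "extends B D r (card D + m ^ c) D' r'" and f: "?f D' r'"
      by (elim exE conjE)
    have "induction_decided binary \<N> a B d l e" if "set_decode d = D'" "rel \<N> l = r'" for d l
      using f unfolding induction_decided_def forces_code[OF that] forces_code_Neg[OF that] P_def
        case_nat_shift by auto
    with extends_le[OF D' size_bound[OF m D order_refl]]
    show "\<exists>D' r'. extends B D r (m ^ (c + 2)) D' r' \<and>
       (\<forall>d l. set_decode d = D' \<longrightarrow> rel \<N> l = r' \<longrightarrow> induction_decided binary \<N> a B d l e)"
      by (intro exI[of _ D'] exI[of _ r'] conjI allI impI)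
  qed
  then show ?thesis by (intro exI allI)
qed

lemma pigeonhole_size:
  fixes m :: nat
  assumes m: "2 \<le> m" and x: "x \<le> m"
  shows "2 * (x + 2 * m ^ c * (m ^ c + 1)) + 2 * m ^ c \<le> m ^ (2 * c + 5)"
proof -
  define z where "z = m ^ (2 * c + 1)"
  define K where "K = m ^ c"
  have "m ^ 1 \<le> z" "K \<le> z" "m ^ (2 * c) \<le> z" unfolding z_def K_def by (rule pow_mono2[OF m], simp)+
  moreover have "m ^ (2 * c) = K * K" unfolding K_def mult_2 power_add ..
  \<comment> \<open>The left side is the expanded claim, and \<open>x\<close>, \<open>K\<close> and
    \<open>K * K\<close> are all at most \<open>z\<close>. The factor is rounded up to 16, which is
    at most \<open>m ^ 4\<close>.\<close>
  ultimately have "2 * x + 4 * (K * K) + 6 * K \<le> 16 * z" using x unfolding power_one_right by linarith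
  also have "(16 :: nat) \<le> m ^ 4" using power_mono[OF m, of 4] by simp
  then have "16 * z \<le> m ^ 4 * z" by (rule mult_right_mono) simp
  also have "m ^ 4 * z = m ^ (4 + (2 * c + 1))" unfolding z_def power_add ..
  also have "4 + (2 * c + 1) = 2 * c + 5" by simp
  finally show ?thesis unfolding K_def[symmetric] by (simp add: algebra_simps)
qed

lemma dense_PHP_decided:
  assumes "Sigma_b1 a"
  shows "\<exists>c N. \<forall>e. dense_req \<N> c N (PHP_decided \<N> a) e"
proof -
  obtain c N where c': "\<forall>m\<ge>2. \<forall>e B. len_le N m e \<longrightarrow>
    certified B (m ^ c) (\<lambda>r. sat \<N> r e a)"
    using certified_Sigma_b1[OF assms] by (elim exE)
  note c = c'[rule_format]
  have "dense_req \<N> (2 * c + 5) (N + 2) (PHP_decided \<N> a) e" for e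
  proof (rule dense_req_natI)
    fix m B and D :: "nat set" and r
    assume m: "2 \<le> m" and e: "\<And>i. i < N + 2 \<Longrightarrow> floorlog 2 (e i) \<le> m"
      and r: "linord B r" "finite D" and D: "card D \<le> m"
    define P where "P x y r = sat \<N> r (case_nat x (case_nat y (\<lambda>k. e (Suc (Suc k))))) a" for x y r
    have P: "certified B (m ^ c) (P x y)" if "x < e 1" "y < e 0" for x y
      unfolding P_def
    proof (rule c[OF m])
      fix i assume i: "i < N"
      have "floorlog 2 x \<le> m" "floorlog 2 y \<le> m"
        using floorlog_mono[of x "e 1" 2] floorlog_mono[of y "e 0" 2] e[of 0] e[of 1] that by auto
      then show "floorlog 2 (case_nat x (case_nat y (\<lambda>k. e (Suc (Suc k)))) i) \<le> m"
        using e[of i] i by (auto split: nat.split)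
    qed
    show "\<exists>D' r'. extends B D r (m ^ (2 * c + 5)) D' r' \<and>
       (\<forall>d l. set_decode d = D' \<longrightarrow> rel \<N> l = r' \<longrightarrow> PHP_decided \<N> a B d l e)"
    proof (cases "e 0 < e 1")
      case False
      have "card D \<le> m ^ (2 * c + 5)" using size_bound[OF m D, of 0 "2 * c + 3"] by (simp add: add.commute)
      then show ?thesis using extends_refl[OF r] False by (auto simp: PHP_decided_def)
    next
      case True
      have "\<exists>D' r'. extends B D r (m ^ (2 * c + 5)) D' r' \<and>
        ((\<exists>x<e 1. \<forall>y<e 0. forces_nat B D' r' (\<lambda>r. \<not> P x y r)) \<or>
         (\<exists>x<e 1. \<exists>x'<e 1. x \<noteq> x' \<and> (\<exists>y<e 0. forces_nat B D' r' (P x y) \<and> forces_nat B D' r' (P x' y))) \<or>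
         (\<exists>x<e 1. \<exists>y<e 0. \<exists>y'<e 0. y \<noteq> y' \<and> forces_nat B D' r' (P x y) \<and> forces_nat B D' r' (P x y')))" (is "\<exists>D' r'. _ \<and> ?f D' r'")
        by (rule extend_pigeonhole[OF _ r True pigeonhole_size[OF m D]]) (rule P)
      then obtain D' r' where D': "extends B D r (m ^ (2 * c + 5)) D' r'"
        and f: "?f D' r'"
        by (elim exE conjE)
      have "PHP_decided \<N> a B d l e" if "set_decode d = D'" "rel \<N> l = r'" for d l
      proof -
        define pos where "pos x y \<longleftrightarrow> forces_nat B D' r' (P x y)" for x y
        define neg where "neg x y \<longleftrightarrow> forces_nat B D' r' (\<lambda>r. \<not> P x y r)" for x y
        have pos: "forces \<N> a B d l (case_nat x (case_nat y (\<lambda>k. e (Suc (Suc k))))) \<longleftrightarrow> pos x y" for x y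
          unfolding forces_code[OF that] pos_def P_def ..
        have neg: "forces \<N> (\<^bold>\<not> a) B d l (case_nat x (case_nat y (\<lambda>k. e (Suc (Suc k))))) \<longleftrightarrow> neg x y" for x y
          unfolding forces_code_Neg[OF that] neg_def P_def ..
        show ?thesis
          using f unfolding PHP_decided_def pos neg pos_def[symmetric] neg_def[symmetric]
          by (simp only: nat_structure_simps lt_nat) blast
      qed
      with D' show ?thesis by (intro exI[of _ D'] exI[of _ r'] conjI allI impI)
    qed
  qed
  then show ?thesis by (intro exI allI)
qed

section \<open>Transfer to the model\<close>

text \<open>The size \<open>m + 1\<close> is replaced by \<open>m ^ 2\<close>, which keeps all sizes
  in the form of powers.\<close>

definition point_added :: "'a L_structure \<Rightarrow> 'a \<Rightarrow> 'a \<Rightarrow> 'a \<Rightarrow> 'a \<Rightarrow> 'a \<Rightarrow> 'a \<Rightarrow> 'a \<Rightarrow> bool" where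
  "point_added S B D l m z D' l' \<longleftrightarrow> lin S B l' \<and> agree S D l l' \<and> sub S D D' \<and> mem S z D' \<and>
     small S D' (mpow S m 2)"

text \<open>One closed sentence, so that it transfers at once. The first clause brings every point
  into some condition; the cases above, below and between serve the absence of endpoints and
  density.\<close>

definition points_addable :: "'a L_structure \<Rightarrow> bool" where
  "points_addable S \<longleftrightarrow> (\<forall>B\<in>univ S. \<forall>D\<in>univ S. \<forall>l\<in>univ S. \<forall>m\<in>univ S. \<forall>z\<in>univ S.
     lin S B l \<longrightarrow> small S D m \<longrightarrow> leq S (add S (un S) (un S)) m \<longrightarrow>
     (\<exists>D'\<in>univ S. point_added S B D l m z D' l) \<and>
     (lt S z B \<longrightarrow> \<not> mem S z D \<longrightarrow>
       (\<forall>x\<in>univ S. mem S x D \<longrightarrow> lt S x B \<longrightarrow>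
         (\<exists>D'\<in>univ S. \<exists>l'\<in>univ S. point_added S B D l m z D' l' \<and> rel S l' x z) \<and>
         (\<exists>D'\<in>univ S. \<exists>l'\<in>univ S. point_added S B D l m z D' l' \<and> rel S l' z x) \<and>
         (\<forall>y\<in>univ S. mem S y D \<longrightarrow> rel S l x y \<longrightarrow>
           (\<exists>D'\<in>univ S. \<exists>l'\<in>univ S. point_added S B D l m z D' l' \<and> rel S l' x z \<and> rel S l' z y)))))"

lemma insert_point_nat:
  assumes "linord B r" "finite D" "card D \<le> m" "2 \<le> m" "z < B" "z \<notin> D"
    and "Lo \<subseteq> D \<inter> {..<B}" "Hi \<subseteq> D \<inter> {..<B}" "\<And>a b. a \<in> Lo \<Longrightarrow> b \<in> Hi \<Longrightarrow> r a b"
  obtains d l where "set_decode d = insert z D" "linord B (rel \<N> l)"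
    "agree_on D r (rel \<N> l)" "card (insert z D) \<le> m ^ 2"
    "\<And>a. a \<in> Lo \<Longrightarrow> rel \<N> l a z" "\<And>b. b \<in> Hi \<Longrightarrow> rel \<N> l z b"
proof -
  obtain r' where r': "linord B r'" "\<And>x y. x \<noteq> z \<Longrightarrow> y \<noteq> z \<Longrightarrow> r' x y = r x y"
    "\<And>a. a \<in> Lo \<Longrightarrow> r' a z" "\<And>b. b \<in> Hi \<Longrightarrow> r' z b"
    by (rule linord_insert_point[OF assms(1,5), of Lo Hi]) (use assms in blast)+
  obtain l where l: "rel \<N> l = r'" using linord_code[OF r'(1)] .
  obtain d where d: "set_decode d = insert z D" using set_code[of "insert z D"] assms(2) by auto
  have "x \<noteq> z" if "x \<in> D" for x using that assms(6) by blast
  then have "agree_on D r r'" using r'(2) by (simp add: agree_on_def)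
  moreover have "card (insert z D) \<le> m ^ 2"
  proof -
    have "card (insert z D) \<le> m + m" using assms by simp
    also have "\<dots> \<le> m ^ 2" using pow_sum[OF assms(4), of m 1 m] by (simp add: numeral_2_eq_2)
    finally show ?thesis .
  qed
  ultimately show thesis using that[of d l] d r' unfolding l by blast
qed

lemma points_addable_nat: "points_addable \<N>"
  unfolding points_addable_def
proof (intro ballI impI conjI)
  fix B D l m z
  assume "lin \<N> B l" "small \<N> D m"
    "leq \<N> (add \<N> (un \<N>) (un \<N>)) m"
  then have l: "linord B (rel \<N> l)" and D: "card (set_decode D) \<le> m" and m: "2 \<le> m"
    by (simp_all add: lin_nat small_nat)
  have fin: "finite (set_decode D)" by simp
  have irr: "rel \<N> l x y \<Longrightarrow> x < B \<and> y < B" for x y using l by (simp add: linord_def)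
  have added: "point_added \<N> B D l m z d l'"
    if "set_decode d = insert z (set_decode D)" "linord B (rel \<N> l')"
      "agree_on (set_decode D) (rel \<N> l) (rel \<N> l')"
      "card (insert z (set_decode D)) \<le> m ^ 2" for d l'
    using that by (auto simp: point_added_def lin_nat agree_nat sub_nat small_nat)
  show "\<exists>D'\<in>univ \<N>. point_added \<N> B D l m z D' l"
  proof -
    obtain d where d: "set_decode d = insert z (set_decode D)"
      using set_code[of "insert z (set_decode D)"] by auto
    have "card (insert z (set_decode D)) \<le> Suc m" using D card_insert_le_m1 by (simp add: card_insert_if)
    also have "\<dots> \<le> m + m" using m by simp
    also have "\<dots> \<le> m ^ 2" using pow_sum[OF m, of m 1 m] by (simp add: numeral_2_eq_2)
    finally show ?thesis using added[OF d l] by auto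
  qed
  assume z: "lt \<N> z B" "\<not> mem \<N> z D"
  then have z': "z < B" "z \<notin> set_decode D" by simp_all
  fix x assume x: "mem \<N> x D" "lt \<N> x B"
  have x': "{x} \<subseteq> set_decode D \<inter> {..<B}" using x by simp
  show "\<exists>D'\<in>univ \<N>. \<exists>l'\<in>univ \<N>.
      point_added \<N> B D l m z D' l' \<and> rel \<N> l' x z"
  proof (rule insert_point_nat[OF l fin D m z', of "{x}" "{}"])
    fix d l'
    assume A: "set_decode d = insert z (set_decode D)" "linord B (rel \<N> l')"
      "agree_on (set_decode D) (rel \<N> l) (rel \<N> l')"
      "card (insert z (set_decode D)) \<le> m ^ 2"
      and R: "\<And>a. a \<in> {x} \<Longrightarrow> rel \<N> l' a z" "\<And>b. b \<in> {} \<Longrightarrow> rel \<N> l' z b"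
    show ?thesis using added[OF A] R by auto
  qed (use x' in auto)
  show "\<exists>D'\<in>univ \<N>. \<exists>l'\<in>univ \<N>.
      point_added \<N> B D l m z D' l' \<and> rel \<N> l' z x"
  proof (rule insert_point_nat[OF l fin D m z', of "{}" "{x}"])
    fix d l'
    assume A: "set_decode d = insert z (set_decode D)" "linord B (rel \<N> l')"
      "agree_on (set_decode D) (rel \<N> l) (rel \<N> l')"
      "card (insert z (set_decode D)) \<le> m ^ 2"
      and R: "\<And>a. a \<in> {} \<Longrightarrow> rel \<N> l' a z" "\<And>b. b \<in> {x} \<Longrightarrow> rel \<N> l' z b"
    show ?thesis using added[OF A] R by auto
  qed (use x' in auto)
  fix y assume y: "mem \<N> y D" "rel \<N> l x y"
  then have y': "{y} \<subseteq> set_decode D \<inter> {..<B}" using irr by auto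
  show "\<exists>D'\<in>univ \<N>. \<exists>l'\<in>univ \<N>.
      point_added \<N> B D l m z D' l' \<and> rel \<N> l' x z \<and> rel \<N> l' z y"
  proof (rule insert_point_nat[OF l fin D m z', of "{x}" "{y}"])
    fix d l'
    assume A: "set_decode d = insert z (set_decode D)" "linord B (rel \<N> l')"
      "agree_on (set_decode D) (rel \<N> l) (rel \<N> l')"
      "card (insert z (set_decode D)) \<le> m ^ 2"
      and R: "\<And>a. a \<in> {x} \<Longrightarrow> rel \<N> l' a z" "\<And>b. b \<in> {y} \<Longrightarrow> rel \<N> l' z b"
    show ?thesis using added[OF A] R by auto
  qed (use x' y' y(2) in auto)
qed

text \<open>A pigeonhole principle for the relation defined by \<open>a\<close> with parameters
  \<open>e\<close>. With \<open>a\<close> fixed it is first-order and transfers; it is applied to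
  the graph of a definable injection.\<close>

definition avoids_small :: "'a L_structure \<Rightarrow> fm \<Rightarrow> (nat \<Rightarrow> 'a) \<Rightarrow> bool" where
  "avoids_small S a e \<longleftrightarrow> (\<forall>p\<in>univ S. \<forall>D\<in>univ S. \<forall>k\<in>univ S. lt S k p \<longrightarrow> small S D k \<longrightarrow>
     (\<forall>x\<in>univ S. lt S x p \<longrightarrow> (\<exists>y\<in>univ S. L_sat S (case_nat x (case_nat y e)) a)) \<longrightarrow>
     (\<forall>x\<in>univ S. \<forall>x'\<in>univ S. \<forall>y\<in>univ S. lt S x p \<longrightarrow> lt S x' p \<longrightarrow>
        L_sat S (case_nat x (case_nat y e)) a \<longrightarrow> L_sat S (case_nat x' (case_nat y e)) a \<longrightarrow> x = x') \<longrightarrow>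
     (\<exists>x\<in>univ S. \<exists>y\<in>univ S. lt S x p \<and> L_sat S (case_nat x (case_nat y e)) a \<and> \<not> mem S y D))"

lemma avoids_small_nat: "avoids_small \<N> a e"
  unfolding avoids_small_def
proof (intro ballI impI)
  fix p D k
  assume k: "lt \<N> k p" "small \<N> D k"
    and tot: "\<forall>x\<in>univ \<N>. lt \<N> x p \<longrightarrow>
      (\<exists>y\<in>univ \<N>. L_sat \<N> (case_nat x (case_nat y e)) a)"
    and inj: "\<forall>x\<in>univ \<N>. \<forall>x'\<in>univ \<N>. \<forall>y\<in>univ \<N>.
      lt \<N> x p \<longrightarrow> lt \<N> x' p \<longrightarrow> L_sat \<N> (case_nat x (case_nat y e)) a \<longrightarrow>
      L_sat \<N> (case_nat x' (case_nat y e)) a \<longrightarrow> x = x'"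
  define A where "A x y \<longleftrightarrow> L_sat \<N> (case_nat x (case_nat y e)) a" for x y
  obtain g where g: "\<And>x. x < p \<Longrightarrow> A x (g x)"
    using tot unfolding A_def[symmetric] by simp metis
  have "inj_on g {..<p}"
  proof (rule inj_onI)
    fix x x' assume "x \<in> {..<p}" "x' \<in> {..<p}" "g x = g x'"
    then show "x = x'"
      using inj[rule_format, of x x' "g x", unfolded A_def[symmetric]] g[of x] g[of x'] by simp
  qed
  then have "card (g ` {..<p}) = p" by (simp add: card_image)
  moreover have "card (set_decode D) < p" using k by (simp add: small_nat)
  ultimately have "\<not> g ` {..<p} \<subseteq> set_decode D" using card_mono[of "set_decode D" "g ` {..<p}"] by auto
  then obtain x where "x < p" "g x \<notin> set_decode D" by auto
  then show "\<exists>x\<in>univ \<N>. \<exists>y\<in>univ \<N>. lt \<N> x p \<and>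
      L_sat \<N> (case_nat x (case_nat y e)) a \<and> \<not> mem \<N> y D"
    using g[of x] unfolding A_def[symmetric] by (intro bexI[of _ x] bexI[of _ "g x"]) simp_all
qed

text \<open>The clause about lengths at most \<open>x\<close> supplies an element above all numbers
  of such length; the bound \<open>B\<close> of the orders is obtained from it.\<close>

definition basic_facts :: "'a L_structure \<Rightarrow> bool" where
  "basic_facts S \<longleftrightarrow>
     (\<forall>x\<in>univ S. leq S (zer S) x \<and> leq S (half S x) x \<and> leq S (len S (zer S)) x \<and>
        small S (zer S) x \<and> (\<exists>l\<in>univ S. lin S x l) \<and> (\<exists>y\<in>univ S. \<forall>z\<in>univ S. leq S (len S z) x \<longrightarrow> lt S z y)) \<and>
     (\<forall>x\<in>univ S. \<forall>y\<in>univ S. (lt S x y \<longrightarrow> leq S (add S x (un S)) y) \<and> (leq S x y \<longrightarrow> leq S (len S x) (len S y))) \<and>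
     (\<forall>x\<in>univ S. \<forall>y\<in>univ S. \<forall>z\<in>univ S. leq S x y \<longrightarrow> leq S y z \<longrightarrow> leq S x z) \<and>
     (\<forall>x\<in>univ S. \<forall>k\<in>univ S. \<forall>k'\<in>univ S. leq S k k' \<longrightarrow> small S x k \<longrightarrow> small S x k')"

lemma basic_facts_nat: "basic_facts \<N>"
proof -
  have "\<exists>l. lin \<N> x l" for x
  proof -
    obtain l where l: "rel \<N> l = (\<lambda>y z. y < z \<and> z < x)" using linord_code[OF linord_less] .
    have "lin \<N> x l" unfolding lin_nat l by (rule linord_less)
    then show ?thesis ..
  qed
  moreover have "\<exists>y. \<forall>z. floorlog 2 z \<le> x \<longrightarrow> z < y" for x
    by (rule exI[of _ "2 ^ x"]) (simp add: len_le_iff)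
  ultimately show ?thesis
    unfolding basic_facts_def by (auto simp: small_nat floorlog_mono floorlog_eq_zero_iff[THEN iffD2])
qed

definition bounded_by_power :: "'a L_structure \<Rightarrow> trm \<Rightarrow> nat \<Rightarrow> nat \<Rightarrow> (nat \<Rightarrow> 'a) \<Rightarrow> bool" where
  "bounded_by_power S t c N e \<longleftrightarrow> (\<forall>m\<in>univ S. leq S (add S (un S) (un S)) m \<longrightarrow> bounded_env S N m e \<longrightarrow>
     leq S (len S (tval S e t)) (mpow S m c))"

lemma bounded_by_power_nat: "\<exists>c N. \<forall>e. bounded_by_power \<N> t c N e"
proof -
  obtain c N where c: "\<forall>m\<ge>2. \<forall>e. len_le N m e \<longrightarrow> floorlog 2 (tval \<N> e t) \<le> m ^ c"
    using len_tval_bound[of t] by (elim exE)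
  have "bounded_by_power \<N> t c N e" for e
    unfolding bounded_by_power_def bounded_env_def using c by simp
  then show ?thesis by (intro exI allI)
qed

definition mpow_facts :: "'a L_structure \<Rightarrow> nat \<Rightarrow> nat \<Rightarrow> bool" where
  "mpow_facts S c d \<longleftrightarrow> (\<forall>x\<in>univ S. leq S (add S (un S) (un S)) x \<longrightarrow>
     leq S (mpow S x c) (mpow S x (c + d)) \<and> leq S (add S (un S) (un S)) (mpow S x (Suc c)) \<and>
     mpow S (mpow S x c) d = mpow S x (c * d) \<and>
     leq S (add S (mpow S x c) (un S)) (mpow S x (Suc c)))"

lemma mpow_facts_nat: "mpow_facts \<N> c d"
  unfolding mpow_facts_def
proof (intro ballI impI conjI)
  fix x assume "leq \<N> (add \<N> (un \<N>) (un \<N>)) x"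
  then have x: "2 \<le> x" by simp
  show "leq \<N> (mpow \<N> x c) (mpow \<N> x (c + d))"
    using pow_mono2[OF x, of c "c + d"] by simp
  show "leq \<N> (add \<N> (un \<N>) (un \<N>)) (mpow \<N> x (Suc c))"
    using pow_mono2[OF x, of 1 "Suc c"] x by (simp only: mpow_nat nat_structure_simps power_one_right) linarith
  show "mpow \<N> (mpow \<N> x c) d = mpow \<N> x (c * d)"
    by (simp add: power_mult)
  have "x ^ c + 1 \<le> x ^ Suc c" using x by (intro pow_sum) auto
  then show "leq \<N> (add \<N> (mpow \<N> x c) (un \<N>)) (mpow \<N> x (Suc c))"
    by (simp_all only: mpow_nat nat_structure_simps lt_nat)
qed

section \<open>Combinatorial facts and density requirements in the model\<close>

context true_arith
begin

lemma transfer_closed: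
  assumes "same_fm M (\<lambda>e. P) (\<lambda>e. Q)" P
  shows Q
proof -
  have "range (\<lambda>k::nat. zer M) \<subseteq> univ M" using struct by (auto simp: is_structure_def)
  from transferI[OF M assms(1) assms(2) this] show ?thesis .
qed

lemma same_fm_L_sat [same]:
  assumes "same_env M F G" "L_formula a"
  shows "same_fm M (\<lambda>e. L_sat \<N> (F e) a) (\<lambda>e. L_sat M (G e) a)"
proof -
  have "same_fm M (\<lambda>e. L_sat \<N> e a) (\<lambda>e. L_sat M e a)"
    unfolding same_fm_def using assms(2) by (intro exI[of _ a]) simp
  from same_fm_compose[OF struct this assms(1)] show ?thesis .
qed

lemma points_addable_M: "points_addable M"
proof (rule transfer_closed[OF _ points_addable_nat])
  show "same_fm M (\<lambda>e. points_addable \<N>) (\<lambda>e. points_addable M)"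
    unfolding points_addable_def point_added_def by (intro same)
qed

lemma avoids_small_M:
  assumes "L_formula a" "range e \<subseteq> univ M"
  shows "avoids_small M a e"
proof (rule transferI[OF M _ _ assms(2), where Q = "avoids_small M a"])
  show "same_fm M (avoids_small \<N> a) (avoids_small M a)"
    unfolding avoids_small_def[abs_def] by (intro same assms(1))
qed (rule avoids_small_nat)

lemma basic_facts_M: "basic_facts M"
proof (rule transfer_closed[OF _ basic_facts_nat])
  show "same_fm M (\<lambda>e. basic_facts \<N>) (\<lambda>e. basic_facts M)"
    unfolding basic_facts_def by (intro same)
qed

lemma mpow_facts_M: "mpow_facts M c d"
proof (rule transfer_closed[OF _ mpow_facts_nat])
  show "same_fm M (\<lambda>e. mpow_facts \<N> c d) (\<lambda>e. mpow_facts M c d)"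
    unfolding mpow_facts_def by (intro same)
qed

lemma bounded_by_power_M: "\<exists>c N. \<forall>e. range e \<subseteq> univ M \<longrightarrow> bounded_by_power M t c N e"
proof -
  obtain c N where c: "\<And>e. bounded_by_power \<N> t c N e" using bounded_by_power_nat by blast
  have "same_fm M (bounded_by_power \<N> t c N) (bounded_by_power M t c N)"
    unfolding bounded_by_power_def[abs_def] by (intro same)
  from transferI[OF M this c] show ?thesis by blast
qed

lemma dense_M:
  assumes "\<exists>c N. \<forall>e. dense_req \<N> c N P e"
    and "same_fm M (\<lambda>e. P (e 0) (e 1) (e 2) (\<lambda>k. e (Suc (Suc (Suc k)))))
       (\<lambda>e. Q (e 0) (e 1) (e 2) (\<lambda>k. e (Suc (Suc (Suc k)))))"
  shows "\<exists>c N. \<forall>e. range e \<subseteq> univ M \<longrightarrow> dense_req M c N Q e"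
proof -
  obtain c N where "\<forall>e. dense_req \<N> c N P e" using assms(1) by (elim exE)
  then have "\<forall>e. range e \<subseteq> univ M \<longrightarrow> dense_req M c N Q e"
    using transfer_dense_req[OF _ assms(2)] by simp
  then show ?thesis by (intro exI)
qed

text \<open>Indexed by terms and truth values, so countable for each formula; hence one sequence of
  conditions can meet them all.\<close>

definition requirements :: "fm \<Rightarrow> ('a \<Rightarrow> 'a \<Rightarrow> 'a \<Rightarrow> (nat \<Rightarrow> 'a) \<Rightarrow> bool) set" where
  "requirements a = range (\<lambda>t. BEx_witnessed M t a) \<union> range (\<lambda>t. BAll_witnessed M (Len t) a) \<union>
     range (\<lambda>binary. induction_decided binary M a) \<union> {PHP_decided M a}"

lemma requirementsI:
  "BEx_witnessed M t a \<in> requirements a" "BAll_witnessed M (Len t) a \<in> requirements a"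
  "induction_decided binary M a \<in> requirements a" "PHP_decided M a \<in> requirements a"
  unfolding requirements_def by blast+

lemma same_fm_predecessor: "same_term M f g \<Longrightarrow> same_term M f' g' \<Longrightarrow>
    same_fm M (\<lambda>e. predecessor binary \<N> (f e) (f' e)) (\<lambda>e. predecessor binary M (g e) (g' e))"
  unfolding predecessor_def by (cases binary) (simp_all only: if_True if_False, (intro same; assumption)+)

lemma dense_requirements_M:
  assumes "Sigma_b1 a" and "Q \<in> requirements a"
  shows "\<exists>c N. \<forall>e. range e \<subseteq> univ M \<longrightarrow> dense_req M c N Q e"
proof -
  consider t where "Q = BEx_witnessed M t a" | t where "Q = BAll_witnessed M (Len t) a"
    | binary where "Q = induction_decided binary M a" | "Q = PHP_decided M a"
    using assms(2) unfolding requirements_def by auto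
  then show ?thesis
  proof cases
    case 1
    then show ?thesis
      by (simp only:, intro dense_M[OF dense_BEx_witnessed[OF assms(1), of t]])
        (unfold BEx_witnessed_def, intro same)
  next
    case 2
    then show ?thesis
      by (simp only:, intro dense_M[OF dense_BAll_witnessed[OF assms(1), of t]])
        (unfold BAll_witnessed_def, intro same)
  next
    case 3
    then show ?thesis
      by (simp only:, intro dense_M[OF dense_induction_decided[OF assms(1), of binary]])
        (unfold induction_decided_def, intro same same_fm_predecessor)
  next
    case 4
    then show ?thesis
      by (simp only:, intro dense_M[OF dense_PHP_decided[OF assms(1)]]) (unfold PHP_decided_def, intro same)
  qed
qed

end

subsection \<open>Exponentiation and the cut\<close>

text \<open>Any two formulas that define the power function are equivalent in \<open>M\<close> by
  transfer. Substituting 0 for all variables but the first three removes the dependence on the rest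
  of the assignment.\<close>

lemma (in true_arith) is_power_iff:
  assumes a: "defines_power a" and e: "range e \<subseteq> univ M"
  shows "is_power M (e 0) (e 1) (e 2) \<longleftrightarrow> L_sat M e a"
proof
  assume "L_sat M e a"
  then show "is_power M (e 0) (e 1) (e 2)" unfolding is_power_def using a e by blast
next
  assume "is_power M (e 0) (e 1) (e 2)"
  then obtain b e' where b: "defines_power b" and e': "range e' \<subseteq> univ M" "e' 0 = e 0" "e' 1 = e 1" "e' 2 = e 2"
    and sat: "L_sat M e' b"
    unfolding is_power_def by auto
  define \<sigma> where "\<sigma> k = (if k < 3 then Var k else Zero)" for k :: nat
  have eq: "L_sat M f c \<longleftrightarrow> L_sat M f (subst \<sigma> a)" if c: "defines_power c" and f: "range f \<subseteq> univ M" for c f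
  proof -
    have "same_fm M (\<lambda>e. L_sat \<N> e c \<longleftrightarrow> L_sat \<N> e (subst \<sigma> a))
        (\<lambda>e. L_sat M e c \<longleftrightarrow> L_sat M e (subst \<sigma> a))"
      by (intro same_fm_iff same_fm_L_sat same_env_var[of M id, simplified])
        (use a c in \<open>simp_all add: defines_power_def\<close>)
    moreover have "L_sat \<N> e c \<longleftrightarrow> L_sat \<N> e (subst \<sigma> a)" for e
      using a c by (simp add: defines_power_def sat_subst \<sigma>_def)
    ultimately show ?thesis using transferI[OF M _ _ f] by blast
  qed
  have "(\<lambda>k. tval M e' (\<sigma> k)) = (\<lambda>k. tval M e (\<sigma> k))"
    using e' by (auto simp: \<sigma>_def fun_eq_iff less_Suc_eq numeral_3_eq_3 numeral_2_eq_2)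
  then have "L_sat M e' (subst \<sigma> a) \<longleftrightarrow> L_sat M e (subst \<sigma> a)" by (simp add: sat_subst)
  then show "L_sat M e a" using sat eq[OF b e'(1)] eq[OF a e] by blast
qed

text \<open>A formula defining exponentiation is assumed to exist; in the final theorem it comes
  from the powers of \<open>len M n\<close> that accompany the injections.\<close>

locale true_arith_power = true_arith +
  assumes ex_power: "\<exists>a. defines_power a"
begin

lemma is_power_nat: "is_power \<N> x y z \<longleftrightarrow> x ^ y = z"
proof
  assume "is_power \<N> x y z"
  then show "x ^ y = z" unfolding is_power_def defines_power_def by auto
next
  assume "x ^ y = z"
  moreover obtain a where "defines_power a" using ex_power by blast
  ultimately show "is_power \<N> x y z"
    unfolding is_power_def defines_power_def
    by (intro exI[of _ a] exI[of _ "case_nat x (case_nat y (\<lambda>_. z))"]) (simp add: numeral_2_eq_2)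
qed

lemma same_fm_is_power [same]:
  assumes "same_term M f g" "same_term M f' g'" "same_term M f'' g''"
  shows "same_fm M (\<lambda>e. is_power \<N> (f e) (f' e) (f'' e)) (\<lambda>e. is_power M (g e) (g' e) (g'' e))"
proof (rule same_fm_args3[OF struct _ assms])
  obtain a where a: "defines_power a" using ex_power by blast
  show "same_fm M (\<lambda>e. is_power \<N> (e 0) (e 1) (e 2)) (\<lambda>e. is_power M (e 0) (e 1) (e 2))"
    unfolding same_fm_def is_power_nat using a is_power_iff[OF a]
    by (intro exI[of _ a]) (auto simp: defines_power_def)
qed

end

text \<open>The bridge between powers with exponents in the structure and the terms
  \<open>mpow\<close>. The last clause allows the cut to be described by lengths.\<close>

definition power_facts :: "'a L_structure \<Rightarrow> nat \<Rightarrow> bool" where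
  "power_facts S c \<longleftrightarrow>
     (\<forall>x\<in>univ S. is_power S x (standard S c) (mpow S x c) \<and>
        (lt S (standard S 2) x \<longrightarrow> leq S (add S (un S) (un S)) (len S x)) \<and>
        (\<exists>q\<in>univ S. is_power S (standard S 2) x q)) \<and>
     (\<forall>x\<in>univ S. \<forall>z\<in>univ S. is_power S x (standard S c) z \<longrightarrow> z = mpow S x c) \<and>
     (\<forall>x\<in>univ S. \<forall>y\<in>univ S. \<forall>z\<in>univ S. leq S (add S (un S) (un S)) x \<longrightarrow> is_power S x y z \<longrightarrow>
        lt S (standard S c) y \<longrightarrow> lt S (mpow S x c) z) \<and>
     (\<forall>p\<in>univ S. \<forall>q\<in>univ S. \<forall>m\<in>univ S. is_power S (standard S 2) p q \<longrightarrow>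
        (leq S m q \<longrightarrow> leq S (len S m) (add S p (un S))) \<and> (leq S (len S m) p \<longrightarrow> leq S m q))"

lemma standard_nat [simp]: "standard \<N> c = c"
  by (induction c) simp_all

context true_arith_power
begin

lemma power_facts_nat: "power_facts \<N> c"
proof -
  have "Suc (Suc 0) \<le> floorlog 2 x" if "2 < x" for x
    using len_le_iff[of x 1] that by auto
  moreover have "floorlog 2 m \<le> p + 1" if "m \<le> 2 ^ p" for m p
  proof -
    have "m < 2 ^ (p + 1)" using that by (rule le_less_trans) simp
    then show ?thesis by (simp only: len_le_iff)
  qed
  moreover have "m \<le> 2 ^ p" if "floorlog 2 m \<le> p" for m p
    using that by (simp add: len_le_iff)
  moreover have "x ^ c < z" if "2 \<le> x" "x ^ y = z" "c < y" for x y z :: nat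
    using power_strict_increasing[OF that(3), of x] that(1,2) by simp
  ultimately show ?thesis
    unfolding power_facts_def is_power_nat standard_nat by simp
qed

lemma same_term_standard [same]: "same_term M (\<lambda>e. standard \<N> c) (\<lambda>e. standard M c)"
proof (induction c)
  case 0 show ?case unfolding standard.simps by (intro same)
next
  case (Suc c) show ?case unfolding standard.simps by (intro same Suc)
qed

lemma power_facts_M: "power_facts M c"
proof (rule transfer_closed[OF _ power_facts_nat])
  show "same_fm M (\<lambda>e. power_facts \<N> c) (\<lambda>e. power_facts M c)"
    unfolding power_facts_def by (intro same)
qed

lemma standard_univ: "standard M c \<in> univ M"
  using struct by (induction c) (auto simp: is_structure_def)

lemma mpow_univ: "x \<in> univ M \<Longrightarrow> mpow M x c \<in> univ M"
  using struct by (induction c) (auto simp: is_structure_def)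

lemma len_univ: "x \<in> univ M \<Longrightarrow> len M x \<in> univ M"
  using struct by (auto simp: is_structure_def)

lemma basic_unary:
  assumes "x \<in> univ M"
  shows "leq M (zer M) x" "leq M (half M x) x" "small M (zer M) x" "\<exists>l\<in>univ M. lin M x l"
    "\<exists>y\<in>univ M. \<forall>z\<in>univ M. leq M (len M z) x \<longrightarrow> lt M z y"
  using basic_facts_M[unfolded basic_facts_def, THEN conjunct1] assms by simp_all

lemma basic_binary:
  assumes "x \<in> univ M" "y \<in> univ M"
  shows "lt M x y \<Longrightarrow> leq M (add M x (un M)) y"
    "leq M x y \<Longrightarrow> leq M (len M x) (len M y)"
  using basic_facts_M[unfolded basic_facts_def, THEN conjunct2, THEN conjunct1] assms by simp_all

lemma leq_trans:
  "leq M x y \<Longrightarrow> leq M y z \<Longrightarrow> x \<in> univ M \<Longrightarrow> y \<in> univ M \<Longrightarrow> z \<in> univ M \<Longrightarrow> leq M x z"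
  using basic_facts_M[unfolded basic_facts_def, THEN conjunct2, THEN conjunct2, THEN conjunct1] by blast

lemma small_mono:
  "small M x k \<Longrightarrow> leq M k k' \<Longrightarrow> x \<in> univ M \<Longrightarrow> k \<in> univ M \<Longrightarrow> k' \<in> univ M \<Longrightarrow> small M x k'"
  using basic_facts_M[unfolded basic_facts_def, THEN conjunct2, THEN conjunct2, THEN conjunct2] by blast

lemma standard_lt_nonstandard:
  assumes "nonstandard M d"
  shows "lt M (standard M c) d"
proof (induction c)
  have d: "d \<in> univ M" "d \<noteq> standard M k" for k using assms by (auto simp: nonstandard_def)
  case 0
  show ?case using basic_unary(1)[OF d(1)] d(2)[of 0] by (simp add: lt_def)
next
  have d: "d \<in> univ M" "d \<noteq> standard M k" for k using assms by (auto simp: nonstandard_def)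
  case (Suc c)
  show ?case using basic_binary(1)[OF standard_univ d(1) Suc] d(2)[of "Suc c"] by (simp add: lt_def)
qed

lemma power_factsD:
  "x \<in> univ M \<Longrightarrow> is_power M x (standard M c) (mpow M x c)"
  "x \<in> univ M \<Longrightarrow> lt M (standard M 2) x \<Longrightarrow> leq M (add M (un M) (un M)) (len M x)"
  "x \<in> univ M \<Longrightarrow> \<exists>q\<in>univ M. is_power M (standard M 2) x q"
  "x \<in> univ M \<Longrightarrow> z \<in> univ M \<Longrightarrow> is_power M x (standard M c) z \<Longrightarrow> z = mpow M x c"
  "x \<in> univ M \<Longrightarrow> y \<in> univ M \<Longrightarrow> z \<in> univ M \<Longrightarrow> leq M (add M (un M) (un M)) x \<Longrightarrow>
     is_power M x y z \<Longrightarrow> lt M (standard M c) y \<Longrightarrow> lt M (mpow M x c) z"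
  "x \<in> univ M \<Longrightarrow> z \<in> univ M \<Longrightarrow> y \<in> univ M \<Longrightarrow> is_power M (standard M 2) x z \<Longrightarrow>
     leq M y z \<Longrightarrow> leq M (len M y) (add M x (un M))"
  "x \<in> univ M \<Longrightarrow> z \<in> univ M \<Longrightarrow> y \<in> univ M \<Longrightarrow> is_power M (standard M 2) x z \<Longrightarrow>
     leq M (len M y) x \<Longrightarrow> leq M y z"
  using power_facts_M[of c] unfolding power_facts_def by simp_all

lemma is_powerD: "is_power M x y z \<Longrightarrow> x \<in> univ M \<and> y \<in> univ M \<and> z \<in> univ M"
  unfolding is_power_def by auto

end

section \<open>The cut and the conditions\<close>

text \<open>\<open>B\<close> stands for an element above the whole cut, so that an order coded on
  the segment below it covers the cut. The assumption \<open>two\<close> supplies the hypothesis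
  that bases of powers are at least 2.\<close>

locale cut = true_arith_power +
  fixes n B
  assumes n: "n \<in> univ M" and two: "leq M (add M (un M) (un M)) (len M n)"
    and B: "B \<in> univ M"
    and B_bound: "\<And>x c. x \<in> univ M \<Longrightarrow> leq M (len M x) (mpow M (len M n) c) \<Longrightarrow> lt M x B"
begin

definition K :: "nat \<Rightarrow> 'a" where
  "K c = mpow M (len M n) c"

definition I :: "'a set" where
  "I = {m \<in> univ M. \<exists>c. leq M (len M m) (K c)}"

lemma K_univ: "K c \<in> univ M"
  unfolding K_def by (intro mpow_univ len_univ n)

lemma K_mono: "c \<le> d \<Longrightarrow> leq M (K c) (K d)"
  using mpow_facts_M[of c "d - c"] len_univ[OF n] two unfolding mpow_facts_def K_def by auto

lemma K_Suc: "leq M (add M (un M) (un M)) (K (Suc c))" "leq M (add M (K c) (un M)) (K (Suc c))"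
  "mpow M (K c) d = K (c * d)"
  using mpow_facts_M[of c d] len_univ[OF n] two unfolding mpow_facts_def K_def by auto

lemma I_univ: "x \<in> I \<Longrightarrow> x \<in> univ M"
  by (simp add: I_def)

lemma lt_B: "x \<in> I \<Longrightarrow> lt M x B"
  using B_bound by (auto simp: I_def K_def)

lemma add_univ: "x \<in> univ M \<Longrightarrow> y \<in> univ M \<Longrightarrow> add M x y \<in> univ M"
  and un_univ: "un M \<in> univ M" and zer_univ: "zer M \<in> univ M"
  using struct by (auto simp: is_structure_def)

text \<open>From \<open>m \<le> 2 ^ p\<close> only a length of at most \<open>p + 1\<close> follows;
  the additional 1 is absorbed by passing to the next power of \<open>len M n\<close>. In the other
  direction the exponent stays the same.\<close>

lemma univ_small_cut: "univ (small_cut M n) = I"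
proof (rule set_eqI)
  fix m
  show "m \<in> univ (small_cut M n) \<longleftrightarrow> m \<in> I"
  proof
    assume "m \<in> univ (small_cut M n)"
    then obtain c p q where m: "m \<in> univ M" and p: "is_power M (len M n) (standard M c) p"
      and q: "is_power M (standard M 2) p q" "leq M m q"
      by (auto simp: small_cut_def)
    have u: "p \<in> univ M" "q \<in> univ M" using is_powerD[OF p] is_powerD[OF q(1)] by auto
    have "p = K c"
      unfolding K_def by (rule power_factsD(4)[OF len_univ[OF n] u(1) p])
    moreover have "leq M (len M m) (add M p (un M))"
      by (rule power_factsD(6)[OF u m q])
    ultimately have "leq M (len M m) (K (Suc c))"
      using leq_trans[OF _ K_Suc(2)[of c]] m K_univ len_univ add_univ un_univ by simp
    then show "m \<in> I" using m by (auto simp: I_def)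
  next
    assume "m \<in> I"
    then obtain c where m: "m \<in> univ M" "leq M (len M m) (K c)" by (auto simp: I_def)
    have p: "is_power M (len M n) (standard M c) (K c)"
      unfolding K_def by (rule power_factsD(1)[OF len_univ[OF n]])
    obtain q where q: "q \<in> univ M" "is_power M (standard M 2) (K c) q"
      using power_factsD(3)[OF K_univ] by blast
    then have "leq M m q" using power_factsD(7)[OF K_univ q(1) m(1) q(2) m(2)] by simp
    then show "m \<in> univ (small_cut M n)" using m p q by (auto simp: small_cut_def)
  qed
qed

lemma small_cut_eq: "small_cut M n = M\<lparr>univ := I\<rparr>"
  using univ_small_cut by (simp add: small_cut_def)

lemma I_down: "x \<in> I \<Longrightarrow> y \<in> univ M \<Longrightarrow> leq M y x \<Longrightarrow> y \<in> I"
proof -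
  assume x: "x \<in> I" and y: "y \<in> univ M" "leq M y x"
  then obtain c where c: "x \<in> univ M" "leq M (len M x) (K c)" by (auto simp: I_def)
  have "leq M (len M y) (len M x)" using basic_binary(2) y c(1) by simp
  then have "leq M (len M y) (K c)" using c y K_univ len_univ leq_trans[OF _ c(2)] by simp
  then show "y \<in> I" using y by (auto simp: I_def)
qed

lemma bounded_env_I:
  assumes "range e \<subseteq> I"
  shows "\<exists>c. \<forall>d\<ge>c. bounded_env M N (K d) e"
proof (induction N)
  case 0
  show ?case by (simp add: bounded_env_def)
next
  case (Suc N)
  then obtain c where c: "\<forall>d\<ge>c. bounded_env M N (K d) e" by blast
  have "e N \<in> I" using assms by auto
  then obtain c' where c': "e N \<in> univ M" "leq M (len M (e N)) (K c')" by (auto simp: I_def)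
  have "leq M (len M (e N)) (K d)" if "c' \<le> d" for d
    using leq_trans[OF c'(2) K_mono[OF that]] c'(1) K_univ len_univ by simp
  then have "\<forall>d\<ge>max c c'. bounded_env M (Suc N) (K d) e" using c by (simp add: bounded_env_Suc)
  then show ?case ..
qed

lemma I_tval:
  assumes "range e \<subseteq> I"
  shows "tval M e t \<in> I"
proof -
  have e: "range e \<subseteq> univ M" using assms I_univ by auto
  obtain c N where c: "\<forall>e. range e \<subseteq> univ M \<longrightarrow> bounded_by_power M t c N e"
    using bounded_by_power_M[of t] by (elim exE)
  obtain d where d: "\<forall>d'\<ge>d. bounded_env M N (K d') e" using bounded_env_I[OF assms] ..
  have "leq M (len M (tval M e t)) (mpow M (K (Suc d)) c)"
    using c[rule_format, OF e] d K_Suc(1)[of d] K_univ unfolding bounded_by_power_def by simp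
  then show ?thesis using tval_closed[OF struct e] K_Suc(3) by (auto simp: I_def)
qed

definition conds :: "('a \<times> 'a) set" where
  "conds = {(D, l). D \<in> univ M \<and> l \<in> univ M \<and> lin M B l \<and> (\<exists>c. small M D (K c))}"

definition ext :: "'a \<times> 'a \<Rightarrow> 'a \<times> 'a \<Rightarrow> bool" where
  "ext p q \<longleftrightarrow> agree M (fst p) (snd p) (snd q) \<and> sub M (fst p) (fst q)"

lemma ext_refl: "ext p p"
  by (simp add: ext_def agree_def sub_def)

lemma ext_trans:
  assumes "ext p q" "ext q r"
  shows "ext p r"
proof -
  have sub: "mem M x (fst q)" if "mem M x (fst p)" "x \<in> univ M" for x
    using assms(1) that by (simp add: ext_def sub_def)
  have "rel M (snd p) x y \<longleftrightarrow> rel M (snd r) x y"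
    if "mem M x (fst p)" "mem M y (fst p)" "x \<in> univ M" "y \<in> univ M" for x y
    using assms sub that unfolding ext_def agree_def by simp
  moreover have "mem M x (fst r)" if "mem M x (fst p)" "x \<in> univ M" for x
    using assms(2) sub that by (simp add: ext_def sub_def)
  ultimately show ?thesis by (simp add: ext_def agree_def sub_def)
qed

lemma small_K_mono: "D \<in> univ M \<Longrightarrow> small M D (K c) \<Longrightarrow> c \<le> d \<Longrightarrow> small M D (K d)"
  using small_mono[OF _ K_mono] K_univ by simp

lemma extend_dense:
  assumes dense: "\<exists>c N. \<forall>e. range e \<subseteq> univ M \<longrightarrow> dense_req M c N Q e" and e: "range e \<subseteq> I"
    and p: "p \<in> conds"
  shows "\<exists>q\<in>conds. ext p q \<and> Q B (fst q) (snd q) e"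
proof -
  obtain c N where c: "\<forall>e. range e \<subseteq> univ M \<longrightarrow> dense_req M c N Q e" using dense by (elim exE)
  have eM: "range e \<subseteq> univ M" using e I_univ by auto
  obtain d where d: "\<forall>d'\<ge>d. bounded_env M N (K d') e" using bounded_env_I[OF e] ..
  obtain D l k where Dl: "p = (D, l)" "D \<in> univ M" "l \<in> univ M" "lin M B l" "small M D (K k)"
    using p by (auto simp: conds_def)
  \<comment> \<open>The exponent covers the parameters by \<open>d\<close> and the old set by
    \<open>k\<close>, and \<open>Suc\<close> makes the bound at least 2. Its power with exponent
    \<open>c\<close> is again a standard power of \<open>len M n\<close>.\<close>
  let ?m = "K (Suc (max d k))"
  have "leq M (add M (un M) (un M)) ?m" "bounded_env M N ?m e" "small M D ?m"
    using K_Suc(1) d Dl small_K_mono by auto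
  then obtain D' l' where "D' \<in> univ M" "l' \<in> univ M" "lin M B l'" "agree M D l l'" "sub M D D'"
    "small M D' (mpow M ?m c)" "Q B D' l' e"
    using c[rule_format, OF eM] Dl K_univ[of "Suc (max d k)"] B unfolding dense_req_def by blast
  then show ?thesis
    unfolding K_Suc(3) Dl(1) by (intro bexI[of _ "(D', l')"]) (auto simp: conds_def ext_def)
qed

lemma ex_cond: "conds \<noteq> {}"
proof -
  obtain l where "l \<in> univ M" "lin M B l" using basic_unary(4)[OF B] by blast
  moreover have "small M (zer M) (K 0)" using basic_unary(3)[OF K_univ] .
  ultimately have "(zer M, l) \<in> conds" using zer_univ unfolding conds_def by blast
  then show ?thesis by blast
qed

text \<open>The construction of Rasiowa and Sikorski: stage \<open>Suc j\<close> enters the dense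
  set with number \<open>j\<close> of an enumeration.\<close>

lemma ex_generic:
  assumes "countable \<S>" and dense: "\<And>S p. S \<in> \<S> \<Longrightarrow> p \<in> conds \<Longrightarrow> \<exists>q\<in>conds. ext p q \<and> q \<in> S"
  shows "\<exists>G :: nat \<Rightarrow> 'a \<times> 'a. (\<forall>j. G j \<in> conds) \<and> (\<forall>i j. i \<le> j \<longrightarrow> ext (G i) (G j)) \<and>
    (\<forall>S\<in>\<S>. \<exists>j. G j \<in> S)"
proof -
  \<comment> \<open>Adding \<open>UNIV\<close> makes the enumerated family nonempty; reflexivity of
    \<open>ext\<close> shows that it is dense.\<close>
  define f where "f = from_nat_into (insert UNIV \<S>)"
  have f: "range f = insert UNIV \<S>" unfolding f_def using assms(1) by (intro range_from_nat_into) auto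
  have "\<exists>G. \<forall>j. G j \<in> conds \<and> (ext (G j) (G (Suc j)) \<and> G (Suc j) \<in> f j)"
  proof (rule dependent_nat_choice[of "\<lambda>_ p. p \<in> conds" "\<lambda>j p q. ext p q \<and> q \<in> f j"])
    show "\<exists>p. p \<in> conds" using ex_cond by blast
    fix p j assume p: "p \<in> conds"
    have "f j \<in> insert UNIV \<S>" using f by blast
    then show "\<exists>q. q \<in> conds \<and> (ext p q \<and> q \<in> f j)"
      using dense[OF _ p] p ext_refl by blast
  qed
  then obtain G where G: "\<And>j. G j \<in> conds" "\<And>j. ext (G j) (G (Suc j))" "\<And>j. G (Suc j) \<in> f j"
    by blast
  show ?thesis
  proof (intro exI[of _ G] conjI allI impI ballI)
    show "ext (G i) (G j)" if "i \<le> j" for i j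
      using that by (induction j rule: dec_induct) (auto intro: ext_refl ext_trans G)
    show "\<exists>j. G j \<in> S" if "S \<in> \<S>" for S
    proof -
      have "S \<in> range f" using that unfolding f by simp
      then obtain j where "S = f j" by (rule imageE)
      then show ?thesis using G(3)[of j] by blast
    qed
  qed (rule G)
qed

end

section \<open>The generic order\<close>

instance trm :: countable by countable_datatype
instance fm :: countable by countable_datatype

context cut
begin

text \<open>Eventually vanishing assignments suffice, and there are only countably many of them.\<close>

definition envs :: "(nat \<Rightarrow> 'a) set" where
  "envs = {e. range e \<subseteq> I \<and> (\<exists>N. \<forall>k\<ge>N. e k = zer M)}"

lemma envs_I: "e \<in> envs \<Longrightarrow> range e \<subseteq> I"
  by (simp add: envs_def)

lemma zer_I: "zer M \<in> I"
  using basic_facts_M[unfolded basic_facts_def, THEN conjunct1] K_univ zer_univ by (auto simp: I_def)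

lemma case_nat_envs:
  assumes "x \<in> I" "e \<in> envs"
  shows "case_nat x e \<in> envs"
proof -
  obtain N where "\<forall>k\<ge>N. e k = zer M" using assms by (auto simp: envs_def)
  then have "\<forall>k\<ge>Suc N. case_nat x e k = zer M" by (auto simp: Suc_le_eq split: nat.split)
  then show ?thesis using assms by (auto simp: envs_def range_case_nat)
qed

lemma countable_envs:
  assumes "countable (univ M)"
  shows "countable envs"
proof -
  have "countable I" using assms by (rule countable_subset[rotated]) (auto simp: I_def)
  then have count: "countable (lists I)" by (rule countable_lists)
  have "envs \<subseteq> (\<lambda>xs k. if k < length xs then xs ! k else zer M) ` lists I"
  proof
    fix e assume e: "e \<in> envs"
    then obtain N where N: "\<forall>k\<ge>N. e k = zer M" by (auto simp: envs_def)
    show "e \<in> (\<lambda>xs k. if k < length xs then xs ! k else zer M) ` lists I"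
    proof (rule image_eqI)
      show "e = (\<lambda>k. if k < length (map e [0..<N]) then map e [0..<N] ! k else zer M)"
        using N by (intro ext) simp
      show "map e [0..<N] \<in> lists I" using envs_I[OF e] by (auto simp: in_lists_conv_set)
    qed
  qed
  then show ?thesis by (rule countable_subset[OF _ countable_image[OF count]])
qed

end

locale generic = cut +
  fixes G :: "nat \<Rightarrow> 'a \<times> 'a"
  assumes G: "\<And>j. G j \<in> conds" and G_ext: "\<And>i j. i \<le> j \<Longrightarrow> ext (G i) (G j)"
    and G_points: "\<And>x. x \<in> I \<Longrightarrow> \<exists>j. mem M x (fst (G j))"
    and G_dense: "\<And>a Q e. Sigma_b1 a \<Longrightarrow> e \<in> envs \<Longrightarrow> Q \<in> requirements a \<Longrightarrow>
      \<exists>j. Q B (fst (G j)) (snd (G j)) e"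
begin

abbreviation dom :: "nat \<Rightarrow> 'a" where
  "dom j \<equiv> fst (G j)"

abbreviation ord :: "nat \<Rightarrow> 'a" where
  "ord j \<equiv> snd (G j)"

abbreviation forces_at :: "nat \<Rightarrow> fm \<Rightarrow> (nat \<Rightarrow> 'a) \<Rightarrow> bool" where
  "forces_at j a \<equiv> forces M a B (dom j) (ord j)"

definition R :: "'a \<Rightarrow> 'a \<Rightarrow> bool" where
  "R x y \<longleftrightarrow> (\<exists>j. mem M x (dom j) \<and> mem M y (dom j) \<and> rel M (ord j) x y)"

definition forced :: "fm \<Rightarrow> (nat \<Rightarrow> 'a) \<Rightarrow> bool" where
  "forced a e \<longleftrightarrow> (\<exists>j. forces_at j a e)"

lemma forcedI: "forces_at j a e \<Longrightarrow> forced a e"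
  unfolding forced_def by (rule exI)

lemma forces_mono:
  assumes "forces_at i a e" "i \<le> j"
  shows "forces_at j a e"
  unfolding forces_def
proof (intro ballI impI)
  fix l assume l: "l \<in> univ M" "lin M B l" "agree M (dom j) (ord j) l"
  have "agree M (dom i) (ord i) l"
    unfolding agree_def
  proof (intro ballI impI)
    fix x y assume xy: "x \<in> univ M" "y \<in> univ M" "mem M x (dom i)" "mem M y (dom i)"
    have "mem M x (dom j)" "mem M y (dom j)"
      "rel M (ord i) x y \<longleftrightarrow> rel M (ord j) x y"
      using G_ext[OF assms(2)] xy by (simp_all add: ext_def sub_def agree_def)
    then show "rel M (ord i) x y \<longleftrightarrow> rel M l x y" using l(3) xy by (simp add: agree_def)
  qed
  then show "sat M (rel M l) e a" using assms(1) l by (simp add: forces_def)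
qed

text \<open>The later of the two stages forces both formulas, and its own order is among those over
  which forcing quantifies.\<close>

lemma forced_at:
  assumes "forced a e" "forced b e'"
  obtains l where "l \<in> univ M" "sat M (rel M l) e a" "sat M (rel M l) e' b"
proof -
  obtain i j where i: "forces_at i a e"
    and j: "forces_at j b e'"
    using assms(1,2) unfolding forced_def by blast
  have "forces_at (max i j) a e"
    "forces_at (max i j) b e'"
    by (rule forces_mono[OF i max.cobounded1] forces_mono[OF j max.cobounded2])+
  moreover have "ord (max i j) \<in> univ M" "lin M B (ord (max i j))"
    using G[of "max i j"] by (auto simp: conds_def)
  moreover have "agree M D l l" for D l by (simp add: agree_def)
  ultimately show thesis
    unfolding forces_def by (intro that[of "ord (max i j)"]) simp_all
qed

lemma forced_consistent: "forced a e \<Longrightarrow> forced (\<^bold>\<not> a) e \<Longrightarrow> False"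
  by (erule (1) forced_at) simp

lemma forced_semantic:
  assumes "forced a e" "forced b e'"
    and "\<And>l. sat M (rel M l) e a \<Longrightarrow> sat M (rel M l) e' b \<Longrightarrow> sat M (rel M l) e'' c"
  shows "forced c e''"
proof -
  obtain i j where i: "forces_at i a e"
    and j: "forces_at j b e'"
    using assms(1,2) unfolding forced_def by blast
  have "forces_at (max i j) a e"
    "forces_at (max i j) b e'"
    by (rule forces_mono[OF i max.cobounded1] forces_mono[OF j max.cobounded2])+
  then have "forces_at (max i j) c e''"
    unfolding forces_def by (intro ballI impI assms(3)) simp_all
  then show ?thesis unfolding forced_def by (rule exI)
qed

lemma R_iff:
  assumes "mem M x (dom j)" "mem M y (dom j)" "x \<in> univ M" "y \<in> univ M"
  shows "R x y \<longleftrightarrow> rel M (ord j) x y"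
proof
  assume "R x y"
  then obtain i where i: "mem M x (dom i)" "mem M y (dom i)" "rel M (ord i) x y"
    by (auto simp: R_def)
  have "rel M (ord (max i j)) x y"
    using G_ext[of i "max i j"] i assms(3,4) by (simp add: ext_def agree_def)
  then show "rel M (ord j) x y"
    using G_ext[of j "max i j"] assms by (simp add: ext_def agree_def)
qed (use assms in \<open>auto simp: R_def\<close>)

lemma ex_mem:
  assumes "finite A" "A \<subseteq> I"
  shows "\<exists>j. \<forall>x\<in>A. mem M x (dom j)"
  using assms
proof (induction A)
  case (insert x A)
  then obtain i j where i: "\<forall>x\<in>A. mem M x (dom i)" and j: "mem M x (dom j)"
    using G_points[of x] by auto
  have "\<forall>y\<in>insert x A. mem M y (dom (max i j))"
    using G_ext[of i "max i j"] G_ext[of j "max i j"] i j insert.prems I_univ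
    by (auto simp: ext_def sub_def)
  then show ?case ..
qed simp

abbreviation N :: "'a L_structure" where
  "N \<equiv> M\<lparr>univ := I\<rparr>"

lemma tval_N [simp]: "tval N e t = tval M e t"
  by (induction t) simp_all

section \<open>The truth lemma\<close>

text \<open>That the formula is decided and that the decision is correct are stated together, since
  the step for negation needs both. Forcing evaluates in \<open>M\<close>, truth in the cut.\<close>

definition true_iff_forced :: "fm \<Rightarrow> bool" where
  "true_iff_forced a \<longleftrightarrow> (\<forall>e\<in>envs. forced a e \<and> sat N R e a \<or> forced (\<^bold>\<not> a) e \<and> \<not> sat N R e a)"

lemma true_iff_forcedD:
  assumes "true_iff_forced a" "e \<in> envs"
  shows "forced a e \<Longrightarrow> sat N R e a" "forced (\<^bold>\<not> a) e \<Longrightarrow> \<not> sat N R e a"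
    "sat N R e a \<Longrightarrow> forced a e" "\<not> sat N R e a \<Longrightarrow> forced (\<^bold>\<not> a) e"
proof -
  have "forced a e \<and> sat N R e a \<or> forced (\<^bold>\<not> a) e \<and> \<not> sat N R e a"
    using assms unfolding true_iff_forced_def by (rule bspec)
  then show "forced a e \<Longrightarrow> sat N R e a" "forced (\<^bold>\<not> a) e \<Longrightarrow> \<not> sat N R e a"
    "sat N R e a \<Longrightarrow> forced a e" "\<not> sat N R e a \<Longrightarrow> forced (\<^bold>\<not> a) e"
    using forced_consistent[of a e] by blast+
qed

lemma true_iff_forced_const:
  assumes "\<And>e l. e \<in> envs \<Longrightarrow> sat M (rel M l) e a \<longleftrightarrow> sat N R e a"
  shows "true_iff_forced a"
  unfolding true_iff_forced_def
proof
  fix e assume e: "e \<in> envs"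
  show "forced a e \<and> sat N R e a \<or> forced (\<^bold>\<not> a) e \<and> \<not> sat N R e a"
    using assms[OF e] by (cases "sat N R e a") (simp_all add: forced_def forces_def)
qed

lemma true_iff_forced_Tri: "true_iff_forced (s \<^bold>\<lhd> t)"
  unfolding true_iff_forced_def
proof
  fix e assume e: "e \<in> envs"
  let ?x = "tval M e s" and ?y = "tval M e t"
  have xy: "?x \<in> I" "?y \<in> I" using I_tval envs_I[OF e] by simp_all
  then obtain j where j: "mem M ?x (dom j)" "mem M ?y (dom j)"
    using ex_mem[of "{?x, ?y}"] by auto
  have "rel M (ord j) ?x ?y \<longleftrightarrow> rel M l ?x ?y" if "agree M (dom j) (ord j) l" for l
    using that j I_univ[OF xy(1)] I_univ[OF xy(2)] by (simp add: agree_def)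
  then have "forces_at j (s \<^bold>\<lhd> t) e \<and> R ?x ?y \<or>
      forces_at j (\<^bold>\<not> (s \<^bold>\<lhd> t)) e \<and> \<not> R ?x ?y"
    using R_iff[OF j I_univ[OF xy(1)] I_univ[OF xy(2)]] by (auto simp: forces_def)
  then show "forced (s \<^bold>\<lhd> t) e \<and> sat N R e (s \<^bold>\<lhd> t) \<or> forced (\<^bold>\<not> (s \<^bold>\<lhd> t)) e \<and> \<not> sat N R e (s \<^bold>\<lhd> t)"
    unfolding forced_def by auto
qed

lemma true_iff_forced_Neg:
  assumes "true_iff_forced a"
  shows "true_iff_forced (\<^bold>\<not> a)"
  unfolding true_iff_forced_def
proof
  fix e assume e: "e \<in> envs"
  have "forced (\<^bold>\<not> \<^bold>\<not> a) e" if "forced a e" by (rule forced_semantic[OF that that]) simp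
  then show "forced (\<^bold>\<not> a) e \<and> sat N R e (\<^bold>\<not> a) \<or> forced (\<^bold>\<not> \<^bold>\<not> a) e \<and> \<not> sat N R e (\<^bold>\<not> a)"
    unfolding sat.simps using true_iff_forcedD[OF assms e] by blast
qed

lemma true_iff_forced_And:
  assumes "true_iff_forced a" "true_iff_forced b"
  shows "true_iff_forced (a \<^bold>\<and> b)"
  unfolding true_iff_forced_def
proof
  fix e assume e: "e \<in> envs"
  have "forced (a \<^bold>\<and> b) e" if "forced a e" "forced b e" by (rule forced_semantic[OF that]) simp
  moreover have "forced (\<^bold>\<not> (a \<^bold>\<and> b)) e" if "forced (\<^bold>\<not> a) e" by (rule forced_semantic[OF that that]) simp
  moreover have "forced (\<^bold>\<not> (a \<^bold>\<and> b)) e" if "forced (\<^bold>\<not> b) e" by (rule forced_semantic[OF that that]) simp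
  ultimately show "forced (a \<^bold>\<and> b) e \<and> sat N R e (a \<^bold>\<and> b) \<or> forced (\<^bold>\<not> (a \<^bold>\<and> b)) e \<and> \<not> sat N R e (a \<^bold>\<and> b)"
    unfolding sat.simps using true_iff_forcedD[OF assms(1) e] true_iff_forcedD[OF assms(2) e] by blast
qed

lemma true_iff_forced_Or:
  assumes "true_iff_forced a" "true_iff_forced b"
  shows "true_iff_forced (a \<^bold>\<or> b)"
  unfolding true_iff_forced_def
proof
  fix e assume e: "e \<in> envs"
  have "forced (\<^bold>\<not> (a \<^bold>\<or> b)) e" if "forced (\<^bold>\<not> a) e" "forced (\<^bold>\<not> b) e" by (rule forced_semantic[OF that]) simp
  moreover have "forced (a \<^bold>\<or> b) e" if "forced a e" by (rule forced_semantic[OF that that]) simp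
  moreover have "forced (a \<^bold>\<or> b) e" if "forced b e" by (rule forced_semantic[OF that that]) simp
  ultimately show "forced (a \<^bold>\<or> b) e \<and> sat N R e (a \<^bold>\<or> b) \<or> forced (\<^bold>\<not> (a \<^bold>\<or> b)) e \<and> \<not> sat N R e (a \<^bold>\<or> b)"
    unfolding sat.simps using true_iff_forcedD[OF assms(1) e] true_iff_forcedD[OF assms(2) e] by blast
qed

lemma below_tval: "e \<in> envs \<Longrightarrow> x \<in> univ M \<Longrightarrow> leq M x (tval M e t) \<Longrightarrow> case_nat x e \<in> envs"
  by (intro case_nat_envs I_down[OF I_tval[OF envs_I]])

text \<open>A witness that is true in the cut would be forced, which contradicts the forced negation
  at a common stage. A forced witness in turn lies in the cut, being bounded by the value of a term
  there, and is therefore a true one.\<close>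

lemma true_iff_forced_BEx:
  assumes "Sigma_b1 a" "true_iff_forced a"
  shows "true_iff_forced (BEx t a)"
  unfolding true_iff_forced_def
proof
  fix e assume e: "e \<in> envs"
  obtain j where "BEx_witnessed M t a B (dom j) (ord j) e" using G_dense[OF assms(1) e requirementsI(1)] by blast
  then consider "forced (\<^bold>\<not> BEx t a) e" |
      x where "x \<in> univ M" "leq M x (tval M e t)" "forced a (case_nat x e)"
    unfolding BEx_witnessed_def forced_def by blast
  then show "forced (BEx t a) e \<and> sat N R e (BEx t a) \<or> forced (\<^bold>\<not> BEx t a) e \<and> \<not> sat N R e (BEx t a)"
  proof cases
    case 1
    have "\<not> sat N R (case_nat x e) a" if x: "x \<in> I" "leq M x (tval M e t)" for x
    proof
      assume "sat N R (case_nat x e) a"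
      then have "forced a (case_nat x e)"
        using true_iff_forcedD(3)[OF assms(2) case_nat_envs[OF x(1) e]] by blast
      then show False
        by (rule forced_at[OF 1]) (use x I_univ in auto)
    qed
    then show ?thesis using 1 by simp
  next
    case 2
    have "case_nat x e \<in> envs" using below_tval[OF e 2(1,2)] .
    then have "sat N R (case_nat x e) a" "x \<in> I"
      using true_iff_forcedD(1)[OF assms(2)] 2 I_down I_tval[OF envs_I[OF e]] by blast+
    moreover have "forced (BEx t a) e" by (rule forced_semantic[OF 2(3,3)]) (use 2 in auto)
    ultimately show ?thesis using 2 by auto
  qed
qed

lemma true_iff_forced_BAll:
  assumes "Sigma_b1 a" "true_iff_forced a"
  shows "true_iff_forced (BAll (Len t) a)"
  unfolding true_iff_forced_def
proof
  fix e assume e: "e \<in> envs"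
  obtain j where "BAll_witnessed M (Len t) a B (dom j) (ord j) e"
    using G_dense[OF assms(1) e requirementsI(2)] by blast
  then consider "forced (BAll (Len t) a) e" |
      x where "x \<in> univ M" "leq M x (tval M e (Len t))" "forced (\<^bold>\<not> a) (case_nat x e)"
    unfolding BAll_witnessed_def forced_def by blast
  then show "forced (BAll (Len t) a) e \<and> sat N R e (BAll (Len t) a) \<or>
      forced (\<^bold>\<not> BAll (Len t) a) e \<and> \<not> sat N R e (BAll (Len t) a)"
  proof cases
    case 1
    have "sat N R (case_nat x e) a" if x: "x \<in> I" "leq M x (tval M e (Len t))" for x
    proof (rule ccontr)
      assume "\<not> sat N R (case_nat x e) a"
      then have "forced (\<^bold>\<not> a) (case_nat x e)"
        using true_iff_forcedD(4)[OF assms(2) case_nat_envs[OF x(1) e]] by blast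
      then show False
        by (rule forced_at[OF 1]) (use x I_univ in auto)
    qed
    then show ?thesis using 1 by simp
  next
    case 2
    have "case_nat x e \<in> envs" using below_tval[OF e 2(1,2)] .
    then have "\<not> sat N R (case_nat x e) a" "x \<in> I"
      using true_iff_forcedD(2)[OF assms(2)] 2 I_down I_tval[OF envs_I[OF e]] by blast+
    moreover have "forced (\<^bold>\<not> BAll (Len t) a) e" by (rule forced_semantic[OF 2(3,3)]) (use 2 in auto)
    ultimately show ?thesis using 2 by auto
  qed
qed

lemma true_iff_forced_sharply_bounded: "sharply_bounded a \<Longrightarrow> true_iff_forced a"
proof (induction rule: sharply_bounded.induct)
  case (7 a t)
  then show ?case using true_iff_forced_BAll Sigma_b1.intros(1) by blast
next
  case (8 a t)
  then show ?case using true_iff_forced_BEx Sigma_b1.intros(1) by blast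
next
  case (3 s t) show ?case by (rule true_iff_forced_Tri)
next
  case (4 a) show ?case using 4(2) by (rule true_iff_forced_Neg)
next
  case (5 a b) show ?case using 5(3,4) by (rule true_iff_forced_And)
next
  case (6 a b) show ?case using 6(3,4) by (rule true_iff_forced_Or)
qed (rule true_iff_forced_const; simp)+

lemma true_iff_forced_Sigma_b1: "Sigma_b1 a \<Longrightarrow> true_iff_forced a"
proof (induction rule: Sigma_b1.induct)
  case (1 a) then show ?case by (rule true_iff_forced_sharply_bounded)
next
  case (2 a b) show ?case using 2(3,4) by (rule true_iff_forced_And)
next
  case (3 a b) show ?case using 3(3,4) by (rule true_iff_forced_Or)
next
  case (4 a t) show ?case using 4 by (rule true_iff_forced_BAll)
next
  case (5 a t) show ?case using 5 by (rule true_iff_forced_BEx)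
next
  case (6 a t) show ?case using 6 by (rule true_iff_forced_BEx)
qed

lemmas forced_true = true_iff_forcedD(1,2)[OF true_iff_forced_Sigma_b1]

end

section \<open>The theories hold in the generic expansion\<close>

primrec tvars_bound :: "trm \<Rightarrow> nat" where
  "tvars_bound (Var k) = Suc k"
| "tvars_bound \<^bold>0 = 0"
| "tvars_bound \<^bold>1 = 0"
| "tvars_bound (s \<^bold>+ t) = max (tvars_bound s) (tvars_bound t)"
| "tvars_bound (s \<^bold>* t) = max (tvars_bound s) (tvars_bound t)"
| "tvars_bound (Len t) = tvars_bound t"
| "tvars_bound (Half t) = tvars_bound t"
| "tvars_bound (s \<^bold># t) = max (tvars_bound s) (tvars_bound t)"

primrec vars_bound :: "fm \<Rightarrow> nat" where
  "vars_bound (s \<^bold>= t) = max (tvars_bound s) (tvars_bound t)"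
| "vars_bound (s \<^bold>\<le> t) = max (tvars_bound s) (tvars_bound t)"
| "vars_bound (s \<^bold>\<lhd> t) = max (tvars_bound s) (tvars_bound t)"
| "vars_bound (\<^bold>\<not> a) = vars_bound a"
| "vars_bound (a \<^bold>\<and> b) = max (vars_bound a) (vars_bound b)"
| "vars_bound (a \<^bold>\<or> b) = max (vars_bound a) (vars_bound b)"
| "vars_bound (All a) = vars_bound a"
| "vars_bound (Ex a) = vars_bound a"

lemma tval_cong: "\<forall>i<tvars_bound t. e i = e' i \<Longrightarrow> tval S e t = tval S e' t"
  by (induction t) simp_all

text \<open>Truth depends on finitely many entries, so what holds under the eventually vanishing
  assignments of \<open>envs\<close> holds under all assignments into the cut.\<close>

lemma sat_cong: "\<forall>i<vars_bound a. e i = e' i \<Longrightarrow> sat S R e a = sat S R e' a"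
proof (induction a arbitrary: e e')
  case (Eq s t)
  then show ?case using tval_cong[of s e e'] tval_cong[of t e e'] by simp
next
  case (Le s t)
  then show ?case using tval_cong[of s e e'] tval_cong[of t e e'] by simp
next
  case (Tri s t)
  then show ?case using tval_cong[of s e e'] tval_cong[of t e e'] by simp
next
  case (Neg a)
  then show ?case using Neg.IH[of e e'] by simp
next
  case (And a b)
  have "sat S R e a = sat S R e' a" by (rule And.IH(1)) (use And.prems in simp)
  moreover have "sat S R e b = sat S R e' b" by (rule And.IH(2)) (use And.prems in simp)
  ultimately show ?case by simp
next
  case (Or a b)
  have "sat S R e a = sat S R e' a" by (rule Or.IH(1)) (use Or.prems in simp)
  moreover have "sat S R e b = sat S R e' b" by (rule Or.IH(2)) (use Or.prems in simp)
  ultimately show ?case by simp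
next
  case (All a)
  have "sat S R (case_nat x e) a = sat S R (case_nat x e') a" for x
    by (rule All.IH) (use All.prems in \<open>simp split: nat.split\<close>)
  then show ?case by simp
next
  case (Ex a)
  have "sat S R (case_nat x e) a = sat S R (case_nat x e') a" for x
    by (rule Ex.IH) (use Ex.prems in \<open>simp split: nat.split\<close>)
  then show ?case by simp
qed

lemma sat_inst: "sat S R e (inst t a) \<longleftrightarrow> sat S R (case_nat (tval S e t) e) a"
proof -
  have "(\<lambda>k. tval S e (case_nat t Var k)) = case_nat (tval S e t) e"
    by (auto simp: fun_eq_iff split: nat.split)
  then show ?thesis by (simp add: inst_def sat_subst)
qed

lemma sat_subst_head: "sat S R (case_nat x e) (subst (case_nat t (\<lambda>k. Var (Suc k))) a) \<longleftrightarrow>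
    sat S R (case_nat (tval S (case_nat x e) t) e) a"
proof -
  have "(\<lambda>k. tval S (case_nat x e) (case_nat t (\<lambda>k. Var (Suc k)) k)) = case_nat (tval S (case_nat x e) t) e"
    by (auto simp: fun_eq_iff split: nat.split)
  then show ?thesis by (simp add: sat_subst)
qed

lemma sat_app2: "sat S R e (app2 d a s t) \<longleftrightarrow>
    sat S R (case_nat (tval S e s) (case_nat (tval S e t) (\<lambda>k. e (k + d)))) a"
proof -
  have "(\<lambda>k. tval S e (case_nat s (case_nat t (\<lambda>k. Var (k + d))) k)) =
      case_nat (tval S e s) (case_nat (tval S e t) (\<lambda>k. e (k + d)))"
    by (auto simp: fun_eq_iff split: nat.split)
  then show ?thesis by (simp add: app2_def sat_subst)
qed

primrec quantifier_free :: "fm \<Rightarrow> bool" where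
  "quantifier_free (s \<^bold>= t) = True"
| "quantifier_free (s \<^bold>\<le> t) = True"
| "quantifier_free (s \<^bold>\<lhd> t) = True"
| "quantifier_free (\<^bold>\<not> a) = quantifier_free a"
| "quantifier_free (a \<^bold>\<and> b) = (quantifier_free a \<and> quantifier_free b)"
| "quantifier_free (a \<^bold>\<or> b) = (quantifier_free a \<and> quantifier_free b)"
| "quantifier_free (All a) = False"
| "quantifier_free (Ex a) = False"

lemma len_double:
  "x = 0 \<or> floorlog 2 (2 * x) = Suc (floorlog 2 x)"
  "x = 0 \<or> floorlog 2 (Suc (2 * x)) = Suc (floorlog 2 x)"
  "x = 0 \<or> floorlog 2 x = Suc (floorlog 2 (x div 2))"
  by (cases "x = 0"; subst compute_floorlog; simp)+

lemma BASIC_nat: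
  assumes "a \<in> BASIC"
  shows "L_formula a \<and> quantifier_free a \<and> L_sat \<N> e a"
proof -
  have pow: "floorlog 2 (2 ^ k :: nat) = Suc k" for k
    using floorlog_power[of 1 2 k] by simp
  have zero: "floorlog 2 0 = 0" by (simp add: floorlog_def)
  have half: "2 * (x div 2) = x \<or> Suc (2 * (x div 2)) = x" for x :: nat by arith
  show ?thesis
    using assms unfolding BASIC_def Let_def insert_iff empty_iff simp_thms
    by (elim disjE;
      use len_double[of "e 0"] half[of "e (Suc 0)"] in \<open>auto simp: pow zero floorlog_mono power_add distrib_left distrib_right
        mult.commute simp flip: mult_2 mult_2_right\<close>)
qed


context generic
begin

lemma range_trunc: "range e \<subseteq> I \<Longrightarrow> (\<lambda>i. if i < k then e i else zer M) \<in> envs"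
  using zer_I unfolding envs_def by (auto intro!: exI[of _ k])

lemma sat_all_envs:
  assumes "\<And>e. e \<in> envs \<Longrightarrow> sat N R e a" and "range e \<subseteq> I"
  shows "sat N R e a"
proof -
  have "sat N R e a = sat N R (\<lambda>i. if i < vars_bound a then e i else zer M) a"
    by (rule sat_cong) simp
  then show ?thesis using assms(1)[OF range_trunc[OF assms(2)]] by simp
qed

text \<open>The axioms are quantifier-free, so their truth passes from \<open>M\<close> to the
  substructure on the cut.\<close>

lemma BASIC_N:
  assumes "a \<in> BASIC" "range e \<subseteq> I"
  shows "sat N R e a"
proof -
  have a: "L_formula a" "quantifier_free a" "\<forall>e. L_sat \<N> e a"
    using BASIC_nat[OF assms(1)] by simp_all
  then have "a \<in> true_arithmetic" by (simp add: true_arithmetic_def)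
  moreover have "range e \<subseteq> univ M" using assms(2) I_univ by auto
  ultimately have "L_sat M e a" using M by (simp add: is_model_def)
  moreover have "sat N R e b = L_sat M e b" if "L_formula b" "quantifier_free b" for b
    using that by (induction b) simp_all
  ultimately show ?thesis using a by simp
qed

text \<open>The third outcome of the requirement is a violation of the step. Both of its points are
  at most \<open>b\<close>, hence in the cut, where being forced implies being true.\<close>

lemma induction_N:
  assumes a: "Sigma_b1 a" and e: "e \<in> envs" and 0: "sat N R (case_nat (zer M) e) a"
    and step: "\<forall>x\<in>I. \<forall>y\<in>I. predecessor binary M x y \<longrightarrow> sat N R (case_nat x e) a \<longrightarrow>
      sat N R (case_nat y e) a"
    and b: "b \<in> I"
  shows "sat N R (case_nat b e) a"
proof -
  have be: "case_nat b e \<in> envs" using case_nat_envs[OF b e] .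
  obtain j where "induction_decided binary M a B (dom j) (ord j) (case_nat b e)"
    using G_dense[OF a be requirementsI(3)] by blast
  then have "forced (\<^bold>\<not> a) (case_nat (zer M) e) \<or> forced a (case_nat b e) \<or>
      (\<exists>x\<in>univ M. \<exists>y\<in>univ M. leq M x y \<and> leq M y b \<and> predecessor binary M x y \<and>
         forced a (case_nat x e) \<and> forced (\<^bold>\<not> a) (case_nat y e))"
    by (auto simp: induction_decided_def dest: forcedI)
  then consider "forced (\<^bold>\<not> a) (case_nat (zer M) e)" | "forced a (case_nat b e)"
    | x y where "x \<in> univ M" "y \<in> univ M" "leq M x y" "leq M y b" "predecessor binary M x y"
      "forced a (case_nat x e)" "forced (\<^bold>\<not> a) (case_nat y e)"
    by blast
  then show ?thesis
  proof cases
    case 1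
    then show ?thesis using forced_true(2)[OF a case_nat_envs[OF zer_I e]] 0 by blast
  next
    case 2
    then show ?thesis using forced_true(1)[OF a be] by blast
  next
    case 3
    have y: "y \<in> I" using I_down[OF b 3(2,4)] .
    have x: "x \<in> I" using I_down[OF y 3(1,3)] .
    have "sat N R (case_nat x e) a" using forced_true(1)[OF a case_nat_envs[OF x e] 3(6)] .
    moreover have "\<not> sat N R (case_nat y e) a" using forced_true(2)[OF a case_nat_envs[OF y e] 3(7)] .
    ultimately show ?thesis using step x y 3(5) by blast
  qed
qed

lemma IND_N:
  assumes "Sigma_b1 a" "e \<in> envs"
  shows "sat N R e (IND a)"
proof -
  have "sat N R e (IND a) \<longleftrightarrow> (sat N R (case_nat (zer M) e) a \<longrightarrow>
      (\<forall>x\<in>I. sat N R (case_nat x e) a \<longrightarrow> sat N R (case_nat (add M x (un M)) e) a) \<longrightarrow>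
      (\<forall>b\<in>I. sat N R (case_nat b e) a))"
    by (simp add: IND_def sat_inst sat_subst_head) blast
  then show ?thesis using induction_N[OF assms, of False] unfolding predecessor_def if_False by blast
qed

lemma PIND_N:
  assumes "Sigma_b1 a" "e \<in> envs"
  shows "sat N R e (PIND a)"
proof -
  have "sat N R e (PIND a) \<longleftrightarrow> (sat N R (case_nat (zer M) e) a \<longrightarrow>
      (\<forall>x\<in>I. sat N R (case_nat (half M x) e) a \<longrightarrow> sat N R (case_nat x e) a) \<longrightarrow>
      (\<forall>b\<in>I. sat N R (case_nat b e) a))"
    by (simp add: PIND_def sat_inst sat_subst_head) blast
  then show ?thesis using induction_N[OF assms, of True] unfolding predecessor_def if_True by blast
qed

lemma PHP_N:
  assumes a: "Sigma_b1 a" and e: "e \<in> envs"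
  shows "sat N R e (PHP a)"
proof -
  have goal: "\<forall>u\<in>I. \<forall>v\<in>I. lt M v u \<longrightarrow>
      (\<exists>x\<in>I. lt M x u \<and> (\<forall>y\<in>I. lt M y v \<longrightarrow> \<not> sat N R (case_nat x (case_nat y e)) a)) \<or>
      (\<exists>x\<in>I. lt M x u \<and> (\<exists>x'\<in>I. lt M x' u \<and> x \<noteq> x' \<and> (\<exists>y\<in>I. lt M y v \<and>
         sat N R (case_nat x (case_nat y e)) a \<and> sat N R (case_nat x' (case_nat y e)) a))) \<or>
      (\<exists>x\<in>I. lt M x u \<and> (\<exists>y\<in>I. lt M y v \<and> (\<exists>y'\<in>I. lt M y' v \<and> y \<noteq> y' \<and>
         sat N R (case_nat x (case_nat y e)) a \<and> sat N R (case_nat x (case_nat y' e)) a)))"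
    (is "\<forall>u\<in>I. \<forall>v\<in>I. lt M v u \<longrightarrow> ?P u v")
  proof (intro ballI impI)
    fix u v assume u: "u \<in> I" and v: "v \<in> I" and "lt M v u"
    have "case_nat v (case_nat u e) \<in> envs" using case_nat_envs u v e by blast
    then obtain j where "PHP_decided M a B (dom j) (ord j) (case_nat v (case_nat u e))"
      using G_dense[OF a _ requirementsI(4)] by blast
    then have "(\<exists>x\<in>univ M. lt M x u \<and> (\<forall>y\<in>univ M. lt M y v \<longrightarrow> forced (\<^bold>\<not> a) (case_nat x (case_nat y e)))) \<or>
      (\<exists>x\<in>univ M. \<exists>x'\<in>univ M. \<exists>y\<in>univ M. lt M x u \<and> lt M x' u \<and> x \<noteq> x' \<and> lt M y v \<and>
        forced a (case_nat x (case_nat y e)) \<and> forced a (case_nat x' (case_nat y e))) \<or>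
      (\<exists>x\<in>univ M. \<exists>y\<in>univ M. \<exists>y'\<in>univ M. lt M x u \<and> lt M y v \<and> lt M y' v \<and> y \<noteq> y' \<and>
        forced a (case_nat x (case_nat y e)) \<and> forced a (case_nat x (case_nat y' e)))"
      using \<open>lt M v u\<close> unfolding PHP_decided_def forced_def by simp blast
    \<comment> \<open>Witnesses are delivered as elements of \<open>M\<close>, but they lie below
      \<open>u\<close> or \<open>v\<close> and thus in the cut.\<close>
    moreover have below: "x \<in> I" if "x \<in> univ M" "lt M x u \<or> lt M x v" for x
      using that I_down u v by (auto simp: lt_def)
    moreover have "case_nat x (case_nat y e) \<in> envs" if "x \<in> I" "y \<in> I" for x y
      using case_nat_envs that e by blast
    note T = forced_true[OF a this]
    ultimately show "?P u v"
      apply (elim disjE bexE conjE)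
      subgoal for x by (intro disjI1 bexI[of _ x] conjI ballI impI T(2)) (auto intro: I_univ)
      subgoal for x x' y by (intro disjI2 disjI1 bexI[of _ x] bexI[of _ x'] bexI[of _ y] conjI T(1)) auto
      subgoal for x y y' by (intro disjI2 disjI2 bexI[of _ x] bexI[of _ y] bexI[of _ y'] conjI T(1)) auto
      done
  qed
  have shift: "(\<lambda>k. case_nat x0 (case_nat x1 (case_nat x2 (case_nat x3 e))) (k + 4)) = e"
    "(\<lambda>k. case_nat x0 (case_nat x1 (case_nat x2 (case_nat x3 (case_nat x4 e)))) (k + 5)) = e"
    for x0 x1 x2 x3 x4
    by (simp_all add: fun_eq_iff eval_nat_numeral)
  show ?thesis
    using goal unfolding PHP_def lt_def imp_conv_disj by (simp add: sat_app2 shift)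
qed

lemma model_N: "is_model N R (T12 \<union> PHP_Delta_b1)"
  unfolding is_model_def
proof (intro conjI ballI allI impI)
  have e: "range (case_nat x (case_nat y (\<lambda>_. zer M))) \<subseteq> I" if "x \<in> I" "y \<in> I" for x y
    using that zer_I by (simp add: range_case_nat)
  have "tval M (case_nat x (case_nat y (\<lambda>_. zer M))) t \<in> I" if "x \<in> I" "y \<in> I" for x y t
    using I_tval[OF e[OF that]] .
  from this[where t = "Len (Var 0)"] this[where t = "Half (Var 0)"] this[where t = "\<^bold>1"]
    this[where t = "Var 0 \<^bold>+ Var 1"] this[where t = "Var 0 \<^bold>* Var 1"] this[where t = "Var 0 \<^bold># Var 1"]
  show "is_structure N" using zer_I by (auto simp: is_structure_def)
  fix a and e :: "nat \<Rightarrow> 'a" assume a: "a \<in> T12 \<union> PHP_Delta_b1" and e: "range e \<subseteq> univ N"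
  have e': "range e \<subseteq> I" using e by simp
  from a consider "a \<in> BASIC" | b where "a = PIND b" "Sigma_b1 b" | b where "a = IND b" "Sigma_b1 b"
    | b where "a = PHP b" "Sigma_b1 b"
    unfolding T12_def S12_def PHP_Delta_b1_def Delta_b1_def by blast
  then show "sat N R e a"
  proof cases
    case 1
    then show ?thesis using BASIC_N e' by blast
  next
    case 2
    show ?thesis unfolding 2(1) by (rule sat_all_envs[OF PIND_N[OF 2(2)] e'])
  next
    case 3
    show ?thesis unfolding 3(1) by (rule sat_all_envs[OF IND_N[OF 3(2)] e'])
  next
    case 4
    show ?thesis unfolding 4(1) by (rule sat_all_envs[OF PHP_N[OF 4(2)] e'])
  qed
qed

end

section \<open>Dense orders\<close>

context cut
begin

lemma small_bounded:
  assumes "small M D (K c)" "D \<in> univ M"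
  shows "\<exists>d. leq M (add M (un M) (un M)) (K d) \<and> small M D (K d)"
  using K_Suc(1)[of c] small_K_mono[OF assms(2,1), of "Suc c"] by auto

lemma point_added_conds:
  assumes "point_added M B D l (K d) z D' l'" "D' \<in> univ M" "l' \<in> univ M"
  shows "(D', l') \<in> conds \<and> ext (D, l) (D', l') \<and> mem M z D'"
  using assms unfolding point_added_def conds_def ext_def K_Suc(3) by auto

lemma add_point:
  assumes p: "p \<in> conds" and z: "z \<in> univ M"
  shows "\<exists>q\<in>conds. ext p q \<and> mem M z (fst q)"
proof -
  obtain D l c where D: "p = (D, l)" "D \<in> univ M" "l \<in> univ M" "lin M B l" "small M D (K c)"
    using p by (auto simp: conds_def)
  obtain d where d: "leq M (add M (un M) (un M)) (K d)" "small M D (K d)"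
    using small_bounded[OF D(5,2)] by blast
  have "\<exists>D'\<in>univ M. point_added M B D l (K d) z D' l"
    using points_addable_M[unfolded points_addable_def, rule_format, OF B D(2,3) K_univ z D(4) d(2,1)]
    by (rule conjunct1)
  then obtain D' where D': "D' \<in> univ M" "point_added M B D l (K d) z D' l" by blast
  show ?thesis
    using point_added_conds[OF D'(2,1) D(3)] unfolding D(1) by (intro bexI[of _ "(D', l)"]) auto
qed

text \<open>The order code gives every point below \<open>B\<close> some place, but a point outside
  of the first component is not committed to it and may still be moved.\<close>

lemma place_point:
  assumes p: "p \<in> conds" and z: "z \<in> I" "\<not> mem M z (fst p)" and x: "x \<in> I" "mem M x (fst p)"
  shows "\<exists>q\<in>conds. ext p q \<and> mem M z (fst q) \<and> rel M (snd q) x z"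
    "\<exists>q\<in>conds. ext p q \<and> mem M z (fst q) \<and> rel M (snd q) z x"
    "y \<in> univ M \<Longrightarrow> mem M y (fst p) \<Longrightarrow> rel M (snd p) x y \<Longrightarrow>
      \<exists>q\<in>conds. ext p q \<and> mem M z (fst q) \<and> rel M (snd q) x z \<and> rel M (snd q) z y"
proof -
  obtain D l c where D: "p = (D, l)" "D \<in> univ M" "l \<in> univ M" "lin M B l" "small M D (K c)"
    using p by (auto simp: conds_def)
  obtain d where d: "leq M (add M (un M) (un M)) (K d)" "small M D (K d)"
    using small_bounded[OF D(5,2)] by blast
  note A = points_addable_M[unfolded points_addable_def, rule_format, OF B D(2,3) K_univ I_univ[OF z(1)] D(4) d(2,1),
      THEN conjunct2, rule_format, OF lt_B[OF z(1)] z(2)[unfolded D(1) fst_conv] I_univ[OF x(1)]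
      x(2)[unfolded D(1) fst_conv] lt_B[OF x(1)]]
  show "\<exists>q\<in>conds. ext p q \<and> mem M z (fst q) \<and> rel M (snd q) x z"
  proof -
    obtain D' l' where D': "D' \<in> univ M" "l' \<in> univ M" "point_added M B D l (K d) z D' l'" "rel M l' x z"
      using A[THEN conjunct1] by blast
    show ?thesis
      using point_added_conds[OF D'(3,1,2)] D'(4) unfolding D(1) by (intro bexI[of _ "(D', l')"]) auto
  qed
  show "\<exists>q\<in>conds. ext p q \<and> mem M z (fst q) \<and> rel M (snd q) z x"
  proof -
    obtain D' l' where D': "D' \<in> univ M" "l' \<in> univ M" "point_added M B D l (K d) z D' l'" "rel M l' z x"
      using A[THEN conjunct2, THEN conjunct1] by blast
    show ?thesis
      using point_added_conds[OF D'(3,1,2)] D'(4) unfolding D(1) by (intro bexI[of _ "(D', l')"]) auto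
  qed
  show "\<exists>q\<in>conds. ext p q \<and> mem M z (fst q) \<and> rel M (snd q) x z \<and> rel M (snd q) z y"
    if y: "y \<in> univ M" "mem M y (fst p)" "rel M (snd p) x y"
  proof -
    obtain D' l' where D': "D' \<in> univ M" "l' \<in> univ M" "point_added M B D l (K d) z D' l'"
      "rel M l' x z" "rel M l' z y"
      using A[THEN conjunct2, THEN conjunct2, rule_format, of y] y unfolding D(1) fst_conv snd_conv
      by blast
    show ?thesis
      using point_added_conds[OF D'(3,1,2)] D'(4,5) unfolding D(1) by (intro bexI[of _ "(D', l')"]) auto
  qed
qed

lemma fresh_point:
  assumes d: "nonstandard M d" and p: "is_power M (len M n) d p"
    and f: "definable_injection M f (below M p) Y" and q: "q \<in> conds"
  shows "\<exists>z\<in>Y. \<not> mem M z (fst q)"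
proof -
  obtain D c where D: "D = fst q" "D \<in> univ M" "small M D (K c)" using q by (auto simp: conds_def)
  have u: "d \<in> univ M" "p \<in> univ M" using is_powerD[OF p] by simp_all
  \<comment> \<open>The nonstandard exponent \<open>d\<close> exceeds the standard \<open>c\<close>,
    and for a base of at least 2 a larger exponent gives a strictly larger power.\<close>
  have Kp: "lt M (K c) p"
    unfolding K_def
    by (rule power_factsD(5)[OF len_univ[OF n] u two p standard_lt_nonstandard[OF d]])
  obtain a e where a: "L_formula a" "range e \<subseteq> univ M"
    and graph: "{(x, f x) | x. x \<in> below M p} =
      {(x, y) \<in> univ M \<times> univ M. L_sat M (case_nat x (case_nat y e)) a}"
    using f unfolding definable_injection_def definable_rel_def by blast
  have fY: "f ` below M p \<subseteq> Y" and inj: "inj_on f (below M p)"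
    using f by (auto simp: definable_injection_def)
  have below: "x \<in> below M p \<longleftrightarrow> x \<in> univ M \<and> lt M x p" for x by (auto simp: below_def lt_def)
  have A: "L_sat M (case_nat x (case_nat y e)) a \<longleftrightarrow> lt M x p \<and> y = f x"
    if "x \<in> univ M" "y \<in> univ M" for x y
  proof -
    have "(x, y) \<in> {(x, f x) | x. x \<in> below M p} \<longleftrightarrow> L_sat M (case_nat x (case_nat y e)) a"
      unfolding graph using that by simp
    then show ?thesis using below that(1) by auto
  qed
  have fu: "f x \<in> univ M" if "x \<in> univ M" "lt M x p" for x
  proof -
    have "(x, f x) \<in> {(x, f x) | x. x \<in> below M p}" using that below by auto
    then show ?thesis unfolding graph by simp
  qed
  have "\<exists>x\<in>univ M. \<exists>y\<in>univ M. lt M x p \<and> L_sat M (case_nat x (case_nat y e)) a \<and> \<not> mem M y D"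
  proof (rule avoids_small_M[OF a, unfolded avoids_small_def, rule_format, OF u(2) D(2) K_univ Kp D(3)])
    show "\<exists>y\<in>univ M. L_sat M (case_nat x (case_nat y e)) a" if "x \<in> univ M" "lt M x p" for x
      using A[OF that(1) fu[OF that]] that(2) fu[OF that] by blast
    show "x = x'" if "x \<in> univ M" "x' \<in> univ M" "y \<in> univ M" "lt M x p" "lt M x' p"
      "L_sat M (case_nat x (case_nat y e)) a" "L_sat M (case_nat x' (case_nat y e)) a" for x x' y
    proof -
      have "f x = f x'" using A[OF that(1,3)] A[OF that(2,3)] that(6,7) by simp
      then show ?thesis using inj_onD[OF inj] below that by blast
    qed
  qed
  then obtain x y where "x \<in> univ M" "y \<in> univ M" "lt M x p" "y = f x" "\<not> mem M y D" using A by blast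
  then show ?thesis using fY below D(1) by blast
qed

end

text \<open>Irreflexivity, totality and transitivity come from linearity at every stage; the other
  axioms are reduced to conditions that a single stage can meet. The implication in
  \<open>between\<close> lets a stage with the points in the other order count as well.\<close>

lemma (in generic) DLO_R:
  assumes Y: "Y \<subseteq> I"
    and lower: "\<And>x. x \<in> Y \<Longrightarrow> \<exists>j. mem M x (dom j) \<and>
      (\<exists>z\<in>Y. mem M z (dom j) \<and> rel M (ord j) z x)"
    and upper: "\<And>x. x \<in> Y \<Longrightarrow> \<exists>j. mem M x (dom j) \<and>
      (\<exists>z\<in>Y. mem M z (dom j) \<and> rel M (ord j) x z)"
    and between: "\<And>x y. x \<in> Y \<Longrightarrow> y \<in> Y \<Longrightarrow> \<exists>j. mem M x (dom j) \<and> mem M y (dom j) \<and>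
      (rel M (ord j) x y \<longrightarrow>
        (\<exists>z\<in>Y. mem M z (dom j) \<and> rel M (ord j) x z \<and> rel M (ord j) z y))"
  shows "DLO Y R"
proof -
  have lin: "rel M (ord j) x y \<Longrightarrow> x \<in> I \<Longrightarrow> y \<in> I \<Longrightarrow> x \<noteq> y"
    "rel M (ord j) x y \<Longrightarrow> rel M (ord j) y z \<Longrightarrow> x \<in> I \<Longrightarrow> y \<in> I \<Longrightarrow> z \<in> I \<Longrightarrow> rel M (ord j) x z"
    "x \<in> I \<Longrightarrow> y \<in> I \<Longrightarrow> x \<noteq> y \<Longrightarrow> rel M (ord j) x y \<or> rel M (ord j) y x" for j x y z
  proof -
    have l: "lin M B (ord j)" using G[of j] by (auto simp: conds_def)
    show "rel M (ord j) x y \<Longrightarrow> x \<in> I \<Longrightarrow> y \<in> I \<Longrightarrow> x \<noteq> y"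
      using l[unfolded lin_def, THEN conjunct1] I_univ by simp
    show "rel M (ord j) x y \<Longrightarrow> rel M (ord j) y z \<Longrightarrow> x \<in> I \<Longrightarrow> y \<in> I \<Longrightarrow> z \<in> I \<Longrightarrow> rel M (ord j) x z"
      using l[unfolded lin_def, THEN conjunct2, THEN conjunct1] I_univ[of x] I_univ[of y] I_univ[of z] by blast
    show "x \<in> I \<Longrightarrow> y \<in> I \<Longrightarrow> x \<noteq> y \<Longrightarrow> rel M (ord j) x y \<or> rel M (ord j) y x"
      using l[unfolded lin_def, THEN conjunct2, THEN conjunct2] I_univ lt_B by simp
  qed
  have iff: "R x y \<longleftrightarrow> rel M (ord j) x y"
    if "x \<in> Y" "y \<in> Y" "mem M x (dom j)" "mem M y (dom j)" for x y j
    using R_iff that Y I_univ by blast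
  have irr: "\<not> R x x" if "x \<in> Y" for x
    using R_def lin(1)[of _ x x] that Y by blast
  have mem3: "\<exists>j. mem M x (dom j) \<and> mem M y (dom j) \<and> mem M z (dom j)"
    if "x \<in> Y" "y \<in> Y" "z \<in> Y" for x y z
    using ex_mem[of "{x, y, z}"] that Y by auto
  show ?thesis
    unfolding DLO_def
  proof (intro conjI ballI impI)
    fix x assume x: "x \<in> Y"
    show "\<not> R x x" using irr[OF x] .
    obtain j z where z: "z \<in> Y" "mem M x (dom j)" "mem M z (dom j)" "rel M (ord j) z x"
      using lower[OF x] by blast
    then have R: "R z x" using iff[OF z(1) x z(3,2)] by simp
    then have "z \<noteq> x" using irr[OF x] by auto
    with R show "\<exists>y\<in>Y. y \<noteq> x \<and> R y x" using z(1) by blast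
    obtain j z where z: "z \<in> Y" "mem M x (dom j)" "mem M z (dom j)" "rel M (ord j) x z"
      using upper[OF x] by blast
    then have R: "R x z" using iff[OF x z(1-3)] by simp
    then have "z \<noteq> x" using irr[OF x] by auto
    with R show "\<exists>y\<in>Y. y \<noteq> x \<and> R x y" using z(1) by blast
  next
    fix x y assume xy: "x \<in> Y" "y \<in> Y" "x \<noteq> y"
    obtain j where j: "mem M x (dom j)" "mem M y (dom j)" using mem3[of x y y] xy by blast
    have "x \<in> I" "y \<in> I" using xy Y by blast+
    from lin(3)[OF this xy(3), of j] show "R x y \<or> R y x"
      using iff[OF xy(1,2) j] iff[OF xy(2,1) j(2,1)] by simp
  next
    fix x y z assume xyz: "x \<in> Y" "y \<in> Y" "z \<in> Y" "R x y \<and> R y z"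
    obtain j where j: "mem M x (dom j)" "mem M y (dom j)" "mem M z (dom j)"
      using mem3 xyz by blast
    have "x \<in> I" "y \<in> I" "z \<in> I" using xyz Y by blast+
    then show "R x z"
      using lin(2)[of j x y z] iff[OF xyz(1,2) j(1,2)] iff[OF xyz(2,3) j(2,3)] iff[OF xyz(1,3) j(1,3)] xyz(4)
      by simp
  next
    fix x y assume xy: "x \<in> Y" "y \<in> Y" "R x y"
    obtain j where j: "mem M x (dom j)" "mem M y (dom j)"
      "rel M (ord j) x y \<longrightarrow>
        (\<exists>z\<in>Y. mem M z (dom j) \<and> rel M (ord j) x z \<and> rel M (ord j) z y)"
      using between[OF xy(1,2)] by blast
    then obtain z where z: "z \<in> Y" "mem M z (dom j)" "rel M (ord j) x z" "rel M (ord j) z y"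
      using iff[OF xy(1,2) j(1,2)] xy(3) by blast
    then show "\<exists>z\<in>Y. R x z \<and> R z y"
      using iff[OF xy(1) z(1) j(1) z(2)] iff[OF z(1) xy(2) z(2) j(2)] by blast
  qed
qed

lemma (in cut) ex_expansion:
  assumes count: "countable (univ M)" and X: "\<And>i::nat. X i \<subseteq> I"
    and fresh: "\<And>i q. q \<in> conds \<Longrightarrow> \<exists>z\<in>X i. \<not> mem M z (fst q)"
  shows "\<exists>R. is_model (M\<lparr>univ := I\<rparr>) R (T12 \<union> PHP_Delta_b1) \<and> (\<forall>i. DLO (X i) R)"
proof -
  define lower where "lower i x = {q. mem M x (fst q) \<and> (\<exists>z\<in>X i. mem M z (fst q) \<and> rel M (snd q) z x)}" for i x
  define upper where "upper i x = {q. mem M x (fst q) \<and> (\<exists>z\<in>X i. mem M z (fst q) \<and> rel M (snd q) x z)}" for i x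
  define between where "between i x y = {q. mem M x (fst q) \<and> mem M y (fst q) \<and> (rel M (snd q) x y \<longrightarrow>
     (\<exists>z\<in>X i. mem M z (fst q) \<and> rel M (snd q) x z \<and> rel M (snd q) z y))}" for i x y
  \<comment> \<open>Three families: points entering the condition, requirements for formulas under
    assignments in \<open>envs\<close>, and the order requirements of the sets \<open>X i\<close>.
    Each of the index sets is countable.\<close>
  define \<S> where "\<S> = (\<lambda>x. {q. mem M x (fst q)}) ` I \<union>
     (\<Union>a\<in>Collect Sigma_b1. \<Union>Q\<in>requirements a. (\<lambda>e. {q. Q B (fst q) (snd q) e}) ` envs) \<union>
     (\<Union>i. lower i ` X i \<union> upper i ` X i \<union> (\<Union>x\<in>X i. between i x ` X i))"
  have "countable I" using count by (rule countable_subset[rotated]) (auto simp: I_def)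
  then have countX: "countable (X i)" for i using X countable_subset by blast
  have "countable (requirements a)" for a unfolding requirements_def by (intro countable_Un) auto
  then have "countable \<S>"
    unfolding \<S>_def using \<open>countable I\<close> countX countable_envs[OF count]
    by (intro countable_Un countable_UN countable_image) auto
  have dense: "\<exists>q\<in>conds. ext p q \<and> q \<in> S" if S: "S \<in> \<S>" and p: "p \<in> conds" for S p
  proof -
    have point: "\<exists>q\<in>conds. ext p q \<and> mem M x (fst q)" if "x \<in> X i" "p \<in> conds" for i x p
      using add_point[OF that(2)] that(1) X I_univ by blast
    from S consider x where "x \<in> I" "S = {q. mem M x (fst q)}"
      | a Q e where "a \<in> Collect Sigma_b1" "Q \<in> requirements a" "e \<in> envs"
          "S = {q. Q B (fst q) (snd q) e}"
      | i x where "x \<in> X i" "S = lower i x" | i x where "x \<in> X i" "S = upper i x"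
      | i x y where "x \<in> X i" "y \<in> X i" "S = between i x y"
      unfolding \<S>_def by (elim UnE imageE UN_E) assumption+
    then show ?thesis
    proof cases
      case 1
      then show ?thesis using add_point[OF p I_univ[OF 1(1)]] by simp
    next
      case 2
      from extend_dense[OF dense_requirements_M[OF _ 2(2)] envs_I[OF 2(3)] p] show ?thesis
        using 2(1) unfolding 2(4) by simp
    next
      case 3
      \<comment> \<open>\<open>x\<close> is put into the condition before the fresh point is chosen,
        so that freshness refers to the enlarged set and the new point can be placed relative to
        \<open>x\<close>.\<close>
      obtain q where q: "q \<in> conds" "ext p q" "mem M x (fst q)" using point[OF 3(1) p] by blast
      obtain z where z: "z \<in> X i" "\<not> mem M z (fst q)" using fresh[OF q(1)] by blast
      obtain q' where q': "q' \<in> conds" "ext q q'" "mem M z (fst q')" "rel M (snd q') z x"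
        using place_point(2)[OF q(1) _ z(2) _ q(3)] z(1) 3(1) X by blast
      have "mem M x (fst q')" using q'(2) q(3) 3(1) X I_univ by (auto simp: ext_def sub_def)
      then show ?thesis unfolding 3(2) lower_def using q' z(1) ext_trans[OF q(2) q'(2)] by blast
    next
      case 4
      obtain q where q: "q \<in> conds" "ext p q" "mem M x (fst q)" using point[OF 4(1) p] by blast
      obtain z where z: "z \<in> X i" "\<not> mem M z (fst q)" using fresh[OF q(1)] by blast
      obtain q' where q': "q' \<in> conds" "ext q q'" "mem M z (fst q')" "rel M (snd q') x z"
        using place_point(1)[OF q(1) _ z(2) _ q(3)] z(1) 4(1) X by blast
      have "mem M x (fst q')" using q'(2) q(3) 4(1) X I_univ by (auto simp: ext_def sub_def)
      then show ?thesis unfolding 4(2) upper_def using q' z(1) ext_trans[OF q(2) q'(2)] by blast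
    next
      case 5
      have xy: "x \<in> I" "y \<in> I" "x \<in> univ M" "y \<in> univ M" using 5(1,2) X I_univ by blast+
      obtain q0 where q0: "q0 \<in> conds" "ext p q0" "mem M x (fst q0)" using point[OF 5(1) p] by blast
      obtain q where q: "q \<in> conds" "ext q0 q" "mem M y (fst q)" using point[OF 5(2) q0(1)] by blast
      have x: "mem M x (fst q)" using q(2) q0(3) xy by (auto simp: ext_def sub_def)
      have pq: "ext p q" using ext_trans[OF q0(2) q(2)] .
      show ?thesis
      \<comment> \<open>With both points in the condition their order is settled. Unless
        \<open>x\<close> precedes \<open>y\<close>, the requirement holds vacuously at
        \<open>q\<close>.\<close>
      proof (cases "rel M (snd q) x y")
        case False
        then show ?thesis unfolding 5(3) between_def using q x pq by blast
      next
        case True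
        obtain z where z: "z \<in> X i" "\<not> mem M z (fst q)" using fresh[OF q(1)] by blast
        obtain q' where q': "q' \<in> conds" "ext q q'" "mem M z (fst q')" "rel M (snd q') x z" "rel M (snd q') z y"
          using place_point(3)[OF q(1) _ z(2) xy(1) x xy(4) q(3) True] z(1) X by blast
        have "mem M x (fst q')" "mem M y (fst q')" using q'(2) q(3) x xy by (auto simp: ext_def sub_def)
        then show ?thesis unfolding 5(3) between_def using q' z(1) ext_trans[OF pq q'(2)] by blast
      qed
    qed
  qed
  have "\<exists>G :: nat \<Rightarrow> 'a \<times> 'a. (\<forall>j. G j \<in> conds) \<and> (\<forall>i j. i \<le> j \<longrightarrow> ext (G i) (G j)) \<and>
      (\<forall>S\<in>\<S>. \<exists>j. G j \<in> S)"
    by (rule ex_generic[OF \<open>countable \<S>\<close>]) (rule dense)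
  then obtain G :: "nat \<Rightarrow> 'a \<times> 'a" where G1: "\<forall>j. G j \<in> conds" and G2: "\<forall>i j. i \<le> j \<longrightarrow> ext (G i) (G j)"
    and G3: "\<forall>S\<in>\<S>. \<exists>j. G j \<in> S"
    by blast
  note chain = G1[rule_format] G2[rule_format] G3[rule_format]
  interpret generic M n B G
  proof
    show "G j \<in> conds" "i \<le> j \<Longrightarrow> ext (G i) (G j)" for i j using chain(1,2) by simp_all
    show "\<exists>j. mem M x (fst (G j))" if "x \<in> I" for x
      using chain(3)[of "{q. mem M x (fst q)}"] that by (auto simp: \<S>_def)
    show "\<exists>j. Q B (fst (G j)) (snd (G j)) e"
      if "Sigma_b1 a" "e \<in> envs" "Q \<in> requirements a" for a Q e
    proof -
      have a: "a \<in> Collect Sigma_b1" using that(1) by simp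
      have "{q. Q B (fst q) (snd q) e} \<in> \<S>" unfolding \<S>_def
        by (rule UnI1, rule UnI2, rule UN_I[OF a], rule UN_I[OF that(3)], rule imageI[OF that(2)])
      from chain(3)[OF this] show ?thesis by simp
    qed
  qed
  have "DLO (X i) R" for i
  proof (rule DLO_R[OF X])
    show "\<exists>j. mem M x (fst (G j)) \<and> (\<exists>z\<in>X i. mem M z (fst (G j)) \<and> rel M (snd (G j)) z x)" if "x \<in> X i" for x
    proof -
      have "lower i x \<in> \<S>" unfolding \<S>_def using that by (intro UnI2) auto
      from chain(3)[OF this] show ?thesis by (simp add: lower_def)
    qed
    show "\<exists>j. mem M x (fst (G j)) \<and> (\<exists>z\<in>X i. mem M z (fst (G j)) \<and> rel M (snd (G j)) x z)" if "x \<in> X i" for x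
    proof -
      have "upper i x \<in> \<S>" unfolding \<S>_def using that by (intro UnI2) auto
      from chain(3)[OF this] show ?thesis by (simp add: upper_def)
    qed
    show "\<exists>j. mem M x (fst (G j)) \<and> mem M y (fst (G j)) \<and> (rel M (snd (G j)) x y \<longrightarrow>
        (\<exists>z\<in>X i. mem M z (fst (G j)) \<and> rel M (snd (G j)) x z \<and> rel M (snd (G j)) z y))"
      if "x \<in> X i" "y \<in> X i" for x y
    proof -
      have "between i x y \<in> \<S>" unfolding \<S>_def using that by (intro UnI2) auto
      from chain(3)[OF this] show ?thesis by (simp add: between_def)
    qed
  qed
  then show ?thesis using model_N by blast
qed

theorem theorem4p11:
  fixes M :: "'a L_structure" and n :: 'a and X :: "nat \<Rightarrow> 'a set"
  assumes "models_true_arithmetic M" and "countable (univ M)"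
    and "nonstandard M n"
    and "\<And>i. X i \<subseteq> univ (small_cut M n)"
    and "\<And>i. \<exists>d p f. nonstandard M d \<and> is_power M (len M n) d p \<and>
           definable_injection M f (below M p) (X i)"
  shows "\<exists>R. is_model (small_cut M n) R (T12 \<union> PHP_Delta_b1) \<and> (\<forall>i. DLO (X i) R)"
proof -
  \<comment> \<open>The power attached to any one of the sets serves to define \<open>B\<close> and
    supplies the formula for exponentiation.\<close>
  obtain d p where d: "nonstandard M d" "is_power M (len M n) d p" using assms(5) by blast
  interpret true_arith_power M
  proof
    show "models_true_arithmetic M" by (rule assms(1))
    show "\<exists>a. defines_power a" using d(2) unfolding is_power_def by blast
  qed
  have n: "n \<in> univ M" using assms(3) by (simp add: nonstandard_def)
  have two: "leq M (add M (un M) (un M)) (len M n)"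
    using power_factsD(2)[OF n standard_lt_nonstandard[OF assms(3)]] .
  have u: "len M n \<in> univ M" "d \<in> univ M" "p \<in> univ M" using is_powerD[OF d(2)] by simp_all
  \<comment> \<open>All numbers of length at most \<open>p\<close> lie below \<open>B\<close>. This
    includes the cut, as \<open>p\<close> exceeds every power of \<open>len M n\<close> with
    standard exponent.\<close>
  obtain B where B: "B \<in> univ M" "\<forall>z\<in>univ M. leq M (len M z) p \<longrightarrow> lt M z B"
    using basic_unary(5)[OF u(3)] by blast
  interpret cut M n B
  proof
    show "n \<in> univ M" "leq M (add M (un M) (un M)) (len M n)" "B \<in> univ M" using n two B by simp_all
    fix x c assume x: "x \<in> univ M" "leq M (len M x) (mpow M (len M n) c)"
    have "lt M (mpow M (len M n) c) p"
      by (rule power_factsD(5)[OF u two d(2) standard_lt_nonstandard[OF d(1)]])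
    then have "leq M (len M x) p"
      using leq_trans[OF x(2)] mpow_univ[OF u(1)] len_univ[OF x(1)] u(3) by (simp add: lt_def)
    then show "lt M x B" using B x by blast
  qed
  have "\<exists>z\<in>X i. \<not> mem M z (fst q)" if "q \<in> conds" for i q
  proof -
    obtain d p f where "nonstandard M d" "is_power M (len M n) d p" "definable_injection M f (below M p) (X i)"
      using assms(5)[of i] by (elim exE conjE)
    then show ?thesis using that by (rule fresh_point)
  qed
  then show ?thesis
    unfolding small_cut_eq by (rule ex_expansion[OF assms(2) assms(4)[unfolded univ_small_cut]])
qed

end
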